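(* Let $\mathcal W=\{(T,y_0): 0<T<\infty,\ y_0\in X\setminus\{0\}\}$ and let $\mathcal W_{1,1},\mathcal W_{1,2},\mathcal W_{2,1},\dots,\mathcal W_{2,4},\mathcal W_{3,1},\dots,\mathcal W_{3,4}\subset\mathcal W$ be the subsets defined in the context. Then: (i) $\mathcal W$ is the disjoint union of the subsets $\mathcal W_{1,j}$ ($j=1,2$), $\mathcal W_{2,j}$ ($j=1,2,3,4$), $\mathcal W_{3,j}$ ($j=1,2,3,4$). (ii) For each $(T,y_0)\in\mathcal W_{1,2}\cup\mathcal W_{2,4}\cup\mathcal W_{3,3}$, the problem $(NP)^{T,y_0}$ has the bang-bang property and the null control is its unique minimal norm control. (iii) Suppose that the following two conditions hold: (a) there is $p_0\in[2,\infty)$ so that $\mathcal A_{p_0}(T,\hat t)\subset\mathcal A_\infty(T,\hat t)$ for all $0<\hat t<T<\infty$; (b) whenever $T\in(0,\infty)$, $E\subset(0,T)$ is a measurable set of positive measure and $f\in Y_T$ satisfies $f=0$ over $E$, then $f=0$ over $(0,T)$. Then for each $(T,y_0)\in\mathcal W_{2,3}\cup\mathcal W_{3,2}$, $(NP)^{T,y_0}$ has the bang-bang property and the null control is not a minimal norm control to this problem. (iv) For each $(T,y_0)\in\mathcal W_{1,1}\cup\mathcal W_{2,1}\cup\mathcal W_{3,1}\cup\mathcal W_{3,4}$, $(NP)^{T,y_0}$ has no admissible control and does not hold the bang-bang property. (v) For each $(T,y_0)\in\mathcal W_{2,2}$, $(NP)^{T,y_0}$ has at least one minimal norm control.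
   Context: Setting. $\mathbb R^+=[0,\infty)$. $X$ (state space) and $U$ (control space) are real Hilbert spaces. $A:D(A)\subset X\to X$ generates a $C_0$-semigroup $\{S(t)\}_{t\ge 0}$ on $X$; $S^*(t)$ is the adjoint semigroup, generated by $A^*$. $X_{-1}=D(A^* )'$ is the dual of $D(A^* )$ with respect to the pivot space $X$, and $S_{-1}(t)$ is the extension of $S(t)$ to $X_{-1}$. $B\in\mathcal L(U,X_{-1})$, $B\ne 0$, is an admissible control operator: for each $\hat t\in(0,\infty)$ there is $C(\hat t)>0$ with $\|\int_0^{\hat t}S_{-1}(\hat t-\tau)Bu(\tau)\,d\tau\|_X\le C(\hat t)\|u\|_{L^2(0,\hat t;U)}$ for all $u\in L^2_{loc}(\mathbb R^+;U)$. $B^*\in\mathcal L(D(A^* ),U)$ is its adjoint. For $y_0\in X$, $T\in(0,\infty)$, $v\in L^2(0,T;U)$, put $\hat y(t;y_0,v)=S(t)y_0+\int_0^tS_{-1}(t-\tau)Bv(\tau)\,d\tau$, $t\in[0,T]$ (the solution in $C([0,T];X)$ of $y'=Ay+Bv$, $y(0)=y_0$). For $u\in L^\infty(\mathbb R^+;U)$, $y(t;y_0,u)$, $t\ge0$, denotes the same expression with $v$ replaced by $u$. Minimal norm problem. For $T\in(0,\infty)$, $y_0\in X\setminus\{0\}$, $(NP)^{T,y_0}$: $N(T,y_0)=\inf\{\|v\|_{L^\infty(0,T;U)}: v\in L^\infty(0,T;U),\ \hat y(T;y_0,v)=0\}$ (with $\inf\emptyset=\infty$). An admissible control is $v\in L^\infty(0,T;U)$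 with $\hat y(T;y_0,v)=0$; a minimal norm control is an admissible control $v^*$ with $\|v^*\|_{L^\infty(0,T;U)}=N(T,y_0)$. $(NP)^{T,y_0}$ has the bang-bang property if it has an admissible control and every minimal norm control $v^*$ satisfies $\|v^*(t)\|_U=N(T,y_0)$ for a.e. $t\in(0,T)$; if there is no admissible control, the bang-bang property is said not to hold. The function $T\mapsto N(T,y_0)$ is decreasing on $(0,\infty)$ and is extended by $N(\infty,y_0)=\lim_{t\to\infty}N(t,y_0)$, $N(0,y_0)=\lim_{t\to0^+}N(t,y_0)$. For $y_0\in X$: $T^0(y_0)=\inf\{\hat t\in\mathbb R^+:\exists u\in L^\infty(\mathbb R^+;U)\text{ s.t. }y(\hat t;y_0,u)=0\}$ and $T^1(y_0)=\inf\{\hat t\in\mathbb R^+: S(\hat t)y_0=0\}$ ($\inf\emptyset=\infty$). Spaces. $\mathcal A_{p_0}(T,\hat t)=\{\hat y(T;0,u):u\in L^{p_0}(0,T;U),\ u|_{(\hat t,T)}=0\}$; $\mathcal A_\infty(T,\hat t)=\{\hat y(T;0,v):v\in L^\infty(0,T;U),\ v|_{(0,\hat t)}=0\}$. $Y_T$ is the closure in $L^1(0,T;U)$ of $X_T=\{B^*S^*(T-\cdot)z|_{(0,T)}:z\in D(A^* )\}$. Subsets of $\mathcal W$. $\mathcal W_1=\{(T,y_0)\in\mathcal W:N(T^0(y_0),y_0)=0\}$, $\mathcal W_2=\{(T,y_0)\in\mathcal W:0<N(T^0(y_0),y_0)<\infty\}$, $\mathcal W_3=\{(T,y_0)\in\mathcal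 W:N(T^0(y_0),y_0)=\infty\}$. $\mathcal W_{1,1}=\{(T,y_0)\in\mathcal W_1:T<T^0(y_0)\}$, $\mathcal W_{1,2}=\{(T,y_0)\in\mathcal W_1:T\ge T^0(y_0)\}$. $\mathcal W_{2,1}=\{(T,y_0)\in\mathcal W_2:T<T^0(y_0)\}$, $\mathcal W_{2,2}=\{(T,y_0)\in\mathcal W_2:T=T^0(y_0)\}$, $\mathcal W_{2,3}=\{(T,y_0)\in\mathcal W_2:T^0(y_0)<T<T^1(y_0)\}$, $\mathcal W_{2,4}=\{(T,y_0)\in\mathcal W_2:T^0(y_0)<T,\ T\ge T^1(y_0)\}$. $\mathcal W_{3,1}=\{(T,y_0)\in\mathcal W_3:T^0(y_0)<\infty,\ T\le T^0(y_0)\}$, $\mathcal W_{3,2}=\{(T,y_0)\in\mathcal W_3:T^0(y_0)<\infty,\ T^0(y_0)<T<T^1(y_0)\}$, $\mathcal W_{3,3}=\{(T,y_0)\in\mathcal W_3:T^0(y_0)<\infty,\ T^0(y_0)<T,\ T\ge T^1(y_0)\}$, $\mathcal W_{3,4}=\{(T,y_0)\in\mathcal W_3:T^0(y_0)=\infty\}$. *)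

theory Defs
  imports "HOL-Analysis.Analysis" "HOL-Probability.Essential_Supremum"
begin

section \<open>Vector-valued Lebesgue spaces\<close>

text \<open>
  The control space is an arbitrary, possibly non-separable, Hilbert space, so that measurability
  has to mean strong measurability. This is \<^const>\<open>measurable_on\<close>: almost everywhere limit of a
  sequence of continuous functions. Elements of \<open>L\<^sup>p\<close> are represented by functions on the whole
  real line, whose values outside the interval in question are irrelevant; equality in \<open>L\<^sup>p\<close> is
  equality almost everywhere and is always written out as such.
\<close>

definition Lp :: "real \<Rightarrow> real set \<Rightarrow> (real \<Rightarrow> 'u::real_normed_vector) set" where
  "Lp p I = {f. f measurable_on I \<and> integrable (lebesgue_on I) (\<lambda>t. norm (f t) powr p)}"

definition Lp_norm :: "real \<Rightarrow> real set \<Rightarrow> (real \<Rightarrow> 'u::real_normed_vector) \<Rightarrow> real" where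
  "Lp_norm p I f = (LINT t|lebesgue_on I. norm (f t) powr p) powr (1 / p)"

definition Linf_norm :: "real set \<Rightarrow> (real \<Rightarrow> 'u::real_normed_vector) \<Rightarrow> ereal" where
  "Linf_norm I f = esssup (lebesgue_on I) (\<lambda>t. ereal (norm (f t)))"

definition Linf :: "real set \<Rightarrow> (real \<Rightarrow> 'u::real_normed_vector) set" where
  "Linf I = {f. f measurable_on I \<and> Linf_norm I f < \<infinity>}"

definition L2_loc :: "(real \<Rightarrow> 'u::real_normed_vector) set" where
  "L2_loc = {f. \<forall>T>0. f \<in> Lp 2 {0<..<T}}"


section \<open>Semigroups, adjoints and the extrapolation space\<close>

definition C0_semigroup :: "(real \<Rightarrow> 'x::real_normed_vector \<Rightarrow>\<^sub>L 'x) \<Rightarrow> bool" where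
  "C0_semigroup S \<longleftrightarrow>
     S 0 = id_blinfun \<and>
     (\<forall>s\<ge>0. \<forall>t\<ge>0. S (s + t) = S s o\<^sub>L S t) \<and>
     (\<forall>x. ((\<lambda>t. S t x) \<longlongrightarrow> x) (at_right 0))"

definition generates ::
    "'x set \<Rightarrow> ('x \<Rightarrow> 'x) \<Rightarrow> (real \<Rightarrow> 'x::real_normed_vector \<Rightarrow>\<^sub>L 'x) \<Rightarrow> bool" where
  "generates D A S \<longleftrightarrow>
     D = {x. \<exists>y. ((\<lambda>t. (S t x - x) /\<^sub>R t) \<longlongrightarrow> y) (at_right 0)} \<and>
     (\<forall>x\<in>D. ((\<lambda>t. (S t x - x) /\<^sub>R t) \<longlongrightarrow> A x) (at_right 0))"

text \<open>
  The data of a control system: \<open>D(A)\<close>, \<open>A\<close>, the semigroup, and \<open>B\<close>. An element of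
  \<open>X\<^sub>-\<^sub>1 = D(A\<^sup>*)'\<close> is a functional on \<open>X\<close> that is only meaningful on \<open>D(A\<^sup>*)\<close>, hence the type of \<open>B\<close>.
\<close>

record (overloaded) ('x, 'u) ctrl_sys =
  dom_gen :: "'x::real_normed_vector set"
  gen :: "'x \<Rightarrow> 'x"
  sg :: "real \<Rightarrow> 'x \<Rightarrow>\<^sub>L 'x"
  ctrl :: "'u \<Rightarrow> 'x \<Rightarrow> real"

definition dom_adj :: "('x::real_inner, 'u) ctrl_sys \<Rightarrow> 'x set" where
  "dom_adj \<Sigma> = {z. \<exists>w. \<forall>x\<in>dom_gen \<Sigma>. gen \<Sigma> x \<bullet> z = x \<bullet> w}"

definition gen_adj :: "('x::real_inner, 'u) ctrl_sys \<Rightarrow> 'x \<Rightarrow> 'x" where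
  "gen_adj \<Sigma> z = (THE w. \<forall>x\<in>dom_gen \<Sigma>. gen \<Sigma> x \<bullet> z = x \<bullet> w)"

definition sg_adj :: "('x::real_inner, 'u) ctrl_sys \<Rightarrow> real \<Rightarrow> 'x \<Rightarrow> 'x" where
  "sg_adj \<Sigma> t = adjoint (blinfun_apply (sg \<Sigma> t))"

definition graph_norm :: "('x::real_inner, 'u) ctrl_sys \<Rightarrow> 'x \<Rightarrow> real" where
  "graph_norm \<Sigma> z = sqrt ((norm z)\<^sup>2 + (norm (gen_adj \<Sigma> z))\<^sup>2)"

text \<open>
  \<open>X\<^sub>-\<^sub>1\<close> is the set of linear functionals on \<open>D(A\<^sup>*)\<close> that are bounded for the graph norm;
  extensionality makes equality of functionals on \<open>D(A\<^sup>*)\<close> coincide with logical equality.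
\<close>

definition Xm1 :: "('x::real_inner, 'u) ctrl_sys \<Rightarrow> ('x \<Rightarrow> real) set" where
  "Xm1 \<Sigma> = {\<phi> \<in> extensional (dom_adj \<Sigma>).
     (\<forall>z\<in>dom_adj \<Sigma>. \<forall>w\<in>dom_adj \<Sigma>. \<phi> (z + w) = \<phi> z + \<phi> w) \<and>
     (\<forall>c. \<forall>z\<in>dom_adj \<Sigma>. \<phi> (c *\<^sub>R z) = c * \<phi> z) \<and>
     (\<exists>C. \<forall>z\<in>dom_adj \<Sigma>. \<bar>\<phi> z\<bar> \<le> C * graph_norm \<Sigma> z)}"

text \<open>The embedding of the pivot space \<open>X\<close> into \<open>X\<^sub>-\<^sub>1\<close>, and its (partial) inverse.\<close>

definition embed :: "('x::real_inner, 'u) ctrl_sys \<Rightarrow> 'x \<Rightarrow> 'x \<Rightarrow> real" where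
  "embed \<Sigma> x = (\<lambda>z\<in>dom_adj \<Sigma>. x \<bullet> z)"

definition to_X :: "('x::real_inner, 'u) ctrl_sys \<Rightarrow> ('x \<Rightarrow> real) \<Rightarrow> 'x" where
  "to_X \<Sigma> = inv (embed \<Sigma>)"

text \<open>
  The extension of the semigroup to \<open>X\<^sub>-\<^sub>1\<close> acts by duality; it sends \<open>embed \<Sigma> x\<close> to
  \<open>embed \<Sigma> (S(t) x)\<close>.
\<close>

definition sg_ext ::
    "('x::real_inner, 'u) ctrl_sys \<Rightarrow> real \<Rightarrow> ('x \<Rightarrow> real) \<Rightarrow> 'x \<Rightarrow> real" where
  "sg_ext \<Sigma> t \<phi> = (\<lambda>z\<in>dom_adj \<Sigma>. \<phi> (sg_adj \<Sigma> t z))"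

text \<open>
  The integral over \<open>(0, t)\<close> of a function with values in \<open>X\<^sub>-\<^sub>1\<close>, a space of functionals, is taken
  pointwise on \<open>D(A\<^sup>*)\<close>. For Bochner integrable functions this is the Bochner integral, since that
  one commutes with the evaluations at points of \<open>D(A\<^sup>*)\<close>, and these separate \<open>X\<^sub>-\<^sub>1\<close>.
\<close>

definition Xm1_integral ::
    "('x::real_inner, 'u) ctrl_sys \<Rightarrow> real \<Rightarrow> (real \<Rightarrow> 'x \<Rightarrow> real) \<Rightarrow> 'x \<Rightarrow> real" where
  "Xm1_integral \<Sigma> t F = (\<lambda>z\<in>dom_adj \<Sigma>. LINT \<tau>|lebesgue_on {0<..<t}. F \<tau> z)"

definition input_integral ::
    "('x::real_inner, 'u) ctrl_sys \<Rightarrow> real \<Rightarrow> (real \<Rightarrow> 'u) \<Rightarrow> 'x \<Rightarrow> real" where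
  "input_integral \<Sigma> t u = Xm1_integral \<Sigma> t (\<lambda>\<tau>. sg_ext \<Sigma> (t - \<tau>) (ctrl \<Sigma> (u \<tau>)))"

definition bounded_into_Xm1 ::
    "('x::real_inner, 'u::real_normed_vector) ctrl_sys \<Rightarrow> ('u \<Rightarrow> 'x \<Rightarrow> real) \<Rightarrow> bool" where
  "bounded_into_Xm1 \<Sigma> L \<longleftrightarrow>
     (\<forall>u. L u \<in> Xm1 \<Sigma>) \<and>
     (\<forall>u v. \<forall>z\<in>dom_adj \<Sigma>. L (u + v) z = L u z + L v z) \<and>
     (\<forall>c u. \<forall>z\<in>dom_adj \<Sigma>. L (c *\<^sub>R u) z = c * L u z) \<and>
     (\<exists>C. \<forall>u. \<forall>z\<in>dom_adj \<Sigma>. \<bar>L u z\<bar> \<le> C * norm u * graph_norm \<Sigma> z)"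

text \<open>The estimate includes the assertion that the integral, a priori in \<open>X\<^sub>-\<^sub>1\<close>, lies in \<open>X\<close>.\<close>

definition admissible_ctrl_op ::
    "('x::real_inner, 'u::real_normed_vector) ctrl_sys \<Rightarrow> bool" where
  "admissible_ctrl_op \<Sigma> \<longleftrightarrow>
     (\<forall>t>0. \<exists>C>0. \<forall>u\<in>L2_loc. input_integral \<Sigma> t u \<in> range (embed \<Sigma>) \<and>
        norm (to_X \<Sigma> (input_integral \<Sigma> t u)) \<le> C * Lp_norm 2 {0<..<t} u)"

definition control_system ::
    "('x::{real_inner, banach}, 'u::{real_inner, banach}) ctrl_sys \<Rightarrow> bool" where
  "control_system \<Sigma> \<longleftrightarrow>
     C0_semigroup (sg \<Sigma>) \<and> generates (dom_gen \<Sigma>) (gen \<Sigma>) (sg \<Sigma>) \<and>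
     bounded_into_Xm1 \<Sigma> (ctrl \<Sigma>) \<and>
     (\<exists>u. \<exists>z\<in>dom_adj \<Sigma>. ctrl \<Sigma> u z \<noteq> 0) \<and>
     admissible_ctrl_op \<Sigma>"

definition ctrl_adj :: "('x::real_inner, 'u::real_inner) ctrl_sys \<Rightarrow> 'x \<Rightarrow> 'u" where
  "ctrl_adj \<Sigma> z = (THE w. \<forall>u. u \<bullet> w = ctrl \<Sigma> u z)"


section \<open>The minimal norm problem\<close>

text \<open>
  \<open>state \<Sigma> t y0 v\<close> only depends on the values of \<open>v\<close> on \<open>(0, t)\<close>; it serves both as
  \<open>\<hat>y(t; y\<^sub>0, v)\<close>, for a control \<open>v\<close> on \<open>(0, T)\<close> with \<open>t \<le> T\<close>, and as \<open>y(t; y\<^sub>0, u)\<close>, for a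
  control \<open>u\<close> on the half-line.
\<close>

definition state :: "('x::real_inner, 'u) ctrl_sys \<Rightarrow> real \<Rightarrow> 'x \<Rightarrow> (real \<Rightarrow> 'u) \<Rightarrow> 'x" where
  "state \<Sigma> t y0 v = sg \<Sigma> t y0 + to_X \<Sigma> (input_integral \<Sigma> t v)"

definition admissible_control ::
    "('x::real_inner, 'u::real_normed_vector) ctrl_sys \<Rightarrow> real \<Rightarrow> 'x \<Rightarrow> (real \<Rightarrow> 'u) \<Rightarrow> bool" where
  "admissible_control \<Sigma> T y0 v \<longleftrightarrow> v \<in> Linf {0<..<T} \<and> state \<Sigma> T y0 v = 0"

definition min_norm ::
    "('x::real_inner, 'u::real_normed_vector) ctrl_sys \<Rightarrow> real \<Rightarrow> 'x \<Rightarrow> ereal" where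
  "min_norm \<Sigma> T y0 = Inf {Linf_norm {0<..<T} v | v. admissible_control \<Sigma> T y0 v}"

definition min_norm_ext ::
    "('x::real_inner, 'u::real_normed_vector) ctrl_sys \<Rightarrow> ereal \<Rightarrow> 'x \<Rightarrow> ereal" where
  "min_norm_ext \<Sigma> T y0 =
     (if T = \<infinity> then Lim at_top (\<lambda>t. min_norm \<Sigma> t y0)
      else if T = 0 then Lim (at_right 0) (\<lambda>t. min_norm \<Sigma> t y0)
      else min_norm \<Sigma> (real_of_ereal T) y0)"

definition minimal_norm_control ::
    "('x::real_inner, 'u::real_normed_vector) ctrl_sys \<Rightarrow> real \<Rightarrow> 'x \<Rightarrow> (real \<Rightarrow> 'u) \<Rightarrow> bool" where
  "minimal_norm_control \<Sigma> T y0 v \<longleftrightarrow>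
     admissible_control \<Sigma> T y0 v \<and> Linf_norm {0<..<T} v = min_norm \<Sigma> T y0"

definition bang_bang ::
    "('x::real_inner, 'u::real_normed_vector) ctrl_sys \<Rightarrow> real \<Rightarrow> 'x \<Rightarrow> bool" where
  "bang_bang \<Sigma> T y0 \<longleftrightarrow>
     (\<exists>v. admissible_control \<Sigma> T y0 v) \<and>
     (\<forall>v. minimal_norm_control \<Sigma> T y0 v \<longrightarrow>
        (AE t\<in>{0<..<T} in lebesgue. ereal (norm (v t)) = min_norm \<Sigma> T y0))"

definition T0 :: "('x::real_inner, 'u::real_normed_vector) ctrl_sys \<Rightarrow> 'x \<Rightarrow> ereal" where
  "T0 \<Sigma> y0 = Inf {ereal t | t. t \<ge> 0 \<and> (\<exists>u\<in>Linf {0<..}. state \<Sigma> t y0 u = 0)}"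

definition T1 :: "('x::real_inner, 'u) ctrl_sys \<Rightarrow> 'x \<Rightarrow> ereal" where
  "T1 \<Sigma> y0 = Inf {ereal t | t. t \<ge> 0 \<and> sg \<Sigma> t y0 = 0}"


section \<open>Spaces and subsets in the theorem\<close>

definition reach_p ::
    "('x::real_inner, 'u::real_normed_vector) ctrl_sys \<Rightarrow> real \<Rightarrow> real \<Rightarrow> real \<Rightarrow> 'x set" where
  "reach_p \<Sigma> p T t =
     {state \<Sigma> T 0 u | u. u \<in> Lp p {0<..<T} \<and> (AE s\<in>{t<..<T} in lebesgue. u s = 0)}"

definition reach_inf ::
    "('x::real_inner, 'u::real_normed_vector) ctrl_sys \<Rightarrow> real \<Rightarrow> real \<Rightarrow> 'x set" where
  "reach_inf \<Sigma> T t =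
     {state \<Sigma> T 0 v | v. v \<in> Linf {0<..<T} \<and> (AE s\<in>{0<..<t} in lebesgue. v s = 0)}"

definition X_space ::
    "('x::real_inner, 'u::real_inner) ctrl_sys \<Rightarrow> real \<Rightarrow> (real \<Rightarrow> 'u) set" where
  "X_space \<Sigma> T = {\<lambda>t. ctrl_adj \<Sigma> (sg_adj \<Sigma> (T - t) z) | z. z \<in> dom_adj \<Sigma>}"

definition Y_space ::
    "('x::real_inner, 'u::real_inner) ctrl_sys \<Rightarrow> real \<Rightarrow> (real \<Rightarrow> 'u) set" where
  "Y_space \<Sigma> T =
     {f \<in> Lp 1 {0<..<T}. \<forall>\<epsilon>>0. \<exists>g\<in>X_space \<Sigma> T. Lp_norm 1 {0<..<T} (\<lambda>t. f t - g t) < \<epsilon>}"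

context
  fixes \<Sigma> :: "('x::real_inner, 'u::real_normed_vector) ctrl_sys"
begin

definition W :: "(real \<times> 'x) set" where
  "W = {(T, y0). 0 < T \<and> y0 \<noteq> 0}"

definition W1 where "W1 = {(T, y0) \<in> W. min_norm_ext \<Sigma> (T0 \<Sigma> y0) y0 = 0}"
definition W2 where "W2 = {(T, y0) \<in> W. 0 < min_norm_ext \<Sigma> (T0 \<Sigma> y0) y0 \<and>
                                         min_norm_ext \<Sigma> (T0 \<Sigma> y0) y0 < \<infinity>}"
definition W3 where "W3 = {(T, y0) \<in> W. min_norm_ext \<Sigma> (T0 \<Sigma> y0) y0 = \<infinity>}"

definition W11 where "W11 = {(T, y0) \<in> W1. ereal T < T0 \<Sigma> y0}"
definition W12 where "W12 = {(T, y0) \<in> W1. ereal T \<ge> T0 \<Sigma> y0}"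

definition W21 where "W21 = {(T, y0) \<in> W2. ereal T < T0 \<Sigma> y0}"
definition W22 where "W22 = {(T, y0) \<in> W2. ereal T = T0 \<Sigma> y0}"
definition W23 where "W23 = {(T, y0) \<in> W2. T0 \<Sigma> y0 < ereal T \<and> ereal T < T1 \<Sigma> y0}"
definition W24 where "W24 = {(T, y0) \<in> W2. T0 \<Sigma> y0 < ereal T \<and> ereal T \<ge> T1 \<Sigma> y0}"

definition W31 where "W31 = {(T, y0) \<in> W3. T0 \<Sigma> y0 < \<infinity> \<and> ereal T \<le> T0 \<Sigma> y0}"
definition W32 where "W32 = {(T, y0) \<in> W3. T0 \<Sigma> y0 < \<infinity> \<and> T0 \<Sigma> y0 < ereal T \<and> ereal T < T1 \<Sigma> y0}"
definition W33 where "W33 = {(T, y0) \<in> W3. T0 \<Sigma> y0 < \<infinity> \<and> T0 \<Sigma> y0 < ereal T \<and> ereal T \<ge> T1 \<Sigma> y0}"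
definition W34 where "W34 = {(T, y0) \<in> W3. T0 \<Sigma> y0 = \<infinity>}"

end

end

theory Submission
  imports Defs
begin

text \<open>
  With \<open>obs T z \<tau> = B\<^sup>* S\<^sup>*(T - \<tau>) z\<close>, the state reached from \<open>0\<close> with control \<open>v\<close> is the vector \<open>x\<close> with
  \<open>x \<bullet> z = \<integral> v \<bullet> obs T z\<close> for all \<open>z \<in> D(A\<^sup>*)\<close>. Weak compactness of balls of controls is replaced by
  minimising a strictly convex integral over decreasing convex sets; hence minimal norms are attained,
  and \<open>N(T, y\<^sub>0) = 0\<close> forces \<open>S(T) y\<^sub>0 = 0\<close>.

  For the bang-bang property, separation yields \<open>z\<^sub>n\<close> with \<open>\<parallel>obs T z\<^sub>n\<parallel> \<le> 1\<close> in \<open>L\<^sup>1(0, T)\<close> and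
  \<open>- S(T) y\<^sub>0 \<bullet> z\<^sub>n\<close> tending to the minimal norm \<open>N\<close>. Condition (a) and a gliding hump argument give
  \<open>\<integral>\<^sub>E \<bar>obs T z\<bar> \<le> C \<bar>E\<bar>\<^bsup>1/p\<^esup> \<parallel>obs T z\<parallel>\<close> for \<open>E\<close> inside \<open>(0, t)\<close>, \<open>t < T\<close>, so that convex combinations of the
  \<open>obs T z\<^sub>n\<close> converge in \<open>L\<^sup>1(0, t)\<close> to some \<open>g \<in> Y\<^sub>t\<close>. Then \<open>N \<bar>g\<bar> = v \<bullet> g\<close> for every minimal norm control \<open>v\<close>,
  and \<open>g\<close> is nonzero almost everywhere by (b), because \<open>T\<^sup>0(y\<^sub>0) < t\<close> rules out \<open>g = 0\<close>.
\<close>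

section \<open>Hilbert spaces\<close>

text \<open>\<open>B\<close> takes values outside \<open>X\<close>, so every identity about states
  is tested against \<open>D'\<close>, the only place where \<open>B'\<close> is meaningful; the
  averaged orbits \<open>J h x\<close> supply the density that makes this enough. \<open>U\<close>
  may be non-separable, so strong measurability has to be carried through every limit, which is why
  limits of controls are taken almost everywhere and in \<open>L^1\<close>, never weakly. The
  obstacle in the bang-bang part is that the mass of \<open>obs T (z n)\<close> may concentrate at
  the final time \<open>T\<close>, where no compactness is available. Condition (a) controls only
  what happens on (0, t), in terms of the total mass on (t, T): this is why \<open>g\<close> lives
  on (0, t) with \<open>t < T\<close>, and why the norm of \<open>v\<close> is identified on each
  such interval before \<open>t\<close> tends to \<open>T\<close>. Moreover (a) bounds the pairing
  with \<open>obs T z\<close> for one control in \<open>L^p\<close> at a time; the gliding hump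
  makes the bound uniform over the unit ball of \<open>L^p\<close>, and testing with normalised
  signs supported in \<open>E\<close> turns it into uniform integrability.\<close>

lemma closest_point_variational:
  fixes p y :: "'a::real_inner"
  assumes "convex K" "p \<in> K" "x \<in> K" and min: "\<And>x. x \<in> K \<Longrightarrow> norm (y - p) \<le> norm (y - x)"
  shows "(y - p) \<bullet> (x - p) \<le> 0"
proof (rule ccontr)
  let ?a = "(y - p) \<bullet> (x - p)" and ?b = "(norm (x - p))\<^sup>2"
  assume "\<not> ?a \<le> 0"
  then have a: "?a > 0" by simp
  have b: "?b > 0" using a by auto
  \<comment> \<open>A step of size \<open>s\<close> from \<open>p\<close> towards \<open>x\<close>
    changes the squared distance to \<open>y\<close> by \<open>- 2 * s * ?a + s^2 * ?b\<close>,
    which is negative as soon as \<open>s * ?b \<le> ?a\<close>.\<close>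
  define s where "s = min 1 (?a / ?b)"
  have s: "0 < s" "s \<le> 1" "s * ?b \<le> ?a"
    using a b by (auto simp: s_def min_def field_simps)
  have "(1 - s) *\<^sub>R p + s *\<^sub>R x \<in> K"
    using assms s by (intro convexD) auto
  then have "(norm (y - p))\<^sup>2 \<le> (norm (y - ((1 - s) *\<^sub>R p + s *\<^sub>R x)))\<^sup>2"
    using min by (intro power_mono) auto
  also have "y - ((1 - s) *\<^sub>R p + s *\<^sub>R x) = (y - p) - s *\<^sub>R (x - p)"
    by (simp add: algebra_simps)
  also have "(norm ((y - p) - s *\<^sub>R (x - p)))\<^sup>2 = (norm (y - p))\<^sup>2 - 2 * s * ?a + s\<^sup>2 * ?b"
    by (simp only: power2_norm_eq_inner inner_diff_left inner_diff_right inner_scaleR_left inner_scaleR_right)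
       (simp add: inner_commute algebra_simps power2_eq_square)
  finally have "s * (2 * ?a) \<le> s * (s * ?b)" by (simp add: power2_eq_square)
  then have "2 * ?a \<le> s * ?b" using s(1) by (simp only: mult_le_cancel_left_pos)
  then show False using s a by linarith
qed

text \<open>Parallelogram identity: midpoints of a minimising sequence stay in \<open>K\<close>,
  hence at squared distance at least \<open>d\<close> from \<open>y\<close>, which forces the
  sequence to be Cauchy. Completeness stands in for compactness.\<close>

lemma ex_closest_point:
  fixes K :: "'a::{real_inner, banach} set"
  assumes "convex K" "closed K" "K \<noteq> {}"
  obtains p where "p \<in> K" "\<And>x. x \<in> K \<Longrightarrow> norm (y - p) \<le> norm (y - x)"
proof -
  define d where "d = (INF x\<in>K. (norm (y - x))\<^sup>2)"
  have bdd: "bdd_below ((\<lambda>x. (norm (y - x))\<^sup>2) ` K)" by (rule bdd_belowI[of _ 0]) auto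
  have d_le: "d \<le> (norm (y - x))\<^sup>2" if "x \<in> K" for x
    unfolding d_def using bdd that by (rule cINF_lower)
  have "\<exists>x\<in>K. (norm (y - x))\<^sup>2 < d + 1 / real (Suc n)" for n
    using cINF_less_iff[OF assms(3) bdd, of "d + 1 / real (Suc n)"] by (simp add: d_def)
  then obtain x where xK: "\<And>n. x n \<in> K" and x: "\<And>n. (norm (y - x n))\<^sup>2 < d + 1 / real (Suc n)"
    by metis
  have par: "(norm (x n - x m))\<^sup>2 \<le> 2 / real (Suc n) + 2 / real (Suc m)" for n m
  proof -
    have "(1/2) *\<^sub>R x n + (1/2) *\<^sub>R x m \<in> K" using assms(1) xK by (intro convexD) auto
    from d_le[OF this] have "4 * d \<le> 4 * (norm (y - ((1/2) *\<^sub>R x n + (1/2) *\<^sub>R x m)))\<^sup>2" by simp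
    also have "\<dots> = 2 * (norm (y - x n))\<^sup>2 + 2 * (norm (y - x m))\<^sup>2 - (norm (x n - x m))\<^sup>2"
      by (simp only: power2_norm_eq_inner inner_diff_left inner_diff_right inner_scaleR_left
          inner_scaleR_right inner_add_left inner_add_right)
         (simp add: inner_commute algebra_simps)
    finally show ?thesis using x[of n] x[of m] by simp
  qed
  have "Cauchy x"
  proof (rule metric_CauchyI)
    fix e :: real assume e: "e > 0"
    obtain M where M: "4 / e\<^sup>2 < real M" using reals_Archimedean2 by blast
    have "dist (x m) (x n) < e" if "m \<ge> M" "n \<ge> M" for m n
    proof -
      have *: "2 / real (Suc k) < e\<^sup>2 / 2" if "k \<ge> M" for k
      proof -
        have "4 / e\<^sup>2 < real (Suc k)" using M that by linarith
        then show ?thesis using e by (simp add: field_simps)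
      qed
      have "(norm (x m - x n))\<^sup>2 < e\<^sup>2" using par[of m n] *[of m] *[of n] that by simp
      then show ?thesis using e by (auto simp: dist_norm intro: power_less_imp_less_base)
    qed
    then show "\<exists>M. \<forall>m\<ge>M. \<forall>n\<ge>M. dist (x m) (x n) < e" by blast
  qed
  then obtain p where p: "x \<longlonglongrightarrow> p" using Cauchy_convergent convergent_def by blast
  have pK: "p \<in> K" using assms(2) xK p closed_sequentially by blast
  have "(\<lambda>n. (norm (y - x n))\<^sup>2) \<longlonglongrightarrow> (norm (y - p))\<^sup>2" by (intro tendsto_intros p)
  moreover have "(\<lambda>n. d + 1 / real (Suc n)) \<longlonglongrightarrow> d + 0"
    by (intro tendsto_add tendsto_const LIMSEQ_Suc[OF lim_1_over_n])
  ultimately have "(norm (y - p))\<^sup>2 \<le> d + 0"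
    by (rule LIMSEQ_le) (use x less_imp_le in blast)
  then have "norm (y - p) \<le> norm (y - z)" if "z \<in> K" for z
    using d_le[OF that] by (simp add: power2_le_imp_le)
  with pK that show thesis by blast
qed

text \<open>The variational inequality at \<open>p + v\<close> and at \<open>p - v\<close> gives
  both signs.\<close>

lemma orthogonal_to_subspace:
  fixes p y :: "'a::real_inner"
  assumes "subspace K" "p \<in> K" "\<And>x. x \<in> K \<Longrightarrow> norm (y - p) \<le> norm (y - x)" "v \<in> K"
  shows "(y - p) \<bullet> v = 0"
proof -
  have "p + v \<in> K" "p - v \<in> K" using assms by (auto simp: subspace_add subspace_diff)
  then have "(y - p) \<bullet> (p + v - p) \<le> 0" "(y - p) \<bullet> (p - v - p) \<le> 0"
    using closest_point_variational[OF subspace_imp_convex[OF assms(1)] assms(2)] assms(3) by blast+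
  then show ?thesis by simp
qed

text \<open>The residual \<open>a - p\<close> of some \<open>a\<close> outside the kernel spans the
  orthogonal complement of the kernel; rescaled, it is the representing vector.\<close>

lemma riesz_representation:
  fixes f :: "'a::{real_inner, banach} \<Rightarrow> real"
  assumes "bounded_linear f"
  obtains w where "\<And>x. f x = x \<bullet> w"
proof (cases "\<forall>x. f x = 0")
  case True
  then show ?thesis using that[of 0] by simp
next
  case False
  interpret bounded_linear f by fact
  obtain a where a: "f a \<noteq> 0" using False by blast
  let ?K = "f -` {0}"
  have sub: "subspace ?K" by (auto simp: subspace_def add scale)
  have "closed ?K" by (intro closed_vimage closed_singleton linear_continuous_on assms)
  moreover have "?K \<noteq> {}" using zero by (metis empty_iff singletonI vimageI)
  ultimately obtain p where p: "p \<in> ?K" "\<And>x. x \<in> ?K \<Longrightarrow> norm (a - p) \<le> norm (a - x)"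
    using ex_closest_point[OF subspace_imp_convex[OF sub], of a] by blast
  have orth: "(a - p) \<bullet> v = 0" if "f v = 0" for v
    using orthogonal_to_subspace[OF sub p] that by simp
  have fn: "f (a - p) \<noteq> 0" using a p by (simp add: diff)
  then have nn: "(a - p) \<bullet> (a - p) \<noteq> 0" by (auto simp: zero)
  show ?thesis
  proof (rule that)
    fix x
    have "f (x - (f x / f (a - p)) *\<^sub>R (a - p)) = 0" using fn by (simp add: diff scale)
    from orth[OF this] have "(a - p) \<bullet> x = f x / f (a - p) * ((a - p) \<bullet> (a - p))"
      by (simp add: inner_diff_right)
    then show "f x = x \<bullet> ((f (a - p) / ((a - p) \<bullet> (a - p))) *\<^sub>R (a - p))"
      using fn nn by (simp add: inner_commute)
  qed
qed

text \<open>\<open>adjoint\<close> is a choice among the functions that satisfy the adjoint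
  identity; Riesz representation, applied for every \<open>y\<close>, shows that there is
  one.\<close>

lemma inner_adjoint:
  fixes f :: "'a::{real_inner, banach} \<Rightarrow> 'b::real_inner"
  assumes "bounded_linear f"
  shows "x \<bullet> adjoint f y = f x \<bullet> y"
proof -
  have "\<exists>w. \<forall>x. f x \<bullet> y = x \<bullet> w" for y
    using riesz_representation[OF bounded_linear_inner_left_comp[OF assms, of y]] by metis
  then have "\<exists>g. \<forall>x y. f x \<bullet> y = x \<bullet> g y" by metis
  then have "\<forall>x y. f x \<bullet> y = x \<bullet> adjoint f y" unfolding adjoint_def by (rule someI_ex)
  then show ?thesis by metis
qed

text \<open>The residual of the projection onto \<open>closure D\<close> is orthogonal to
  \<open>D\<close>, so it is 0 by \<open>sep\<close>.\<close>

lemma dense_subspace: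
  fixes D :: "'a::{real_inner, banach} set"
  assumes "subspace D" and sep: "\<And>x. (\<And>z. z \<in> D \<Longrightarrow> x \<bullet> z = 0) \<Longrightarrow> x = 0"
  shows "closure D = UNIV"
proof -
  have sub: "subspace (closure D)"
  proof -
    have cl: "x \<in> closure D \<longleftrightarrow> (\<exists>f. (\<forall>n. f n \<in> D) \<and> f \<longlonglongrightarrow> x)" for x
      by (rule closure_sequential)
    show ?thesis
      unfolding subspace_def cl
    proof (intro conjI ballI allI; clarify?)
      show "\<exists>f. (\<forall>n. f n \<in> D) \<and> f \<longlonglongrightarrow> 0"
        using subspace_0[OF assms(1)] by (intro exI[of _ "\<lambda>_. 0"]) simp
    next
      fix x y assume "x \<in> closure D" "y \<in> closure D"
      then obtain f g where "\<forall>n. f n \<in> D" "\<forall>n. g n \<in> D" "f \<longlonglongrightarrow> x" "g \<longlonglongrightarrow> y"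
        unfolding cl by blast
      then show "\<exists>f. (\<forall>n. f n \<in> D) \<and> f \<longlonglongrightarrow> x + y"
        using subspace_add[OF assms(1)] by (intro exI[of _ "\<lambda>n. f n + g n"]) (auto intro: tendsto_add)
    next
      fix c x assume "x \<in> closure D"
      then obtain f where "\<forall>n. f n \<in> D" "f \<longlonglongrightarrow> x" unfolding cl by blast
      then show "\<exists>f. (\<forall>n. f n \<in> D) \<and> f \<longlonglongrightarrow> c *\<^sub>R x"
        using subspace_mul[OF assms(1)] by (intro exI[of _ "\<lambda>n. c *\<^sub>R f n"]) (auto intro: tendsto_intros)
    qed
  qed
  have "y \<in> closure D" for y
  proof -
    have "closure D \<noteq> {}" using subspace_0[OF sub] by (metis empty_iff)
    then obtain p where p: "p \<in> closure D" "\<And>x. x \<in> closure D \<Longrightarrow> norm (y - p) \<le> norm (y - x)"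
      using ex_closest_point[OF subspace_imp_convex[OF sub] closed_closure] by metis
    have "(y - p) \<bullet> z = 0" if "z \<in> D" for z
      using orthogonal_to_subspace[OF sub p] closure_subset that by blast
    then have "y - p = 0" by (rule sep)
    with p show ?thesis by simp
  qed
  then show ?thesis by blast
qed

text \<open>The hyperplane through the projection \<open>p\<close> of \<open>y\<close> onto
  \<open>closure K\<close>, with normal \<open>y - p\<close>, separates; the gap is the squared
  distance of \<open>y\<close> to \<open>p\<close>.\<close>

lemma separate_point_convex:
  fixes K :: "'a::{real_inner, banach} set"
  assumes "convex K" "K \<noteq> {}" "y \<notin> closure K"
  obtains \<zeta> c where "\<And>x. x \<in> K \<Longrightarrow> x \<bullet> \<zeta> \<le> c" "c < y \<bullet> \<zeta>"
proof -
  have cv: "convex (closure K)" using assms(1) by (rule convex_closure)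
  obtain p where p: "p \<in> closure K" "\<And>x. x \<in> closure K \<Longrightarrow> norm (y - p) \<le> norm (y - x)"
    using ex_closest_point[OF cv, of y] assms by auto
  show thesis
  proof (rule that)
    show "x \<bullet> (y - p) \<le> p \<bullet> (y - p)" if "x \<in> K" for x
      using closest_point_variational[OF cv p(1) _ p(2), of x] that closure_subset[of K]
      by (auto simp: inner_diff inner_commute)
    have "y \<noteq> p" using p assms by auto
    then have "(y - p) \<bullet> (y - p) > 0" by simp
    then show "p \<bullet> (y - p) < y \<bullet> (y - p)" by (simp add: inner_diff_left)
  qed
qed

section \<open>Strong measurability\<close>

lemma measurable_on_norm:
  assumes "f measurable_on S" "S \<in> sets lebesgue"
  shows "(\<lambda>t. norm (f t)) \<in> borel_measurable (lebesgue_on S)"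
proof -
  have "(norm \<circ> f) measurable_on S"
    by (rule measurable_on_compose_continuous_0[OF assms(1)]) (auto intro: continuous_intros)
  then show ?thesis
    using measurable_on_imp_borel_measurable_lebesgue[OF _ assms(2)] by (simp add: o_def)
qed

lemma measurable_on_inner:
  fixes f g :: "'a::euclidean_space \<Rightarrow> 'b::real_inner"
  assumes "f measurable_on S" "g measurable_on S" "S \<in> sets lebesgue"
  shows "(\<lambda>t. f t \<bullet> g t) \<in> borel_measurable (lebesgue_on S)"
proof -
  have "(\<lambda>t. f t \<bullet> g t) measurable_on S"
    by (rule measurable_on_combine[OF assms(1,2)]) (intro continuous_intros, simp)
  then show ?thesis
    using measurable_on_imp_borel_measurable_lebesgue[OF _ assms(3)] by blast
qed

lemma measurable_on_if:
  assumes "f measurable_on S" "E \<in> sets lebesgue"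
  shows "(\<lambda>t. if t \<in> E then f t else 0) measurable_on S"
proof -
  have "(\<lambda>t. if t \<in> S then f t else 0) measurable_on UNIV"
    using assms(1) by (simp add: measurable_on_UNIV)
  from measurable_on_restrict[OF this assms(2)]
  have "(\<lambda>t. if t \<in> S then if t \<in> E then f t else 0 else 0) measurable_on UNIV"
    by (rule back_subst[of "\<lambda>h. h measurable_on UNIV"]) auto
  then show ?thesis by (simp only: measurable_on_UNIV)
qed

lemma measurable_on_indicator:
  "f measurable_on S \<Longrightarrow> E \<in> sets lebesgue \<Longrightarrow> (\<lambda>t. indicat_real E t *\<^sub>R f t) measurable_on S"
  using measurable_on_if[of f S E] by (rule back_subst[of "\<lambda>h. h measurable_on S"]) (auto simp: indicator_def)

lemma measurable_on_subset:
  assumes "f measurable_on S" "E \<subseteq> S" "E \<in> sets lebesgue"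
  shows "f measurable_on E"
proof -
  have "(\<lambda>t. if t \<in> S then f t else 0) measurable_on UNIV"
    using assms(1) by (simp add: measurable_on_UNIV)
  from measurable_on_restrict[OF this assms(3)]
  have "(\<lambda>t. if t \<in> E then f t else 0) measurable_on UNIV"
    by (rule back_subst[of "\<lambda>h. h measurable_on UNIV"]) (use assms(2) in \<open>auto intro!: ext\<close>)
  then show ?thesis by (simp only: measurable_on_UNIV)
qed

lemma measurable_on_superset:
  assumes "f measurable_on E" "E \<subseteq> S" "\<And>t. t \<in> S - E \<Longrightarrow> f t = 0"
  shows "f measurable_on S"
proof -
  have "(\<lambda>t. if t \<in> E then f t else 0) measurable_on UNIV"
    using assms(1) by (simp add: measurable_on_UNIV)
  then have "(\<lambda>t. if t \<in> S then f t else 0) measurable_on UNIV"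
    by (rule back_subst[of "\<lambda>h. h measurable_on UNIV"]) (use assms(2,3) in \<open>auto intro!: ext\<close>)
  then show ?thesis by (simp only: measurable_on_UNIV)
qed

lemma AE_lebesgue_on_negligible:
  assumes "AE t in lebesgue_on S. P t" "S \<in> sets lebesgue"
  obtains N where "negligible N" "\<And>t. t \<in> S - N \<Longrightarrow> P t"
proof -
  have "AE t in lebesgue. t \<in> S \<longrightarrow> P t"
    using assms by (simp add: AE_restrict_space_iff)
  then obtain N where "{t \<in> space lebesgue. \<not> (t \<in> S \<longrightarrow> P t)} \<subseteq> N" "emeasure lebesgue N = 0" "N \<in> sets lebesgue"
    by (rule AE_E)
  then have "negligible N" "\<And>t. t \<in> S - N \<Longrightarrow> P t"
    by (auto simp: negligible_iff_emeasure0)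
  then show thesis by (rule that)
qed

text \<open>Sum and integral commute for nonnegative terms, so the series has a finite integral and
  is finite almost everywhere.\<close>

lemma AE_summable_of_integrals:
  fixes f :: "nat \<Rightarrow> 'a \<Rightarrow> real"
  assumes int: "\<And>n. integrable M (f n)" and nonneg: "\<And>n t. 0 \<le> f n t"
    and bound: "\<And>n. integral\<^sup>L M (f n) \<le> b n" and "summable b"
  shows "AE t in M. summable (\<lambda>n. f n t)"
proof -
  have "(\<integral>\<^sup>+ t. (\<Sum>n. ennreal (f n t)) \<partial>M) = (\<Sum>n. \<integral>\<^sup>+ t. ennreal (f n t) \<partial>M)"
    using int by (intro nn_integral_suminf) auto
  also have "\<dots> = (\<Sum>n. ennreal (integral\<^sup>L M (f n)))"
    using int nonneg by (intro suminf_cong nn_integral_eq_integral) auto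
  also have "\<dots> < top"
  proof -
    have "summable (\<lambda>n. integral\<^sup>L M (f n))"
      by (rule summable_comparison_test'[OF assms(4)])
         (use bound nonneg in \<open>auto intro: integral_nonneg\<close>)
    then show ?thesis
      using nonneg by (simp add: ennreal_suminf_neq_top integral_nonneg less_top[symmetric])
  qed
  finally have "AE t in M. (\<Sum>n. ennreal (f n t)) \<noteq> \<infinity>"
    using int by (intro nn_integral_PInf_AE) auto
  then show ?thesis
    by eventually_elim (use nonneg in \<open>auto intro: summable_suminf_not_top\<close>)
qed

text \<open>
  Continuous approximants of the \<open>f n\<close> are chosen \<open>2\<^sup>-\<^sup>n\<close>-close in measure, with respect to a finite
  measure equivalent to Lebesgue measure, so that their distances to the \<open>f n\<close> tend to \<open>0\<close> almost
  everywhere.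
\<close>

lemma measurable_on_AE_limit:
  fixes f :: "nat \<Rightarrow> 'a::euclidean_space \<Rightarrow> 'b::real_normed_vector"
  assumes f: "\<And>n. f n measurable_on S" and S: "S \<in> sets lebesgue"
    and lim: "AE t in lebesgue_on S. (\<lambda>n. f n t) \<longlonglongrightarrow> g t"
  shows "g measurable_on S"
proof -
  define F where "F n t = (if t \<in> S then f n t else 0)" for n t
  define G where "G t = (if t \<in> S then g t else 0)" for t
  have F: "F n measurable_on UNIV" for n
    using f by (simp add: F_def[abs_def] measurable_on_UNIV)
  have limF: "AE t in lebesgue. (\<lambda>n. F n t) \<longlonglongrightarrow> G t"
  proof -
    have "AE t in lebesgue. t \<in> S \<longrightarrow> (\<lambda>n. f n t) \<longlonglongrightarrow> g t"
      using lim S by (simp add: AE_restrict_space_iff)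
    then show ?thesis by eventually_elim (auto simp: F_def G_def)
  qed
  obtain w :: "'a \<Rightarrow> ennreal" where w: "w \<in> borel_measurable lebesgue" "integral\<^sup>N lebesgue w \<noteq> \<infinity>"
      "\<And>t. 0 < w t" "\<And>t. w t < \<infinity>"
  proof -
    obtain w :: "'a \<Rightarrow> ennreal" where "w \<in> borel_measurable lborel" "integral\<^sup>N lborel w \<noteq> \<infinity>"
        "\<And>t. 0 < w t" "\<And>t. w t < \<infinity>"
      using sigma_finite_measure.Ex_finite_integrable_function[OF sigma_finite_lborel] by auto
    then show thesis
      by (intro that[of w]) (auto simp: nn_integral_completion intro: measurable_completion)
  qed
  define \<nu> where "\<nu> = density lebesgue w"
  have AE\<nu>: "(AE t in \<nu>. P t) \<longleftrightarrow> (AE t in lebesgue. P t)" for P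
    unfolding \<nu>_def using w by (subst AE_density) auto
  interpret finite_measure \<nu>
    by (rule finite_measureI) (use w in \<open>simp add: \<nu>_def emeasure_density\<close>)
  have meas\<nu>: "borel_measurable \<nu> = (borel_measurable lebesgue :: ('a \<Rightarrow> real) set)"
    by (rule measurable_cong_sets) (auto simp: \<nu>_def)
  \<comment> \<open>Cutting the distance off at 1 makes it integrable for the finite measure
    \<open>\<nu>\<close> whatever the size of \<open>F n\<close>, and does not change which
    sequences tend to 0.\<close>
  have dist_meas: "(\<lambda>t. min 1 (norm (c t - F n t))) \<in> borel_measurable \<nu>" if "continuous_on UNIV c" for c n
  proof -
    have "(\<lambda>t. norm (c t - F n t)) \<in> borel_measurable (lebesgue_on UNIV)"
      by (intro measurable_on_norm measurable_on_diff F continuous_imp_measurable_on that) auto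
    then show ?thesis by (simp add: meas\<nu> lebesgue_on_UNIV_eq)
  qed
  have "\<exists>c. continuous_on UNIV c \<and> (\<integral>t. min 1 (norm (c t - F n t)) \<partial>\<nu>) < (1/2)^n" for n
  proof -
    obtain N c where N: "negligible N" and c: "\<And>k. continuous_on UNIV (c k)"
      and lim: "\<And>t. t \<notin> N \<Longrightarrow> (\<lambda>k. c k t) \<longlonglongrightarrow> F n t"
      using F[of n] unfolding measurable_on_def by auto
    have "(\<lambda>k. \<integral>t. min 1 (norm (c k t - F n t)) \<partial>\<nu>) \<longlonglongrightarrow> (\<integral>t. 0 \<partial>\<nu>)"
    proof (rule integral_dominated_convergence[where w="\<lambda>_. 1"])
      have "AE t in lebesgue. t \<notin> N" using N by (simp add: AE_not_in negligible_iff_null_sets)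
      then show "AE t in \<nu>. (\<lambda>k. min 1 (norm (c k t - F n t))) \<longlonglongrightarrow> 0"
        unfolding AE\<nu>
      proof eventually_elim
        fix t assume "t \<notin> N"
        have "(\<lambda>k. min 1 (norm (c k t - F n t))) \<longlonglongrightarrow> min 1 (norm (F n t - F n t))"
          by (intro tendsto_intros lim) fact
        then show "(\<lambda>k. min 1 (norm (c k t - F n t))) \<longlonglongrightarrow> 0" by simp
      qed
    qed (use dist_meas[OF c] in auto)
    then have "eventually (\<lambda>k. (\<integral>t. min 1 (norm (c k t - F n t)) \<partial>\<nu>) < (1/2)^n) sequentially"
      by (intro order_tendstoD(2)) auto
    then obtain k where "(\<integral>t. min 1 (norm (c k t - F n t)) \<partial>\<nu>) < (1/2)^n"
      using eventually_happens trivial_limit_sequentially by blast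
    with c[of k] show ?thesis by blast
  qed
  then have "\<forall>n. \<exists>c. continuous_on UNIV c \<and> (\<integral>t. min 1 (norm (c t - F n t)) \<partial>\<nu>) < (1/2)^n" by (rule allI)
  from choice[OF this] obtain c where c: "\<And>n. continuous_on UNIV (c n)"
    and small: "\<And>n. (\<integral>t. min 1 (norm (c n t - F n t)) \<partial>\<nu>) < (1/2)^n"
    by blast
  have "AE t in \<nu>. summable (\<lambda>n. min 1 (norm (c n t - F n t)))"
  proof (rule AE_summable_of_integrals)
    show "integrable \<nu> (\<lambda>t. min 1 (norm (c n t - F n t)))" for n
      by (rule integrable_const_bound[where B=1]) (use dist_meas[OF c] in auto)
    show "(\<integral>t. min 1 (norm (c n t - F n t)) \<partial>\<nu>) \<le> (1/2)^n" for n
      using small less_imp_le by blast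
  qed auto
  then have "AE t in lebesgue. (\<lambda>n. c n t) \<longlonglongrightarrow> G t"
    unfolding AE\<nu> using limF
  proof eventually_elim
    fix t assume "summable (\<lambda>n. min 1 (norm (c n t - F n t)))" and l: "(\<lambda>n. F n t) \<longlonglongrightarrow> G t"
    then have z: "(\<lambda>n. min 1 (norm (c n t - F n t))) \<longlonglongrightarrow> 0" by (simp add: summable_LIMSEQ_zero)
    then have "eventually (\<lambda>n. min 1 (norm (c n t - F n t)) < 1) sequentially"
      by (rule order_tendstoD) simp
    then have "eventually (\<lambda>n. min 1 (norm (c n t - F n t)) = norm (c n t - F n t)) sequentially"
      by eventually_elim auto
    with z have "(\<lambda>n. norm (c n t - F n t)) \<longlonglongrightarrow> 0" by (simp add: tendsto_cong)
    then have "(\<lambda>n. c n t - F n t) \<longlonglongrightarrow> 0" by (rule tendsto_norm_zero_cancel)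
    from tendsto_add[OF this l] show "(\<lambda>n. c n t) \<longlonglongrightarrow> G t" by simp
  qed
  then have "AE t in lebesgue_on UNIV. (\<lambda>n. c n t) \<longlonglongrightarrow> G t" by (simp only: lebesgue_on_UNIV_eq)
  then obtain N where "negligible N" "\<And>t. t \<in> UNIV - N \<Longrightarrow> (\<lambda>n. c n t) \<longlonglongrightarrow> G t"
    by (rule AE_lebesgue_on_negligible) auto
  then show ?thesis
    unfolding measurable_on_def using c by (intro exI[of _ N] exI[of _ c]) (simp add: G_def)
qed

text \<open>Riesz-Fischer for geometrically small increments: the tail of the series of increments
  dominates the distance of \<open>h k\<close> to the limit, and its integral is at most
  \<open>2 * (1/2)^k\<close>. \<open>measurable_on_AE_limit\<close> keeps the limit strongly
  measurable.\<close>

lemma L1_complete: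
  fixes h :: "nat \<Rightarrow> 'a::euclidean_space \<Rightarrow> 'b::banach"
  assumes S: "S \<in> sets lebesgue" and h: "\<And>k. h k measurable_on S"
    and int: "\<And>k. integrable (lebesgue_on S) (\<lambda>t. norm (h (Suc k) t - h k t))"
    and small: "\<And>k. (LINT t|lebesgue_on S. norm (h (Suc k) t - h k t)) \<le> (1/2)^k"
  obtains g where "g measurable_on S" "AE t in lebesgue_on S. (\<lambda>k. h k t) \<longlonglongrightarrow> g t"
    "\<And>k. integrable (lebesgue_on S) (\<lambda>t. norm (h k t - g t))"
    "(\<lambda>k. LINT t|lebesgue_on S. norm (h k t - g t)) \<longlonglongrightarrow> 0"
proof -
  let ?M = "lebesgue_on S"
  define g where "g t = lim (\<lambda>k. h k t)" for t
  have sm: "AE t in ?M. summable (\<lambda>k. norm (h (Suc k) t - h k t))"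
    by (rule AE_summable_of_integrals[OF int _ small]) auto
  have tail: "(\<lambda>k. h k t) \<longlonglongrightarrow> g t \<and> (\<forall>k. norm (h k t - g t) \<le> (\<Sum>j. norm (h (Suc (j + k)) t - h (j + k) t)))"
    if s: "summable (\<lambda>k. norm (h (Suc k) t - h k t))" for t
  proof -
    have "convergent (\<lambda>n. h n t - h 0 t)"
      using summable_norm_cancel[OF s] sum_lessThan_telescope[of "\<lambda>k. h k t"]
      by (simp add: summable_iff_convergent)
    then have "convergent (\<lambda>n. (h n t - h 0 t) + h 0 t)" by (intro convergent_add convergent_const)
    then have l: "(\<lambda>k. h k t) \<longlonglongrightarrow> g t" by (simp add: g_def convergent_LIMSEQ_iff)
    have "norm (h k t - g t) \<le> (\<Sum>j. norm (h (Suc (j + k)) t - h (j + k) t))" for k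
    proof (rule LIMSEQ_le_const2)
      have "(\<lambda>n. h (n + k) t) \<longlonglongrightarrow> g t" using l by (rule LIMSEQ_ignore_initial_segment)
      then show "(\<lambda>n. norm (h k t - h (n + k) t)) \<longlonglongrightarrow> norm (h k t - g t)" by (intro tendsto_intros)
      have sk: "summable (\<lambda>j. norm (h (Suc (j + k)) t - h (j + k) t))"
        using summable_iff_shift[of "\<lambda>j. norm (h (Suc j) t - h j t)" k] s by simp
      have "norm (h k t - h (n + k) t) \<le> (\<Sum>j. norm (h (Suc (j + k)) t - h (j + k) t))" for n
      proof -
        have "h (n + k) t - h k t = (\<Sum>j<n. h (Suc (j + k)) t - h (j + k) t)"
          using sum_lessThan_telescope[of "\<lambda>j. h (j + k) t" n] by simp
        then have "norm (h k t - h (n + k) t) = norm (\<Sum>j<n. h (Suc (j + k)) t - h (j + k) t)"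
          by (metis norm_minus_commute)
        also have "\<dots> \<le> (\<Sum>j<n. norm (h (Suc (j + k)) t - h (j + k) t))" by (rule norm_sum)
        also have "\<dots> \<le> (\<Sum>j. norm (h (Suc (j + k)) t - h (j + k) t))"
          using sk by (intro sum_le_suminf) auto
        finally show ?thesis .
      qed
      then show "\<exists>N. \<forall>n\<ge>N. norm (h k t - h (n + k) t) \<le> (\<Sum>j. norm (h (Suc (j + k)) t - h (j + k) t))"
        by blast
    qed
    with l show ?thesis by blast
  qed
  have lim: "AE t in ?M. (\<lambda>k. h k t) \<longlonglongrightarrow> g t" using sm by eventually_elim (use tail in blast)
  have g: "g measurable_on S" by (rule measurable_on_AE_limit[OF h S lim])
  have summable_half: "summable (\<lambda>j. (1/2::real)^(j + k))" for k
    by (simp add: summable_ignore_initial_segment)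
  have si: "summable (\<lambda>j. LINT t|?M. norm (norm (h (Suc (j + k)) t - h (j + k) t)))" for k
    by (rule summable_comparison_test'[OF summable_half[of k]]) (use small in auto)
  have sk: "AE t in ?M. summable (\<lambda>j. norm (norm (h (Suc (j + k)) t - h (j + k) t)))" for k
    using sm
  proof eventually_elim
    fix t assume "summable (\<lambda>k. norm (h (Suc k) t - h k t))"
    then show "summable (\<lambda>j. norm (norm (h (Suc (j + k)) t - h (j + k) t)))"
      using summable_iff_shift[of "\<lambda>j. norm (h (Suc j) t - h j t)" k] by simp
  qed
  have Rint: "integrable ?M (\<lambda>t. \<Sum>j. norm (h (Suc (j + k)) t - h (j + k) t))" for k
    using integrable_suminf[OF int sk si] .
  have bd: "AE t in ?M. norm (h k t - g t) \<le> (\<Sum>j. norm (h (Suc (j + k)) t - h (j + k) t))" for k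
    using sm by eventually_elim (use tail in blast)
  have m: "(\<lambda>t. norm (h k t - g t)) \<in> borel_measurable ?M" for k
    by (intro measurable_on_norm measurable_on_diff h g S)
  have I: "integrable ?M (\<lambda>t. norm (h k t - g t))" for k
    by (rule Bochner_Integration.integrable_bound[OF Rint[of k] m])
       (use bd[of k] in \<open>eventually_elim, auto\<close>)
  have "(LINT t|?M. norm (h k t - g t)) \<le> 2 * (1/2)^k" for k
  proof -
    have "(LINT t|?M. norm (h k t - g t)) \<le> (LINT t|?M. (\<Sum>j. norm (h (Suc (j + k)) t - h (j + k) t)))"
      by (intro integral_mono_AE I Rint bd)
    also have "\<dots> = (\<Sum>j. LINT t|?M. norm (h (Suc (j + k)) t - h (j + k) t))"
      by (rule integral_suminf[OF int sk si])
    also have "\<dots> \<le> (\<Sum>j. (1/2)^(j + k))"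
      using si[of k] summable_half[of k] small by (intro suminf_le) auto
    also have "\<dots> = 2 * (1/2)^k"
      using suminf_mult2[OF summable_geometric[of "1/2::real"], of "(1/2)^k"]
      by (simp add: power_add suminf_geometric)
    finally show ?thesis .
  qed
  then have "(\<lambda>k. LINT t|?M. norm (h k t - g t)) \<longlonglongrightarrow> 0"
    by (intro tendsto_sandwich[OF _ _ tendsto_const[of 0]
          tendsto_mult_right_zero[OF LIMSEQ_power_zero[of "1/2::real"], of 2]]) auto
  with g lim I show thesis by (rule that)
qed

section \<open>Convex sets of uniformly integrable functions\<close>

text \<open>In the proof, \<open>s\<close>, \<open>t\<close> and \<open>2 * m\<close> are the
  lengths of (1, a), (1, b) and their sum in the product of the reals with the given space.
  Convexity is their triangle inequality, and the second claim bounds its defect from below.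
  \<open>D\<close> is the Cauchy-Schwarz defect; the factor 8 q^3 is the product of the bounds
  \<open>s * t + (1 + a \<bullet> b) \<le> 2 * q^2\<close> and
  \<open>s + t + 2 * m \<le> 4 * q\<close>.\<close>

lemma sqrt_one_plus_norm_sq_convex:
  fixes a b :: "'a::real_inner"
  shows "sqrt (1 + (norm ((1/2) *\<^sub>R (a + b)))\<^sup>2) \<le> (sqrt (1 + (norm a)\<^sup>2) + sqrt (1 + (norm b)\<^sup>2)) / 2" (is ?conv)
    and "norm a \<le> M \<Longrightarrow> norm b \<le> M \<Longrightarrow>
      (norm (a - b))\<^sup>2 \<le> 8 * sqrt (1 + M\<^sup>2) ^ 3 *
        ((sqrt (1 + (norm a)\<^sup>2) + sqrt (1 + (norm b)\<^sup>2)) / 2 - sqrt (1 + (norm ((1/2) *\<^sub>R (a + b)))\<^sup>2))" (is "_ \<Longrightarrow> _ \<Longrightarrow> ?strong")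
proof -
  define s t m where "s = sqrt (1 + (norm a)\<^sup>2)" and "t = sqrt (1 + (norm b)\<^sup>2)"
    and "m = sqrt (1 + (norm ((1/2) *\<^sub>R (a + b)))\<^sup>2)"
  have sq: "s\<^sup>2 = 1 + a \<bullet> a" "t\<^sup>2 = 1 + b \<bullet> b" and pos: "s \<ge> 1" "t \<ge> 1" "m \<ge> 1"
    by (auto simp: s_def t_def m_def add_nonneg_nonneg power2_norm_eq_inner)
  have "m\<^sup>2 = 1 + (norm ((1/2) *\<^sub>R (a + b)))\<^sup>2" unfolding m_def by (rule real_sqrt_pow2) (simp add: add_nonneg_nonneg)
  then have m2: "4 * m\<^sup>2 = 4 + a \<bullet> a + b \<bullet> b + 2 * (a \<bullet> b)"
    unfolding power2_norm_eq_inner by (simp add: inner_add_left inner_add_right inner_commute)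
  define D where "D = s * t - (1 + a \<bullet> b)"
  have cs: "(a \<bullet> b)\<^sup>2 \<le> (a \<bullet> a) * (b \<bullet> b)" by (rule Cauchy_Schwarz_ineq)
  have ab: "(norm (a - b))\<^sup>2 = a \<bullet> a + b \<bullet> b - 2 * (a \<bullet> b)"
    by (simp add: power2_norm_eq_inner inner_diff_left inner_diff_right inner_commute)
  \<comment> \<open>The Gram determinant of (1, a) and (1, b).\<close>
  have st2: "(s * t)\<^sup>2 - (1 + a \<bullet> b)\<^sup>2 = (norm (a - b))\<^sup>2 + ((a \<bullet> a) * (b \<bullet> b) - (a \<bullet> b)\<^sup>2)"
    unfolding power_mult_distrib sq ab by (simp add: algebra_simps power2_eq_square)
  then have "(1 + a \<bullet> b)\<^sup>2 \<le> (s * t)\<^sup>2" using cs zero_le_power2[of "norm (a - b)"] by linarith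
  then have ub: "\<bar>1 + a \<bullet> b\<bar> \<le> s * t" using pos by (simp add: abs_le_square_iff[symmetric])
  then have D0: "0 \<le> D" by (simp add: D_def)
  have DG: "(s + t)\<^sup>2 - (2 * m)\<^sup>2 = 2 * D"
    using m2 sq by (simp add: D_def power2_eq_square algebra_simps)
  then have "(2 * m)\<^sup>2 \<le> (s + t)\<^sup>2" using D0 by linarith
  then have mst: "2 * m \<le> s + t" using pos by - (rule power2_le_imp_le, assumption, linarith)
  then have "m \<le> (s + t) / 2" by simp
  then show ?conv unfolding s_def t_def m_def .
  assume M: "norm a \<le> M" "norm b \<le> M"
  define q where "q = sqrt (1 + M\<^sup>2)"
  have q: "s \<le> q" "t \<le> q" unfolding s_def t_def q_def
    by (rule real_sqrt_le_mono, rule add_left_mono, rule power_mono, rule M, simp)+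
  define G where "G = (s + t) / 2 - m"
  have G0: "0 \<le> G" using mst by (simp add: G_def)
  have "(norm (a - b))\<^sup>2 \<le> (s * t)\<^sup>2 - (1 + a \<bullet> b)\<^sup>2" using st2 cs by linarith
  also have "\<dots> = D * (s * t + (1 + a \<bullet> b))" by (simp add: D_def power2_eq_square algebra_simps)
  also have "\<dots> \<le> D * (2 * (q * q))"
  proof (rule mult_left_mono[OF _ D0])
    have "s * t \<le> q * q" using q pos by (intro mult_mono) auto
    then show "s * t + (1 + a \<bullet> b) \<le> 2 * (q * q)" using ub by linarith
  qed
  also have "D = G * (s + t + 2 * m)" using DG by (simp add: G_def power2_eq_square field_simps)
  also have "G * (s + t + 2 * m) * (2 * (q * q)) \<le> G * (4 * q) * (2 * (q * q))"
    using G0 mst q pos by (intro mult_right_mono mult_left_mono) auto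
  also have "\<dots> = 8 * q ^ 3 * G" by (simp add: power3_eq_cube)
  finally show ?strong unfolding q_def G_def s_def t_def m_def .
qed

text \<open>
  A Komlos type argument: the sets \<open>C n\<close> are minimised over with respect to the strictly convex
  functional \<open>f \<mapsto> \<integral> sqrt (1 + \<bar>f\<bar>\<^sup>2)\<close>, which replaces the reflexivity of the space.
\<close>

lemma uniformly_integrable_convex_Cauchy:
  fixes C :: "nat \<Rightarrow> ('a::euclidean_space \<Rightarrow> 'b::real_inner) set"
  assumes S: "S \<in> lmeasurable"
    and ne: "\<And>n. C n \<noteq> {}" and dec: "decseq C"
    and mid: "\<And>n f g. f \<in> C n \<Longrightarrow> g \<in> C n \<Longrightarrow> (\<lambda>t. (1/2) *\<^sub>R (f t + g t)) \<in> C n"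
    and meas: "\<And>f. f \<in> C 0 \<Longrightarrow> f measurable_on S"
    and int: "\<And>f. f \<in> C 0 \<Longrightarrow> integrable (lebesgue_on S) (\<lambda>t. norm (f t))"
    and ui: "\<And>f E. f \<in> C 0 \<Longrightarrow> E \<in> sets (lebesgue_on S) \<Longrightarrow>
        (LINT t|lebesgue_on S. indicator E t * norm (f t)) \<le> c * measure (lebesgue_on S) E powr \<alpha>"
    and c: "c \<ge> 0" and \<alpha>: "\<alpha> > 0"
  obtains h where "\<And>n. h n \<in> C n"
    "\<And>\<epsilon>. \<epsilon> > 0 \<Longrightarrow> \<exists>N. \<forall>n\<ge>N. \<forall>k\<ge>N. (LINT t|lebesgue_on S. norm (h n t - h k t)) < \<epsilon>"
proof -
  let ?M = "lebesgue_on S"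
  have SL: "S \<in> sets lebesgue" using S by (rule fmeasurableD)
  interpret finite_measure ?M using S by (rule finite_measure_lebesgue_on)
  define V where "V = measure ?M S"
  have SM: "S \<in> sets ?M" "space ?M = S" using SL by (auto simp: sets_restrict_space)
  have C0: "C n \<subseteq> C 0" for n using dec by (simp add: decseq_def)
  define \<psi> where "\<psi> u = sqrt (1 + (norm u)\<^sup>2)" for u :: 'b
  have \<psi>_le: "\<psi> u \<le> 1 + norm u" and \<psi>_ge: "0 \<le> \<psi> u" for u
    by (auto simp: \<psi>_def intro!: real_le_lsqrt add_nonneg_nonneg simp: power2_sum)
  define K where "K = c * V powr \<alpha>"
  have K0: "K \<ge> 0" using c by (simp add: K_def)
  have intK: "(LINT t|?M. norm (f t)) \<le> K" if "f \<in> C 0" for f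
  proof -
    have "(LINT t|?M. norm (f t)) = (LINT t|?M. indicator S t * norm (f t))"
      by (rule Bochner_Integration.integral_cong) (auto simp: SM)
    with ui[OF that SM(1)] show ?thesis by (simp add: K_def V_def)
  qed
  have \<psi>i: "integrable ?M (\<lambda>t. \<psi> (f t))" if "f \<in> C 0" for f
  proof (rule Bochner_Integration.integrable_bound)
    show "integrable ?M (\<lambda>t. 1 + norm (f t))" using int[OF that] by auto
    show "(\<lambda>t. \<psi> (f t)) \<in> borel_measurable ?M"
      using measurable_on_norm[OF meas[OF that] SL] unfolding \<psi>_def by measurable
    show "AE t in ?M. norm (\<psi> (f t)) \<le> norm (1 + norm (f t))"
      using \<psi>_le \<psi>_ge by (simp add: abs_of_nonneg)
  qed
  define \<Phi> where "\<Phi> f = (LINT t|?M. \<psi> (f t))" for f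
  have \<Phi>0: "0 \<le> \<Phi> f" for f unfolding \<Phi>_def by (rule Bochner_Integration.integral_nonneg) (rule \<psi>_ge)
  have \<Phi>K: "\<Phi> f \<le> V + K" if "f \<in> C 0" for f
  proof -
    have "\<Phi> f \<le> (LINT t|?M. 1 + norm (f t))"
      unfolding \<Phi>_def using int[OF that] \<psi>i[OF that] \<psi>_le by (intro integral_mono) auto
    also have "\<dots> = V + (LINT t|?M. norm (f t))" using int[OF that] by (simp add: V_def SM)
    finally show ?thesis using intK[OF that] by simp
  qed
  define m where "m n = (INF f\<in>C n. \<Phi> f)" for n
  have bdd: "bdd_below (\<Phi> ` C n)" for n by (rule bdd_belowI[of _ 0]) (use \<Phi>0 in auto)
  have m_le: "m n \<le> \<Phi> f" if "f \<in> C n" for n f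
    unfolding m_def using bdd that by (rule cINF_lower)
  \<comment> \<open>The infima increase because the sets shrink, and they stay bounded by the values
    on \<open>C 0\<close>. So near-minimisers far out are nearly optimal for one common value
    \<open>L\<close>.\<close>
  have "incseq m"
    unfolding incseq_def m_def using dec ne bdd by (auto intro!: cINF_superset_mono simp: decseq_def)
  moreover have "m n \<le> V + K" for n
    using ne[of n] m_le \<Phi>K C0 by (meson all_not_in_conv order_trans subsetD)
  ultimately obtain L where L: "m \<longlonglongrightarrow> L" "\<And>n. m n \<le> L"
    using incseq_convergent[of m "V + K"] by blast
  have "\<exists>f\<in>C n. \<Phi> f < m n + 1 / real (Suc n)" for n
    using cINF_less_iff[OF ne bdd, of n "m n + 1 / real (Suc n)"] by (simp add: m_def)
  then obtain h where h: "\<And>n. h n \<in> C n" and h\<Phi>: "\<And>n. \<Phi> (h n) < m n + 1 / real (Suc n)"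
    by metis
  have h0: "h n \<in> C 0" for n using h C0 by blast
  \<comment> \<open>The convexity gap at the midpoint of \<open>h n\<close> and \<open>h k\<close>.
    Its integral is small because the midpoint lies in \<open>C (min n k)\<close> and cannot fall
    below the infimum there.\<close>
  define G where "G n k t = (\<psi> (h n t) + \<psi> (h k t)) / 2 - \<psi> ((1/2) *\<^sub>R (h n t + h k t))" for n k t
  have G0: "0 \<le> G n k t" for n k t
    using sqrt_one_plus_norm_sq_convex(1)[of "h n t" "h k t"] by (simp add: G_def \<psi>_def)
  have mid0: "(\<lambda>t. (1/2) *\<^sub>R (h n t + h k t)) \<in> C (min n k)" for n k
    using h[of n] h[of k] decseqD[OF dec min.cobounded1[of n k]] decseqD[OF dec min.cobounded2[of n k]]
    by (intro mid) blast+
  then have mid0': "(\<lambda>t. (1/2) *\<^sub>R (h n t + h k t)) \<in> C 0" for n k using C0 by blast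
  have Gi: "integrable ?M (G n k)" for n k
    unfolding G_def using \<psi>i[OF h0] \<psi>i[OF mid0'] by auto
  define \<gamma> where "\<gamma> n = (L - m n) + 1 / real (Suc n)" for n
  have \<gamma>: "\<gamma> \<longlonglongrightarrow> 0"
  proof -
    have "\<gamma> \<longlonglongrightarrow> (L - L) + 0"
      unfolding \<gamma>_def by (intro tendsto_intros L LIMSEQ_Suc[OF lim_1_over_n])
    then show ?thesis by simp
  qed
  have GI: "(LINT t|?M. G n k t) \<le> \<gamma> n + \<gamma> k" for n k
  proof -
    have "(LINT t|?M. G n k t) = (\<Phi> (h n) + \<Phi> (h k)) / 2 - \<Phi> (\<lambda>t. (1/2) *\<^sub>R (h n t + h k t))"
      unfolding G_def \<Phi>_def using \<psi>i[OF h0] \<psi>i[OF mid0'] by simp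
    also have "\<dots> \<le> (m n + 1 / real (Suc n) + (m k + 1 / real (Suc k))) / 2 - m (min n k)"
      by (intro diff_mono divide_right_mono add_mono less_imp_le[OF h\<Phi>] m_le[OF mid0]) simp
    also have "\<dots> \<le> \<gamma> n + \<gamma> k"
    proof -
      have arith: "(a + p + (b + q)) / 2 - a \<le> L - a + p + (L - b + q) \<and> (a + p + (b + q)) / 2 - b \<le> L - a + p + (L - b + q)"
        if "0 \<le> p" "0 \<le> q" "a \<le> L" "b \<le> L" for a b p q :: real
        using that by (simp add: field_simps)
      have "0 \<le> 1 / real (Suc n)" "0 \<le> 1 / real (Suc k)" by simp_all
      from arith[OF this L(2)[of n] L(2)[of k]] show ?thesis
        unfolding \<gamma>_def min_def by (cases "n \<le> k") simp_all
    qed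
    finally show ?thesis .
  qed
  have hm: "(\<lambda>t. norm (h n t)) \<in> borel_measurable ?M" for n
    using measurable_on_norm[OF meas[OF h0] SL] .
  have hdm: "(\<lambda>t. norm (h n t - h k t)) \<in> borel_measurable ?M" for n k
    by (intro measurable_on_norm measurable_on_diff meas h0 SL)
  have hdi: "integrable ?M (\<lambda>t. norm (h n t - h k t))" for n k
    by (rule Bochner_Integration.integrable_bound[OF Bochner_Integration.integrable_add[OF int[OF h0[of n]] int[OF h0[of k]]] hdm])
       (auto intro: norm_triangle_ineq4)
  have "\<exists>N. \<forall>n\<ge>N. \<forall>k\<ge>N. (LINT t|?M. norm (h n t - h k t)) < \<epsilon>" if \<epsilon>: "\<epsilon> > 0" for \<epsilon>
  proof -
    \<comment> \<open>Sets of measure at most \<open>\<delta>\<close> carry at most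
      \<open>\<epsilon> / 8\<close> of the norm of any member of \<open>C 0\<close>.
      \<open>R\<close> makes the set where one of the two norms reaches \<open>R\<close> that small,
      by Markov's inequality; off this set \<open>G\<close> controls the squared difference.\<close>
    define \<delta> where "\<delta> = (\<epsilon> / (8 * (c + 1))) powr (1/\<alpha>)"
    have \<delta>: "\<delta> > 0" using \<epsilon> c by (simp add: \<delta>_def)
    have \<delta>\<alpha>: "\<delta> powr \<alpha> = \<epsilon> / (8 * (c + 1))" using \<epsilon> c \<alpha> by (simp add: \<delta>_def powr_powr)
    define R where "R = 2 * K / \<delta> + 1"
    have R: "R > 0" "2 * K \<le> \<delta> * R" using K0 \<delta> by (auto simp: R_def field_simps intro: add_nonneg_pos)
    define q where "q = sqrt (1 + R\<^sup>2)"
    have q: "q > 0" by (simp add: q_def add_pos_nonneg)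
    define \<eta> where "\<eta> = \<epsilon> / (4 * (V + 1))"
    have V0: "V \<ge> 0" by (simp add: V_def)
    have \<eta>: "\<eta> > 0" "\<eta> * V \<le> \<epsilon> / 4" using \<epsilon> V0 by (auto simp: \<eta>_def field_simps)
    \<comment> \<open>From \<open>d \<le> \<eta> + d^2 / (4 * \<eta>)\<close>, which turns the bound
      on the squared difference into one on the difference itself.\<close>
    define \<kappa> where "\<kappa> = 8 * q ^ 3 / (4 * \<eta>)"
    have \<kappa>: "\<kappa> > 0" using q \<eta> by (simp add: \<kappa>_def)
    have "eventually (\<lambda>n. \<gamma> n < \<epsilon> / (8 * \<kappa>)) sequentially"
      by (rule order_tendstoD[OF \<gamma>]) (use \<epsilon> \<kappa> in simp)
    then obtain N where N: "\<And>n. n \<ge> N \<Longrightarrow> \<gamma> n < \<epsilon> / (8 * \<kappa>)"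
      by (auto simp: eventually_sequentially)
    have "(LINT t|?M. norm (h n t - h k t)) < \<epsilon>" if nk: "n \<ge> N" "k \<ge> N" for n k
    proof -
      define E where "E = {t \<in> space ?M. R \<le> norm (h n t)} \<union> {t \<in> space ?M. R \<le> norm (h k t)}"
      have EM: "E \<in> sets ?M"
        unfolding E_def using hm[of n] hm[of k] by measurable
      have mk: "measure ?M {t \<in> space ?M. R \<le> norm (h j t)} \<le> K / R" for j
      proof -
        have "measure ?M {t \<in> space ?M. R \<le> norm (h j t)} \<le> (LINT t|?M. norm (h j t)) / R"
          by (rule integral_Markov_inequality_measure[where A="{}"]) (use int[OF h0] R in auto)
        also have "\<dots> \<le> K / R" using intK[OF h0] R by (intro divide_right_mono) auto
        finally show ?thesis .
      qed
      have "measure ?M E \<le> K / R + K / R"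
        unfolding E_def
        by (rule order_trans[OF measure_Un_le add_mono[OF mk mk]]) (use hm in measurable)
      also have "\<dots> \<le> \<delta>" using R by (simp add: field_simps)
      finally have "measure ?M E powr \<alpha> \<le> \<delta> powr \<alpha>" using \<alpha> by (intro powr_mono2) auto
      then have "c * measure ?M E powr \<alpha> \<le> c * (\<epsilon> / (8 * (c + 1)))"
        unfolding \<delta>\<alpha> using c by (rule mult_left_mono)
      also have "\<dots> \<le> \<epsilon> / 8" using c \<epsilon> by (simp add: field_simps)
      finally have EI: "(LINT t|?M. indicator E t * norm (h j t)) \<le> \<epsilon> / 8" for j
        using ui[OF h0[of j] EM] by linarith
      have Ei: "integrable ?M (\<lambda>t. indicator E t * norm (h j t))" for j
        using integrable_mult_indicator[OF EM int[OF h0[of j]]] by simp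
      have pt: "norm (h n t - h k t) \<le> \<eta> + \<kappa> * G n k t + (indicator E t * norm (h n t) + indicator E t * norm (h k t))"
        if "t \<in> space ?M" for t
      proof (cases "t \<in> E")
        case True
        have "0 \<le> \<eta> + \<kappa> * G n k t" using \<eta> \<kappa> G0 by (intro add_nonneg_nonneg mult_nonneg_nonneg) auto
        with True norm_triangle_ineq4[of "h n t" "h k t"] show ?thesis by simp
      next
        case False
        then have "norm (h n t) \<le> R" "norm (h k t) \<le> R" using that by (auto simp: E_def)
        then have *: "(norm (h n t - h k t))\<^sup>2 \<le> 8 * q ^ 3 * G n k t"
          using sqrt_one_plus_norm_sq_convex(2)[of "h n t" R "h k t"] by (simp add: G_def \<psi>_def q_def)
        define d where "d = norm (h n t - h k t)"
        have "d * (4 * \<eta>) \<le> \<eta> * (4 * \<eta>) + d\<^sup>2"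
          using zero_le_power2[of "d - 2 * \<eta>"] by (simp add: power2_eq_square algebra_simps)
        also have "\<dots> \<le> \<eta> * (4 * \<eta>) + 8 * q ^ 3 * G n k t" using * by (simp add: d_def)
        also have "\<dots> = (\<eta> + \<kappa> * G n k t) * (4 * \<eta>)" using \<eta> by (simp add: \<kappa>_def field_simps)
        finally have "d \<le> \<eta> + \<kappa> * G n k t" using \<eta> by (simp only: mult_le_cancel_right_pos)
        with False show ?thesis by (simp add: d_def)
      qed
      have "(LINT t|?M. norm (h n t - h k t))
        \<le> (LINT t|?M. \<eta> + \<kappa> * G n k t + (indicator E t * norm (h n t) + indicator E t * norm (h k t)))"
        using hdi Gi Ei by (intro integral_mono pt) auto
      also have "\<dots> = \<eta> * V + \<kappa> * (LINT t|?M. G n k t)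
        + ((LINT t|?M. indicator E t * norm (h n t)) + (LINT t|?M. indicator E t * norm (h k t)))"
        using Gi Ei by (simp add: V_def SM)
      also have "\<dots> \<le> \<epsilon> / 4 + \<kappa> * (\<gamma> n + \<gamma> k) + (\<epsilon> / 8 + \<epsilon> / 8)"
        using \<eta> \<kappa> GI EI by (intro add_mono mult_left_mono) auto
      also have "\<dots> < \<epsilon>"
      proof -
        have "\<kappa> * (\<gamma> n + \<gamma> k) < \<kappa> * (\<epsilon> / (8 * \<kappa>) + \<epsilon> / (8 * \<kappa>))"
          using N nk \<kappa> by (intro mult_strict_left_mono add_strict_mono) auto
        also have "\<dots> = \<epsilon> / 4" using \<kappa> by (simp add: field_simps)
        finally show ?thesis using \<epsilon> by simp
      qed
      finally show ?thesis .
    qed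
    then show ?thesis by blast
  qed
  with h show thesis by (rule that)
qed

text \<open>The Cauchy sequence is thinned until its increments are at most \<open>(1/2)^k\<close>,
  so that \<open>L1_complete\<close> applies. As the sets decrease, the \<open>n\<close>-th term of
  the thinned sequence still lies in \<open>C n\<close>.\<close>

lemma uniformly_integrable_convex_limit:
  fixes C :: "nat \<Rightarrow> ('a::euclidean_space \<Rightarrow> 'b::{real_inner, banach}) set"
  assumes S: "S \<in> lmeasurable"
    and ne: "\<And>n. C n \<noteq> {}" and dec: "decseq C"
    and mid: "\<And>n f g. f \<in> C n \<Longrightarrow> g \<in> C n \<Longrightarrow> (\<lambda>t. (1/2) *\<^sub>R (f t + g t)) \<in> C n"
    and meas: "\<And>f. f \<in> C 0 \<Longrightarrow> f measurable_on S"
    and int: "\<And>f. f \<in> C 0 \<Longrightarrow> integrable (lebesgue_on S) (\<lambda>t. norm (f t))"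
    and ui: "\<And>f E. f \<in> C 0 \<Longrightarrow> E \<in> sets (lebesgue_on S) \<Longrightarrow>
        (LINT t|lebesgue_on S. indicator E t * norm (f t)) \<le> c * measure (lebesgue_on S) E powr \<alpha>"
    and c: "c \<ge> 0" and \<alpha>: "\<alpha> > 0"
  obtains h g where "\<And>n. h n \<in> C n" "g measurable_on S"
    "AE t in lebesgue_on S. (\<lambda>n. h n t) \<longlonglongrightarrow> g t"
    "\<And>n. integrable (lebesgue_on S) (\<lambda>t. norm (h n t - g t))"
    "(\<lambda>n. LINT t|lebesgue_on S. norm (h n t - g t)) \<longlonglongrightarrow> 0"
proof -
  let ?M = "lebesgue_on S"
  have SL: "S \<in> sets lebesgue" using S by (rule fmeasurableD)
  obtain h where h: "\<And>n. h n \<in> C n"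
    and cau: "\<And>\<epsilon>. \<epsilon> > 0 \<Longrightarrow> \<exists>N. \<forall>n\<ge>N. \<forall>k\<ge>N. (LINT t|?M. norm (h n t - h k t)) < \<epsilon>"
    using uniformly_integrable_convex_Cauchy[OF S ne dec mid meas int ui c \<alpha>] by blast
  have "\<forall>j. \<exists>N. \<forall>n\<ge>N. \<forall>k\<ge>N. (LINT t|?M. norm (h n t - h k t)) < (1/2)^j"
    using cau by simp
  then obtain N where N: "\<And>j n k. n \<ge> N j \<Longrightarrow> k \<ge> N j \<Longrightarrow> (LINT t|?M. norm (h n t - h k t)) < (1/2)^j"
    by metis
  \<comment> \<open>The summand \<open>j\<close> puts \<open>h (r j)\<close> into
    \<open>C j\<close>; the maximum makes both \<open>r j\<close> and \<open>r (Suc j)\<close> at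
    least \<open>N j\<close>.\<close>
  define r where "r j = j + Max (N ` {..j})" for j
  have r: "N j \<le> r j" "j \<le> r j" "N j \<le> r (Suc j)" for j
  proof -
    have *: "N i \<le> Max (N ` {..j})" if "i \<le> j" for i j using that by (intro Max_ge) auto
    show "N j \<le> r j" "j \<le> r j" "N j \<le> r (Suc j)"
      unfolding r_def using *[of j j] *[of j "Suc j"] by linarith+
  qed
  have C0: "C n \<subseteq> C k" if "k \<le> n" for n k using dec that by (simp add: decseq_def)
  have hr: "h (r j) \<in> C j" "h (r j) \<in> C 0" for j using h C0 r by blast+
  have hm: "h (r j) measurable_on S" for j using hr meas by blast
  have hdm: "(\<lambda>t. norm (h (r (Suc k)) t - h (r k) t)) \<in> borel_measurable ?M" for k
    by (intro measurable_on_norm measurable_on_diff hm SL)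
  have "integrable ?M (\<lambda>t. norm (h (r (Suc k)) t - h (r k) t))" for k
    by (rule Bochner_Integration.integrable_bound[OF Bochner_Integration.integrable_add[OF int[OF hr(2)[of "Suc k"]] int[OF hr(2)[of k]]] hdm])
       (auto intro: norm_triangle_ineq4)
  moreover have "(LINT t|?M. norm (h (r (Suc k)) t - h (r k) t)) \<le> (1/2)^k" for k
    using N[of k "r (Suc k)" "r k"] r by (simp add: less_imp_le)
  ultimately show thesis
    using L1_complete[of S "\<lambda>j. h (r j)", OF SL hm] hr(1) that[of "\<lambda>j. h (r j)"] by blast
qed

section \<open>Uniform boundedness and local bounds of semigroups\<close>

text \<open>The \<open>n\<close>-th sign is that of the partial sum over \<open>k < n\<close>, so
  that the new term, with \<open>l n n\<close> nonnegative, can only enlarge this sum in absolute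
  value.\<close>

fun hump_weight :: "(nat \<Rightarrow> nat \<Rightarrow> real) \<Rightarrow> nat \<Rightarrow> real" where
  "hump_weight l n =
     (if 0 \<le> (\<Sum>k<n. hump_weight l k * l n k) then 1 else - 1) * (1/3)^n"

declare hump_weight.simps [simp del]

text \<open>
  The gliding hump in the proof of the uniform boundedness principle (after Sokal), reduced to the
  matrix of values \<open>l n k\<close> of the \<open>n\<close>-th functional at a near-maximiser for the \<open>k\<close>-th one.
\<close>

lemma hump_weight_bound:
  assumes l: "\<And>n k. \<bar>l n k\<bar> \<le> 4/3 * l n n"
  shows "\<bar>hump_weight l n\<bar> = (1/3)^n" "summable (\<lambda>k. hump_weight l k * l n k)"
    and "(1/3)^n * l n n / 3 \<le> \<bar>\<Sum>k. hump_weight l k * l n k\<bar>"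
proof -
  let ?s = "hump_weight l"
  show abs_s: "\<bar>?s n\<bar> = (1/3)^n" for n
    by (subst hump_weight.simps) (simp add: abs_mult)
  have l0: "0 \<le> l n n" for n using l[of n n] by linarith
  have term_le: "\<bar>?s k * l n k\<bar> \<le> (1/3)^k * (4/3 * l n n)" for k n
    unfolding abs_mult abs_s by (intro mult_left_mono l) auto
  have geo: "summable (\<lambda>k. (1/3::real)^k * (4/3 * l n n))" for n
    by (intro summable_mult2 summable_geometric) simp
  show sm: "summable (\<lambda>k. ?s k * l n k)" for n
    by (rule summable_comparison_test'[OF geo[of n]]) (use term_le in simp)
  have head: "(1/3)^n * l n n \<le> \<bar>\<Sum>k<Suc n. ?s k * l n k\<bar>"
  proof -
    let ?P = "\<Sum>k<n. ?s k * l n k"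
    have "?s n = (if 0 \<le> ?P then 1 else - 1) * (1/3)^n" by (rule hump_weight.simps)
    moreover have "0 \<le> (1/3)^n * l n n" using l0 by simp
    ultimately show ?thesis by (auto simp: abs_if)
  qed
  \<comment> \<open>The tail is at most 4/3 times 1/3 times 3/2, that is 2/3, of
    \<open>(1/3)^n * l n n\<close>, so a third of the head survives. The ratio 1/3 and the slack 4/3
    are balanced for this.\<close>
  have "\<bar>\<Sum>k. ?s (k + Suc n) * l n (k + Suc n)\<bar> \<le> (\<Sum>k. (1/3)^(k + Suc n) * (4/3 * l n n))"
  proof -
    have a: "summable (\<lambda>k. (1/3::real)^(k + Suc n) * (4/3 * l n n))"
      by (rule summable_ignore_initial_segment[OF geo])
    have b: "summable (\<lambda>k. \<bar>?s (k + Suc n) * l n (k + Suc n)\<bar>)"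
      by (rule summable_comparison_test'[OF a]) (simp only: real_norm_def abs_idempotent term_le)
    have "\<bar>\<Sum>k. ?s (k + Suc n) * l n (k + Suc n)\<bar> \<le> (\<Sum>k. \<bar>?s (k + Suc n) * l n (k + Suc n)\<bar>)"
      by (rule summable_rabs[OF b])
    also have "\<dots> \<le> (\<Sum>k. (1/3)^(k + Suc n) * (4/3 * l n n))"
      by (rule suminf_le[OF term_le b a])
    finally show ?thesis .
  qed
  also have "(\<Sum>k. (1/3)^(k + Suc n) * (4/3 * l n n)) = (\<Sum>k. (1/3)^k * ((1/3)^Suc n * (4/3 * l n n)))"
    by (simp add: power_add mult_ac)
  also have "\<dots> = (\<Sum>k. (1/3)^k) * ((1/3)^Suc n * (4/3 * l n n))"
    by (rule suminf_mult2[symmetric]) (simp add: summable_geometric)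
  also have "\<dots> = 2/3 * ((1/3)^n * l n n)"
    by (simp add: suminf_geometric)
  finally have tail: "\<bar>\<Sum>k. ?s (k + Suc n) * l n (k + Suc n)\<bar> \<le> 2/3 * ((1/3)^n * l n n)" .
  have "(\<Sum>k. ?s k * l n k) = (\<Sum>k. ?s (k + Suc n) * l n (k + Suc n)) + (\<Sum>k<Suc n. ?s k * l n k)"
    by (rule suminf_split_initial_segment[OF sm])
  with head tail show "(1/3)^n * l n n / 3 \<le> \<bar>\<Sum>k. ?s k * l n k\<bar>" by linarith
qed

lemma near_maximiser_blinfun:
  fixes f :: "'a::real_normed_vector \<Rightarrow>\<^sub>L 'b::real_normed_vector"
  assumes "c < norm f" "0 \<le> c"
  obtains e where "norm e \<le> 1" "c < norm (f e)"
proof -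
  obtain e where e: "c * norm e < norm (f e)"
    using norm_blinfun_bound[of c f] assms by (meson not_le)
  then have "e \<noteq> 0" by auto
  show thesis
  proof (rule that)
    show "norm (sgn e) \<le> 1" by (simp add: norm_sgn)
    show "c < norm (f (sgn e))"
      using e \<open>e \<noteq> 0\<close> by (simp add: sgn_div_norm blinfun.scaleR_right field_simps)
  qed
qed

text \<open>Otherwise there are times \<open>t n \<le> 1 / (n + 1)\<close> with norms above
  \<open>4^n\<close>. The hump vector \<open>x\<close> built from near-maximisers then satisfies
  \<open>(4/3)^n / 4 \<le> norm (S (t n) x)\<close>, against the convergence of
  \<open>S (t n) x\<close> to \<open>x\<close>.\<close>

lemma C0_semigroup_bounded_near_0:
  fixes S :: "real \<Rightarrow> 'x::{real_inner, banach} \<Rightarrow>\<^sub>L 'x"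
  assumes "C0_semigroup S"
  obtains \<delta> M where "\<delta> > 0" "\<And>t. 0 \<le> t \<Longrightarrow> t \<le> \<delta> \<Longrightarrow> norm (S t) \<le> M"
proof (rule ccontr)
  assume "\<not> thesis"
  then have "\<exists>t. 0 \<le> t \<and> t \<le> 1 / real (Suc n) \<and> 4^n < norm (S t)" for n
    using that[of "1 / real (Suc n)" "4^n"] by (meson not_le of_nat_0_less_iff zero_less_Suc zero_less_divide_1_iff)
  then obtain t where t: "\<And>n. 0 \<le> t n" "\<And>n. t n \<le> 1 / real (Suc n)" and big: "\<And>n. 4^n < norm (S (t n))"
    by metis
  have t_pos: "0 < t n" for n
  proof (rule ccontr)
    assume "\<not> 0 < t n"
    then have "S (t n) = id_blinfun" using t(1)[of n] assms by (simp add: C0_semigroup_def)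
    then have "norm (S (t n)) \<le> 1" by (metis norm_blinfun_id_le)
    with big[of n] one_le_power[of "4::real" n] show False by linarith
  qed
  have t0: "filterlim t (at_right 0) sequentially"
    unfolding filterlim_at
  proof
    show "\<forall>\<^sub>F n in sequentially. t n \<in> {0<..} \<and> t n \<noteq> 0" using t_pos by (auto simp: less_le)
    show "t \<longlonglongrightarrow> 0"
      by (rule tendsto_sandwich[OF _ _ tendsto_const LIMSEQ_Suc[OF lim_1_over_n]]) (use t in auto)
  qed
  have "\<exists>e. norm e \<le> 1 \<and> 3/4 * norm (S (t n)) < norm (S (t n) e)" for n
  proof -
    have "0 < norm (S (t n))" using big[of n] by (meson less_trans zero_less_numeral zero_less_power)
    then show ?thesis using near_maximiser_blinfun[of "3/4 * norm (S (t n))" "S (t n)"] by auto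
  qed
  then obtain e where e: "\<And>n. norm (e n) \<le> 1" "\<And>n. 3/4 * norm (S (t n)) < norm (S (t n) (e n))"
    by metis
  \<comment> \<open>Pairing with the direction of \<open>S (t n) (e n)\<close> makes the values
    scalar; the factor 3/4 in the choice of \<open>e n\<close> is the 4/3 that
    \<open>hump_weight_bound\<close> asks for.\<close>
  define l where "l n k = S (t n) (e k) \<bullet> sgn (S (t n) (e n))" for n k
  have lnn: "l n n = norm (S (t n) (e n))" for n
    using e(2)[of n] by (simp add: l_def sgn_div_norm power2_norm_eq_inner[symmetric] power2_eq_square field_simps)
  have lnk: "\<bar>l n k\<bar> \<le> 4/3 * l n n" for n k
  proof -
    have "\<bar>l n k\<bar> \<le> norm (S (t n) (e k)) * norm (sgn (S (t n) (e n)))"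
      unfolding l_def by (rule Cauchy_Schwarz_ineq2)
    also have "\<dots> \<le> norm (S (t n) (e k)) * 1" by (intro mult_left_mono) (auto simp: norm_sgn)
    also have "\<dots> \<le> norm (S (t n)) * norm (e k)" using norm_blinfun by simp
    also have "\<dots> \<le> norm (S (t n)) * 1" by (intro mult_left_mono e) simp
    also have "\<dots> \<le> 4/3 * l n n" using e(2)[of n] lnn[of n] by simp
    finally show ?thesis .
  qed
  note hump = hump_weight_bound[of l, OF lnk]
  have sm: "summable (\<lambda>k. hump_weight l k *\<^sub>R e k)"
  proof (rule summable_comparison_test'[of "\<lambda>k. (1/3)^k" 0])
    show "norm (hump_weight l k *\<^sub>R e k) \<le> (1/3)^k" for k
      using mult_left_mono[OF e(1)[of k], of "(1/3)^k"] by (simp add: hump(1))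
  qed (simp add: summable_geometric)
  define x where "x = (\<Sum>k. hump_weight l k *\<^sub>R e k)"
  have big_x: "(4/3)^n / 4 \<le> norm (S (t n) x)" for n
  proof -
    define w where "w = sgn (S (t n) (e n))"
    have bl: "bounded_linear (\<lambda>x. S (t n) x \<bullet> w)"
      by (intro bounded_linear_inner_left_comp blinfun.bounded_linear_right)
    have "S (t n) x \<bullet> w = (\<Sum>k. hump_weight l k * l n k)"
      unfolding x_def bounded_linear.suminf[OF bl sm]
      by (simp add: l_def w_def blinfun.scaleR_right)
    then have "(1/3)^n * l n n / 3 \<le> \<bar>S (t n) x \<bullet> w\<bar>" using hump(3)[of n] by simp
    also have "\<dots> \<le> norm (S (t n) x) * norm w" by (rule Cauchy_Schwarz_ineq2)
    also have "\<dots> \<le> norm (S (t n) x) * 1" by (intro mult_left_mono) (auto simp: norm_sgn w_def)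
    finally have *: "(1/3)^n * l n n / 3 \<le> norm (S (t n) x)" by simp
    have "(1/3)^n * (3/4 * 4^n) / 3 \<le> (1/3)^n * l n n / 3"
      using e(2)[of n] big[of n] lnn[of n] by (intro divide_right_mono mult_left_mono) auto
    moreover have "(1/3)^n * (3/4 * 4^n) / 3 = (4/3)^n / (4::real)"
      by (simp add: power_divide)
    ultimately show ?thesis using * by linarith
  qed
  have "((\<lambda>t. S t x) \<longlongrightarrow> x) (at_right 0)" using assms by (simp add: C0_semigroup_def)
  from filterlim_compose[OF this t0] have "(\<lambda>n. S (t n) x) \<longlonglongrightarrow> x" .
  then have "Bseq (\<lambda>n. S (t n) x)" by (rule convergent_imp_Bseq[OF convergentI])
  then obtain K where K: "\<And>n. norm (S (t n) x) \<le> K" by (auto simp: Bseq_def)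
  obtain n where "4 * K < (4/3)^n" using real_arch_pow[of "4/3" "4 * K"] by auto
  with big_x[of n] K[of n] show False by linarith
qed

text \<open>The semigroup law carries the bound on [0, \<delta>] along, in steps of length
  \<open>\<delta>\<close>.\<close>

lemma C0_semigroup_bounded:
  fixes S :: "real \<Rightarrow> 'x::{real_inner, banach} \<Rightarrow>\<^sub>L 'x"
  assumes "C0_semigroup S"
  obtains M where "M \<ge> 0" "\<And>t. 0 \<le> t \<Longrightarrow> t \<le> T \<Longrightarrow> norm (S t) \<le> M"
proof -
  obtain \<delta> M where \<delta>: "\<delta> > 0" and M: "\<And>t. 0 \<le> t \<Longrightarrow> t \<le> \<delta> \<Longrightarrow> norm (S t) \<le> M"
    using C0_semigroup_bounded_near_0[OF assms] by blast
  have M0: "0 \<le> M" using M[of 0] \<delta> norm_ge_zero order_trans by (metis less_imp_le order_refl)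
  have step: "\<exists>K. \<forall>t. 0 \<le> t \<and> t \<le> real (Suc n) * \<delta> \<longrightarrow> norm (S t) \<le> K" for n
  proof (induction n)
    case 0
    then show ?case using M by auto
  next
    case (Suc n)
    then obtain K where K: "\<And>t. 0 \<le> t \<Longrightarrow> t \<le> real (Suc n) * \<delta> \<Longrightarrow> norm (S t) \<le> K" by blast
    have "norm (S t) \<le> max K (K * M)" if t: "0 \<le> t" "t \<le> real (Suc (Suc n)) * \<delta>" for t
    proof (cases "t \<le> real (Suc n) * \<delta>")
      case True
      then show ?thesis using K[of t] t by simp
    next
      case False
      define a where "a = real n * \<delta>"
    have a: "0 \<le> a" "real (Suc n) * \<delta> = a + \<delta>" "real (Suc (Suc n)) * \<delta> = a + 2 * \<delta>"
      using \<delta> by (simp_all add: a_def algebra_simps)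
    have d: "0 \<le> t - \<delta>" "t - \<delta> \<le> real (Suc n) * \<delta>"
      using False t a(1) unfolding a(2,3) by simp_all
    have "S t = S (t - \<delta>) o\<^sub>L S \<delta>"
        using assms d \<delta> unfolding C0_semigroup_def by (metis diff_add_cancel less_imp_le)
      then have "norm (S t) \<le> norm (S (t - \<delta>)) * norm (S \<delta>)" by (simp add: norm_blinfun_compose)
      also have "\<dots> \<le> K * M" using K[OF d] M[of \<delta>] \<delta> by (intro mult_mono) (auto intro: order_trans[OF norm_ge_zero])
      finally show ?thesis by simp
    qed
    then show ?case by blast
  qed
  obtain n where n: "T / \<delta> < real (Suc n)" using reals_Archimedean2 of_nat_less_of_nat_power_cancel_iff
    by (metis lessI less_trans of_nat_less_iff)
  obtain K where K: "\<forall>t. 0 \<le> t \<and> t \<le> real (Suc n) * \<delta> \<longrightarrow> norm (S t) \<le> K" using step by blast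
  show thesis
  proof (rule that[of "max 0 K"])
    fix t assume t: "0 \<le> t" "t \<le> T"
    have "T \<le> real (Suc n) * \<delta>" using n \<delta> by (simp add: field_simps)
    then show "norm (S t) \<le> max 0 K" using K t by (meson max.coboundedI2 order_trans)
  qed simp
qed

text \<open>Left and right continuity both come from
  \<open>S b x - S a x = S a (S (b - a) x - x)\<close> for \<open>a < b\<close>: the larger time is
  reached from the smaller one, and the local bound absorbs \<open>S a\<close>.\<close>

lemma C0_semigroup_continuous:
  fixes S :: "real \<Rightarrow> 'x::{real_inner, banach} \<Rightarrow>\<^sub>L 'x"
  assumes "C0_semigroup S"
  shows "continuous_on {0..} (\<lambda>t. S t x)"
proof -
  have "continuous (at t within {0..}) (\<lambda>t. S t x)" if t: "t \<in> {0..}" for t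
    unfolding continuous_within_eps_delta
  proof (intro allI impI)
    fix \<epsilon> :: real assume \<epsilon>: "\<epsilon> > 0"
    obtain M where M: "M \<ge> 0" "\<And>s. 0 \<le> s \<Longrightarrow> s \<le> t + 1 \<Longrightarrow> norm (S s) \<le> M"
      using C0_semigroup_bounded[OF assms] by blast
    have "((\<lambda>h. S h x) \<longlongrightarrow> x) (at_right 0)" using assms by (simp add: C0_semigroup_def)
    then have "eventually (\<lambda>h. dist (S h x) x < \<epsilon> / (M + 1)) (at_right 0)"
      using \<epsilon> M by (intro tendstoD) auto
    then obtain d where d: "d > 0" and close: "\<And>h. 0 < h \<Longrightarrow> h < d \<Longrightarrow> dist (S h x) x < \<epsilon> / (M + 1)"
      by (auto simp: eventually_at_right_field)
    have inc: "norm (S b x - S a x) < \<epsilon>" if ab: "0 \<le> a" "a < b" "b \<le> t + 1" "b - a < d" for a b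
    proof -
      have "S b = S a o\<^sub>L S (b - a)"
        using assms ab unfolding C0_semigroup_def by (metis add.commute diff_add_cancel diff_ge_0_iff_ge less_imp_le)
      then have "norm (S b x - S a x) = norm (S a (S (b - a) x - x))" by (simp add: blinfun.diff_right)
      also have "\<dots> \<le> norm (S a) * norm (S (b - a) x - x)" by (rule norm_blinfun)
      also have "\<dots> \<le> M * (\<epsilon> / (M + 1))"
        using M(2)[of a] close[of "b - a"] ab M(1) by (intro mult_mono) (auto simp: dist_norm)
      also have "\<dots> < \<epsilon>" using M \<epsilon> by (simp add: field_simps)
      finally show ?thesis .
    qed
    have "dist (S s x) (S t x) < \<epsilon>" if s: "s \<in> {0..}" "dist s t < min d 1" for s
    proof (cases s t rule: linorder_cases)
      case less
      then show ?thesis using inc[of s t] s by (auto simp: dist_norm norm_minus_commute)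
    next
      case greater
      then show ?thesis using inc[of t s] s t by (auto simp: dist_norm)
    qed (use \<epsilon> in auto)
    then show "\<exists>d>0. \<forall>s\<in>{0..}. dist s t < d \<longrightarrow> dist (S s x) (S t x) < \<epsilon>"
      using d by (intro exI[of _ "min d 1"]) auto
  qed
  then show ?thesis by (simp add: continuous_on_eq_continuous_within)
qed

section \<open>The adjoint semigroup\<close>

text \<open>The norm bound comes from testing the adjoint identity at \<open>adjoint f y\<close>
  itself.\<close>

lemma bounded_linear_adjoint:
  fixes f :: "'a::{real_inner, banach} \<Rightarrow> 'b::real_inner"
  assumes "bounded_linear f"
  shows "bounded_linear (adjoint f)" "norm (adjoint f y) \<le> onorm f * norm y"
proof -
  show bound: "norm (adjoint f y) \<le> onorm f * norm y" for y
  proof -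
    have "norm (adjoint f y) * norm (adjoint f y) = f (adjoint f y) \<bullet> y"
      using inner_adjoint[OF assms, of "adjoint f y" y] by (simp add: power2_norm_eq_inner[symmetric] power2_eq_square)
    also have "\<dots> \<le> norm (f (adjoint f y)) * norm y" by (rule norm_cauchy_schwarz)
    also have "\<dots> \<le> onorm f * norm (adjoint f y) * norm y"
      by (intro mult_right_mono onorm[OF assms]) simp
    finally have "norm (adjoint f y) * norm (adjoint f y) \<le> norm (adjoint f y) * (onorm f * norm y)"
      by (simp add: mult_ac)
    then show ?thesis
      using onorm_pos_le[OF assms] by (cases "adjoint f y = 0") auto
  qed
  show "bounded_linear (adjoint f)"
  proof (rule bounded_linear_intro)
    show "adjoint f (x + y) = adjoint f x + adjoint f y" for x y
      by (rule vector_eq_ldot[THEN iffD1]) (simp add: inner_adjoint[OF assms] inner_add_right)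
    show "adjoint f (c *\<^sub>R x) = c *\<^sub>R adjoint f x" for c x
      by (rule vector_eq_ldot[THEN iffD1]) (simp add: inner_adjoint[OF assms])
    show "norm (adjoint f y) \<le> norm y * onorm f" for y
      using bound[of y] by (simp add: mult.commute)
  qed
qed

locale admissible_system =
  fixes \<Sigma> :: "('x::{real_inner, banach}, 'u::{real_inner, banach}) ctrl_sys"
  assumes control_system: "control_system \<Sigma>"
begin

abbreviation "S \<equiv> sg \<Sigma>"
abbreviation "A \<equiv> gen \<Sigma>"
abbreviation "D \<equiv> dom_gen \<Sigma>"
abbreviation "S' \<equiv> sg_adj \<Sigma>"
abbreviation "A' \<equiv> gen_adj \<Sigma>"
abbreviation "D' \<equiv> dom_adj \<Sigma>"

lemma C0: "C0_semigroup S"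
  and D_iff: "x \<in> D \<longleftrightarrow> (\<exists>y. ((\<lambda>t. (S t x - x) /\<^sub>R t) \<longlongrightarrow> y) (at_right 0))"
  and A_lim: "x \<in> D \<Longrightarrow> ((\<lambda>t. (S t x - x) /\<^sub>R t) \<longlongrightarrow> A x) (at_right 0)"
  using control_system unfolding control_system_def generates_def by blast+

lemma A_eqI:
  assumes "((\<lambda>t. (S t x - x) /\<^sub>R t) \<longlongrightarrow> y) (at_right 0)"
  shows "x \<in> D" "A x = y"
proof -
  show "x \<in> D" using assms D_iff by blast
  then show "A x = y" using A_lim tendsto_unique assms trivial_limit_at_right_real by blast
qed

lemma S_0 [simp]: "S 0 x = x"
  using C0 by (simp add: C0_semigroup_def)

lemma S_add: "s \<ge> 0 \<Longrightarrow> t \<ge> 0 \<Longrightarrow> S (s + t) x = S s (S t x)"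
  using C0 by (simp add: C0_semigroup_def)

lemma S_continuous: "continuous_on {0..} (\<lambda>t. S t x)"
  by (rule C0_semigroup_continuous[OF C0])

lemma S_continuous_Icc: "continuous_on {0..h} (\<lambda>t. S t x)"
  by (rule continuous_on_subset[OF S_continuous]) auto

text \<open>The averaged orbit. \<open>J h\<close> maps \<open>X\<close> into \<open>D\<close>, and
  \<open>J h x\<close> divided by \<open>h\<close> tends to \<open>x\<close>; it plays the role of
  the resolvent in the density arguments for \<open>D\<close> and \<open>D'\<close>.\<close>

definition J :: "real \<Rightarrow> 'x \<Rightarrow> 'x" where
  "J h x = integral {0..h} (\<lambda>t. S t x)"

lemma J_integrable: "(\<lambda>t. S t x) integrable_on {0..h}"
  by (rule integrable_continuous_interval[OF S_continuous_Icc])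

lemma bounded_linear_J:
  assumes "h \<ge> 0"
  shows "bounded_linear (J h)"
proof -
  obtain M where M: "M \<ge> 0" "\<And>t. 0 \<le> t \<Longrightarrow> t \<le> h \<Longrightarrow> norm (S t) \<le> M"
    using C0_semigroup_bounded[OF C0] by blast
  show ?thesis
  proof (rule bounded_linear_intro)
    show "J h (x + y) = J h x + J h y" for x y
      by (simp add: J_def blinfun.add_right integral_add J_integrable)
    show "J h (c *\<^sub>R x) = c *\<^sub>R J h x" for c x
      by (simp add: J_def blinfun.scaleR_right)
    show "norm (J h x) \<le> norm x * (M * (h - 0))" for x
    proof -
      have "norm (J h x) \<le> (M * norm x) * (h - 0)"
        unfolding J_def
      proof (rule integral_bound[OF assms S_continuous_Icc])
        show "norm (S t x) \<le> M * norm x" if "t \<in> {0..h}" for t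
          using norm_blinfun[of "S t" x] mult_right_mono[OF M(2)[of t], of "norm x"] that by fastforce
      qed
      then show ?thesis by (simp add: mult_ac)
    qed
  qed
qed

lemma S_J:
  assumes "s \<ge> 0"
  shows "S s (J h x) = J h (S s x)"
proof -
  have "J h (S s x) = integral {0..h} (S s \<circ> (\<lambda>t. S t x))"
    unfolding J_def o_def
    by (rule Henstock_Kurzweil_Integration.integral_cong) (use assms S_add in \<open>metis add.commute atLeastAtMost_iff\<close>)
  also have "\<dots> = S s (J h x)"
    unfolding J_def by (rule integral_linear[OF J_integrable blinfun.bounded_linear_right])
  finally show ?thesis by simp
qed

lemma S_J_eq_diff:
  assumes "s \<ge> 0" "h \<ge> 0"
  shows "S s (J h x) = J (h + s) x - J s x"
proof -
  have "J h (S s x) = integral {0..h} (\<lambda>t. S (t + s) x)"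
    unfolding J_def
    by (rule Henstock_Kurzweil_Integration.integral_cong) (use assms S_add in simp)
  also have "\<dots> = integral {s..h + s} (\<lambda>t. S t x)"
    using integral_shift_Icc_real[of 0 h "\<lambda>t. S t x" s] by (simp add: o_def add.commute)
  also have "\<dots> = J (h + s) x - J s x"
    using Henstock_Kurzweil_Integration.integral_combine[of 0 s "h + s" "\<lambda>t. S t x"] assms J_integrable
    by (simp add: J_def algebra_simps)
  finally show ?thesis using S_J[OF assms(1)] by simp
qed

text \<open>The fundamental theorem of calculus, taken from the right because at
  \<open>h = 0\<close> the orbit is given on one side only.\<close>

lemma J_difference_quotient:
  assumes "h \<ge> 0"
  shows "((\<lambda>s. (J (h + s) x - J h x) /\<^sub>R s) \<longlongrightarrow> S h x) (at_right 0)"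
proof -
  have "((\<lambda>u. J u x) has_vector_derivative S h x) (at h within {0..h + 1})"
    unfolding J_def by (rule integral_has_vector_derivative[OF S_continuous_Icc]) (use assms in auto)
  then have "((\<lambda>u. norm (J u x - J h x - (u - h) *\<^sub>R S h x) / norm (u - h)) \<longlongrightarrow> 0) (at h within {0..h + 1})"
    unfolding has_vector_derivative_def has_derivative_iff_norm by blast
  moreover have "at_right h \<le> at h within {0..h + 1}"
    using at_within_Icc_at_right[of h "h + 1"] at_le[of "{h..h + 1}" "{0..h + 1}" h] assms by auto
  ultimately have "((\<lambda>u. norm (J u x - J h x - (u - h) *\<^sub>R S h x) / norm (u - h)) \<longlongrightarrow> 0) (at_right h)"
    by (rule tendsto_mono[rotated])
  moreover have "\<forall>\<^sub>F u in at_right h. norm (J u x - J h x - (u - h) *\<^sub>R S h x) / norm (u - h)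
      = norm ((J u x - J h x) /\<^sub>R (u - h) - S h x)"
    using eventually_at_right_less[of h]
  proof eventually_elim
    case (elim u)
    then have "(J u x - J h x) /\<^sub>R (u - h) - S h x = (J u x - J h x - (u - h) *\<^sub>R S h x) /\<^sub>R (u - h)"
      by (simp add: scaleR_diff_right)
    then show ?case by (simp add: divide_inverse mult.commute)
  qed
  ultimately have "((\<lambda>u. norm ((J u x - J h x) /\<^sub>R (u - h) - S h x)) \<longlongrightarrow> 0) (at_right h)"
    by (rule Lim_transform_eventually)
  then have "((\<lambda>u. (J u x - J h x) /\<^sub>R (u - h)) \<longlongrightarrow> S h x) (at_right h)"
    by (simp add: tendsto_norm_zero_iff LIM_zero_iff)
  then show ?thesis
    by (simp add: filterlim_at_right_to_0[of _ _ h] add.commute)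
qed

lemma J_over_h: "((\<lambda>h. J h x /\<^sub>R h) \<longlongrightarrow> x) (at_right 0)"
  using J_difference_quotient[of 0 x] by (simp add: J_def)

text \<open>By \<open>S_J_eq_diff\<close> the difference quotient of \<open>J h x\<close> is that of
  the integral at its upper end \<open>h\<close> minus that at its lower end 0.\<close>

lemma J_in_D:
  assumes "h \<ge> 0"
  shows "J h x \<in> D" "A (J h x) = S h x - x"
proof -
  have "((\<lambda>s. (J (h + s) x - J h x) /\<^sub>R s - J s x /\<^sub>R s) \<longlongrightarrow> S h x - x) (at_right 0)"
    by (intro tendsto_diff J_difference_quotient J_over_h assms)
  moreover have "\<forall>\<^sub>F s in at_right 0. (J (h + s) x - J h x) /\<^sub>R s - J s x /\<^sub>R s = (S s (J h x) - J h x) /\<^sub>R s"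
    using eventually_at_right_less[of 0]
  proof eventually_elim
    case (elim s)
    then show ?case
      using S_J_eq_diff[of s h x] assms by (simp add: scaleR_diff_right[symmetric] algebra_simps del: scaleR_diff_right)
  qed
  ultimately have "((\<lambda>s. (S s (J h x) - J h x) /\<^sub>R s) \<longlongrightarrow> S h x - x) (at_right 0)"
    by (rule Lim_transform_eventually)
  then show "J h x \<in> D" "A (J h x) = S h x - x" by (rule A_eqI)+
qed

text \<open>A bounded operator that commutes with the semigroup carries difference quotients to
  difference quotients. It serves for \<open>F = J h\<close> and for \<open>F = S t\<close>.\<close>

lemma S_diff_quotient_map:
  assumes "bounded_linear F" and comm: "\<And>s y. s \<ge> 0 \<Longrightarrow> S s (F y) = F (S s y)" and "x \<in> D"
  shows "F x \<in> D" "A (F x) = F (A x)"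
proof -
  interpret bounded_linear F by fact
  have "((\<lambda>s. F ((S s x - x) /\<^sub>R s)) \<longlongrightarrow> F (A x)) (at_right 0)"
    by (rule tendsto[OF A_lim[OF assms(3)]])
  moreover have "\<forall>\<^sub>F s in at_right 0. F ((S s x - x) /\<^sub>R s) = (S s (F x) - F x) /\<^sub>R s"
    using eventually_at_right_less[of 0] by eventually_elim (simp add: comm diff scale)
  ultimately have "((\<lambda>s. (S s (F x) - F x) /\<^sub>R s) \<longlongrightarrow> F (A x)) (at_right 0)"
    by (rule Lim_transform_eventually)
  then show "F x \<in> D" "A (F x) = F (A x)" by (rule A_eqI)+
qed

lemma J_A: "h \<ge> 0 \<Longrightarrow> x \<in> D \<Longrightarrow> J h (A x) = S h x - x"
  using S_diff_quotient_map(2)[OF bounded_linear_J S_J] J_in_D(2) by metis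

lemma S_in_D: "t \<ge> 0 \<Longrightarrow> x \<in> D \<Longrightarrow> S t x \<in> D"
  and A_S: "t \<ge> 0 \<Longrightarrow> x \<in> D \<Longrightarrow> A (S t x) = S t (A x)"
  using S_diff_quotient_map[OF blinfun.bounded_linear_right, of "S t" x] S_add
  by (metis add.commute)+

lemma D_separates:
  assumes "\<And>y. y \<in> D \<Longrightarrow> y \<bullet> x = 0"
  shows "x = 0"
proof -
  have "((\<lambda>h. (J h x /\<^sub>R h) \<bullet> x) \<longlongrightarrow> x \<bullet> x) (at_right 0)"
    by (intro tendsto_inner J_over_h tendsto_const)
  moreover have "\<forall>\<^sub>F h in at_right 0. (J h x /\<^sub>R h) \<bullet> x = 0"
    using eventually_at_right_less[of 0] by eventually_elim (simp add: assms J_in_D)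
  ultimately have "((\<lambda>_. 0) \<longlongrightarrow> x \<bullet> x) (at_right (0::real))"
    by (rule Lim_transform_eventually)
  then show ?thesis
    using tendsto_unique[OF trivial_limit_at_right_real _ tendsto_const] by (metis inner_eq_zero_iff)
qed

lemma D'_iff: "z \<in> D' \<longleftrightarrow> (\<exists>w. \<forall>x\<in>D. A x \<bullet> z = x \<bullet> w)"
  by (simp add: dom_adj_def)

text \<open>By \<open>D_separates\<close> at most one \<open>w\<close> satisfies the identity, so
  the description that defines \<open>gen_adj\<close> picks it.\<close>

lemma A'_eqI:
  assumes "\<And>x. x \<in> D \<Longrightarrow> A x \<bullet> z = x \<bullet> w"
  shows "z \<in> D'" "A' z = w"
proof -
  show "z \<in> D'" using assms by (auto simp: D'_iff)
  show "A' z = w"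
    unfolding gen_adj_def
  proof (rule the_equality)
    fix w' assume "\<forall>x\<in>D. A x \<bullet> z = x \<bullet> w'"
    then have "w' - w = 0" using assms by (intro D_separates) (simp add: inner_diff_right)
    then show "w' = w" by simp
  qed (use assms in blast)
qed

lemma inner_A': "z \<in> D' \<Longrightarrow> x \<in> D \<Longrightarrow> x \<bullet> A' z = A x \<bullet> z"
  using A'_eqI D'_iff by metis

lemma A'_add: "z \<in> D' \<Longrightarrow> w \<in> D' \<Longrightarrow> z + w \<in> D' \<and> A' (z + w) = A' z + A' w"
  using A'_eqI[of "z + w" "A' z + A' w"] by (simp add: inner_add_right inner_A')

lemma A'_diff: "z \<in> D' \<Longrightarrow> w \<in> D' \<Longrightarrow> z - w \<in> D' \<and> A' (z - w) = A' z - A' w"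
  using A'_eqI[of "z - w" "A' z - A' w"] by (simp add: inner_diff_right inner_A')

lemma A'_scaleR: "z \<in> D' \<Longrightarrow> c *\<^sub>R z \<in> D' \<and> A' (c *\<^sub>R z) = c *\<^sub>R A' z"
  using A'_eqI[of "c *\<^sub>R z" "c *\<^sub>R A' z"] by (simp add: inner_A')

lemma A'_0: "0 \<in> D'"
  by (rule A'_eqI[of 0 0]) simp

lemma subspace_D': "subspace D'"
  using A'_add A'_scaleR A'_0 by (simp add: subspace_def)

lemma inner_S': "x \<bullet> S' t z = S t x \<bullet> z"
  by (simp add: sg_adj_def inner_adjoint blinfun.bounded_linear_right)

lemma bounded_linear_S': "bounded_linear (S' t)"
  unfolding sg_adj_def by (rule bounded_linear_adjoint(1)[OF blinfun.bounded_linear_right])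

lemma S'_add: "s \<ge> 0 \<Longrightarrow> t \<ge> 0 \<Longrightarrow> S' (s + t) z = S' s (S' t z)"
  by (rule vector_eq_ldot[THEN iffD1]) (simp add: inner_S' S_add[symmetric] add.commute)

lemma S'_in_D': "t \<ge> 0 \<Longrightarrow> z \<in> D' \<Longrightarrow> S' t z \<in> D'"
  and A'_S': "t \<ge> 0 \<Longrightarrow> z \<in> D' \<Longrightarrow> A' (S' t z) = S' t (A' z)"
  using A'_eqI[of "S' t z" "S' t (A' z)"] by (simp_all add: inner_S' inner_A' S_in_D A_S)

lemma D'_separates:
  assumes "\<And>z. z \<in> D' \<Longrightarrow> x \<bullet> z = 0"
  shows "x = 0"
proof -
  have J0: "J h x = 0" if h: "h \<ge> 0" for h
  proof (rule vector_eq_rdot[THEN iffD1, rule_format])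
    fix z
    note bl = bounded_linear_J[OF h]
    have "adjoint (J h) z \<in> D'"
      by (rule A'_eqI(1)[of _ "S' h z - z"])
         (simp add: inner_adjoint[OF bl] J_A[OF h] inner_diff_left inner_diff_right inner_S')
    then have "x \<bullet> adjoint (J h) z = 0" by (rule assms)
    then show "J h x \<bullet> z = 0 \<bullet> z" by (simp add: inner_adjoint[OF bl])
  qed
  have "\<forall>\<^sub>F h in at_right 0. J h x /\<^sub>R h = 0"
    using eventually_at_right_less[of 0] by eventually_elim (simp add: J0)
  then have "((\<lambda>_. 0) \<longlongrightarrow> x) (at_right (0::real))"
    by (rule Lim_transform_eventually[OF J_over_h])
  then show ?thesis
    using tendsto_unique[OF trivial_limit_at_right_real _ tendsto_const] by metis
qed

lemma dense_D': "closure D' = UNIV"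
  by (rule dense_subspace[OF subspace_D' D'_separates])

text \<open>
  On \<open>D'\<close> the identity \<open>(S t x - x) \<bullet> w = J t x \<bullet> A' w\<close> makes \<open>S'\<close> Lipschitz continuous; density of \<open>D'\<close>
  and local boundedness do the rest.
\<close>

lemma S'_strongly_continuous_at_0: "((\<lambda>t. S' t z) \<longlongrightarrow> z) (at_right 0)"
proof (rule tendstoI)
  fix \<epsilon> :: real assume \<epsilon>: "\<epsilon> > 0"
  obtain M where M: "M \<ge> 0" "\<And>t. 0 \<le> t \<Longrightarrow> t \<le> 1 \<Longrightarrow> norm (S t) \<le> M"
    using C0_semigroup_bounded[OF C0] by blast
  \<comment> \<open>Replacing \<open>z\<close> by a nearby \<open>w\<close> costs
    \<open>M * \<eta>\<close> under \<open>S' t\<close> and \<open>\<eta>\<close> without it,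
    together half of \<open>\<epsilon>\<close>.\<close>
  define \<eta> where "\<eta> = \<epsilon> / (2 * (M + 1))"
  have \<eta>: "\<eta> > 0" "M * \<eta> + \<eta> = \<epsilon> / 2" 
  proof -
    show "\<eta> > 0" using \<epsilon> M by (simp add: \<eta>_def)
    define N where "N = M + 1"
    have "M * \<eta> + \<eta> = N * \<eta>" by (simp add: N_def algebra_simps)
    also have "\<dots> = \<epsilon> / 2" using M unfolding \<eta>_def N_def[symmetric] by (simp add: N_def[symmetric]) (simp add: N_def)
    finally show "M * \<eta> + \<eta> = \<epsilon> / 2" .
  qed
  obtain w where w: "w \<in> D'" "norm (z - w) < \<eta>"
    using dense_D' \<eta> by (metis UNIV_I closure_approachable dist_norm norm_minus_commute)
  define d where "d = min 1 (\<epsilon> / (2 * (M * norm (A' w) + 1)))"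
  have d: "d > 0" using \<epsilon> M by (simp add: d_def add_nonneg_pos)
  have "dist (S' t z) z < \<epsilon>" if t: "0 < t" "t < d" for t
  proof -
    have t1: "t \<le> 1" using t by (simp add: d_def)
    have nS: "norm (S' t y) \<le> M * norm y" for y
    proof -
      have "norm (S' t y) \<le> onorm (S t) * norm y"
        unfolding sg_adj_def by (rule bounded_linear_adjoint(2)[OF blinfun.bounded_linear_right])
      also have "\<dots> \<le> M * norm y" using M(2)[of t] t t1 by (intro mult_right_mono) (auto simp: norm_blinfun.rep_eq)
      finally show ?thesis .
    qed
    have "norm (S' t w - w) \<le> t * M * norm (A' w)"
    proof -
      let ?v = "S' t w - w"
      have "norm ?v * norm ?v = (S t ?v - ?v) \<bullet> w"
      proof -
        have "(S t v - v) \<bullet> w = v \<bullet> (S' t w - w)" for v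
          by (simp add: inner_diff_left inner_diff_right inner_S')
        then show ?thesis by (metis power2_norm_eq_inner power2_eq_square)
      qed
      also have "\<dots> = J t ?v \<bullet> A' w" using t by (simp add: inner_A'[OF w(1)] J_in_D)
      also have "\<dots> \<le> norm (J t ?v) * norm (A' w)" by (rule norm_cauchy_schwarz)
      also have "\<dots> \<le> (M * norm ?v * (t - 0)) * norm (A' w)"
      proof (rule mult_right_mono)
        show "norm (J t ?v) \<le> M * norm ?v * (t - 0)"
          unfolding J_def
        proof (rule integral_bound[OF _ S_continuous_Icc])
          show "norm (S s ?v) \<le> M * norm ?v" if "s \<in> {0..t}" for s
            using norm_blinfun[of "S s" ?v] mult_right_mono[OF M(2)[of s], of "norm ?v"] that t1 by fastforce
        qed (use t in simp)
      qed simp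
      finally have "norm ?v * norm ?v \<le> norm ?v * (t * M * norm (A' w))" by (simp add: mult_ac)
      then show ?thesis using M(1) t by (cases "?v = 0") auto
    qed
    also have "\<dots> \<le> t * (M * norm (A' w) + 1)" using t by (simp add: algebra_simps)
    also have "\<dots> < \<epsilon> / 2"
    proof -
      have "t < \<epsilon> / (2 * (M * norm (A' w) + 1))" using t by (simp add: d_def)
      moreover have "0 < M * norm (A' w) + 1" using M by (simp add: add_nonneg_pos)
      ultimately show ?thesis by (simp add: field_simps)
    qed
    finally have 1: "norm (S' t w - w) < \<epsilon> / 2" .
    have "S' t z - z = S' t (z - w) + (S' t w - w) + (w - z)"
      by (simp add: bounded_linear.linear[OF bounded_linear_S'] linear_diff)
    then have "norm (S' t z - z) \<le> norm (S' t (z - w)) + norm (S' t w - w) + norm (w - z)"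
      by (simp only:) (intro norm_triangle_le add_right_mono norm_triangle_ineq)
    also have "\<dots> < M * \<eta> + \<epsilon> / 2 + \<eta>"
    proof -
      have "norm (S' t (z - w)) \<le> M * \<eta>"
        using nS[of "z - w"] mult_left_mono[OF less_imp_le[OF w(2)] M(1)] by (rule order_trans)
      moreover have "norm (w - z) < \<eta>" using w(2) by (simp add: norm_minus_commute)
      ultimately show ?thesis using 1 by - (rule add_strict_mono[OF add_le_less_mono])
    qed
    also have "\<dots> = \<epsilon>" using \<eta>(2) by simp
    finally show ?thesis by (simp add: dist_norm)
  qed
  then show "\<forall>\<^sub>F t in at_right 0. dist (S' t z) z < \<epsilon>"
    using d by (auto simp: eventually_at_right_field)
qed

lemma S'_continuous: "continuous_on {0..} (\<lambda>t. S' t z)"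
proof -
  have app: "blinfun_apply (Blinfun (S' t)) = S' t" for t
    by (rule bounded_linear_Blinfun_apply[OF bounded_linear_S'])
  have "S' 0 z = z" for z
    by (rule vector_eq_ldot[THEN iffD1]) (simp add: inner_S')
  then have "C0_semigroup (\<lambda>t. Blinfun (S' t))"
    unfolding C0_semigroup_def
    by (auto simp: app S'_add S'_strongly_continuous_at_0 intro!: blinfun_eqI)
  from C0_semigroup_continuous[OF this] show ?thesis by (simp add: app)
qed

end

section \<open>Lebesgue spaces on intervals\<close>

lemma interval_lmeasurable [simp]: "{a<..<b::real} \<in> lmeasurable"
  using lmeasurable_box[of a b] by (simp only: box_real)

lemma interval_sets_lebesgue [simp]: "{a<..<b::real} \<in> sets lebesgue"
  by (rule fmeasurableD) simp

lemma integral_lebesgue_on_if: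
  fixes f :: "'a::euclidean_space \<Rightarrow> real"
  assumes "A \<subseteq> B" "A \<in> sets lebesgue" "B \<in> sets lebesgue"
  shows "(LINT t|lebesgue_on B. (if t \<in> A then f t else 0)) = (LINT t|lebesgue_on A. f t)"
    and "integrable (lebesgue_on B) (\<lambda>t. if t \<in> A then f t else 0) \<longleftrightarrow> integrable (lebesgue_on A) f"
proof -
  have *: "(\<lambda>t. if t \<in> B then if t \<in> A then f t else 0 else 0) = (\<lambda>t. if t \<in> A then f t else 0)"
    by (rule ext) (use assms(1) in auto)
  show "(LINT t|lebesgue_on B. (if t \<in> A then f t else 0)) = (LINT t|lebesgue_on A. f t)"
    using Lebesgue_Measure.integral_restrict_UNIV[OF assms(3), of "\<lambda>t. if t \<in> A then f t else 0"]
      Lebesgue_Measure.integral_restrict_UNIV[OF assms(2), of f] by (simp add: *)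
  show "integrable (lebesgue_on B) (\<lambda>t. if t \<in> A then f t else 0) \<longleftrightarrow> integrable (lebesgue_on A) f"
    using Lebesgue_Measure.integrable_restrict_UNIV[OF assms(3), of "\<lambda>t. if t \<in> A then f t else 0"]
      Lebesgue_Measure.integrable_restrict_UNIV[OF assms(2), of f] by (simp add: *)
qed

lemma integrable_lebesgue_on_subset:
  fixes f :: "'a::euclidean_space \<Rightarrow> real"
  assumes "integrable (lebesgue_on B) f" "A \<subseteq> B" "A \<in> sets lebesgue" "B \<in> sets lebesgue"
  shows "integrable (lebesgue_on A) f"
proof -
  have "integrable (lebesgue_on B) (\<lambda>t. indicator A t *\<^sub>R f t)"
    by (rule integrable_mult_indicator) (use assms in \<open>auto simp: sets_restrict_space_iff\<close>)
  then have "integrable (lebesgue_on B) (\<lambda>t. if t \<in> A then f t else 0)"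
    by (rule back_subst[of "integrable (lebesgue_on B)"]) (auto simp: indicator_def)
  then show ?thesis using integral_lebesgue_on_if(2)[OF assms(2-4)] by blast
qed

lemma AE_lebesgue_on_subset:
  assumes "AE t in lebesgue_on B. P t" "A \<subseteq> B" "A \<in> sets lebesgue" "B \<in> sets lebesgue"
  shows "AE t in lebesgue_on A. P t"
  using assms by (auto simp: AE_restrict_space_iff elim: eventually_mono)

lemma integrable_inner_bounded:
  fixes v w :: "'a::euclidean_space \<Rightarrow> 'b::real_inner"
  assumes v: "v measurable_on S" "integrable (lebesgue_on S) (\<lambda>t. norm (v t))"
    and w: "w measurable_on S" "AE t in lebesgue_on S. norm (w t) \<le> M" and S: "S \<in> sets lebesgue"
  shows "integrable (lebesgue_on S) (\<lambda>t. v t \<bullet> w t)"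
    and "\<bar>LINT t|lebesgue_on S. v t \<bullet> w t\<bar> \<le> M * (LINT t|lebesgue_on S. norm (v t))"
proof -
  have Mi: "integrable (lebesgue_on S) (\<lambda>t. M * norm (v t))" using v(2) by simp
  have le: "AE t in lebesgue_on S. \<bar>v t \<bullet> w t\<bar> \<le> M * norm (v t)"
    using w(2)
  proof eventually_elim
    fix t assume "norm (w t) \<le> M"
    then have "norm (v t) * norm (w t) \<le> M * norm (v t)"
      using mult_left_mono[of "norm (w t)" M "norm (v t)"] by (simp add: mult.commute)
    with Cauchy_Schwarz_ineq2[of "v t" "w t"] show "\<bar>v t \<bullet> w t\<bar> \<le> M * norm (v t)" by linarith
  qed
  show int: "integrable (lebesgue_on S) (\<lambda>t. v t \<bullet> w t)"
    by (rule Bochner_Integration.integrable_bound[OF Mi measurable_on_inner[OF v(1) w(1) S]])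
       (use le in \<open>eventually_elim, simp\<close>)
  have "\<bar>LINT t|lebesgue_on S. v t \<bullet> w t\<bar> \<le> (LINT t|lebesgue_on S. \<bar>v t \<bullet> w t\<bar>)"
    by (rule integral_abs_bound)
  also have "\<dots> \<le> (LINT t|lebesgue_on S. M * norm (v t))"
    by (rule integral_mono_AE[OF integrable_abs[OF int] Mi le])
  finally show "\<bar>LINT t|lebesgue_on S. v t \<bullet> w t\<bar> \<le> M * (LINT t|lebesgue_on S. norm (v t))" by simp
qed

lemma powr_le_one_plus_powr:
  fixes x :: real
  assumes "0 \<le> q" "q \<le> p" "0 \<le> x"
  shows "x powr q \<le> 1 + x powr p"
proof (cases "x \<le> 1")
  case True
  then have "x powr q \<le> 1" using assms by (intro powr_le1) auto
  then show ?thesis by (simp add: add_increasing2)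
next
  case False
  then have "x powr q \<le> x powr p" using assms by (intro powr_mono) auto
  then show ?thesis by simp
qed

lemma Lp_mono:
  assumes "f \<in> Lp p S" "1 \<le> q" "q \<le> p" "S \<in> lmeasurable"
  shows "f \<in> Lp q S"
proof -
  interpret finite_measure "lebesgue_on S" using assms(4) by (rule finite_measure_lebesgue_on)
  have le: "norm y powr q \<le> 1 + norm y powr p" for y :: 'a
    using powr_le_one_plus_powr[of q p "norm y"] assms(2,3) by simp
  have m: "(\<lambda>t. norm (f t)) \<in> borel_measurable (lebesgue_on S)"
    using assms by (intro measurable_on_norm) (auto simp: Lp_def)
  have "integrable (lebesgue_on S) (\<lambda>t. norm (f t) powr q)"
    by (rule Bochner_Integration.integrable_bound[of "lebesgue_on S" "\<lambda>t. 1 + norm (f t) powr p"])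
       (use assms m le in \<open>auto simp: Lp_def\<close>)
  then show ?thesis using assms(1) by (simp add: Lp_def)
qed

lemma Lp_integrable_norm:
  assumes "f \<in> Lp p S" "p \<ge> 1" "S \<in> lmeasurable"
  shows "integrable (lebesgue_on S) (\<lambda>t. norm (f t))"
  using Lp_mono[OF assms(1) _ assms(2,3)] by (simp add: Lp_def)

text \<open>An almost everywhere inequality with a real radius keeps extended reals out of the
  estimates; \<open>r\<close> may exceed the norm of \<open>v\<close>.\<close>

definition Linf_ball :: "real \<Rightarrow> real \<Rightarrow> (real \<Rightarrow> 'a::real_normed_vector) set" where
  "Linf_ball T r = {v. v measurable_on {0<..<T} \<and> (AE t in lebesgue_on {0<..<T}. norm (v t) \<le> r)}"

lemma Linf_norm_le_iff:
  assumes "v measurable_on S" "S \<in> sets lebesgue"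
  shows "Linf_norm S v \<le> ereal r \<longleftrightarrow> (AE t in lebesgue_on S. norm (v t) \<le> r)"
proof -
  have m: "(\<lambda>t. ereal (norm (v t))) \<in> borel_measurable (lebesgue_on S)"
    using measurable_on_norm[OF assms] by simp
  show ?thesis
  proof
    assume "Linf_norm S v \<le> ereal r"
    then show "AE t in lebesgue_on S. norm (v t) \<le> r"
      using esssup_AE[of "\<lambda>t. ereal (norm (v t))" "lebesgue_on S"] unfolding Linf_norm_def
      by (auto elim!: eventually_mono dest: order_trans)
  qed (use esssup_I[OF m, of "ereal r"] in \<open>simp add: Linf_norm_def\<close>)
qed

lemma Linf_ball_iff: "v \<in> Linf_ball T r \<longleftrightarrow> v measurable_on {0<..<T} \<and> Linf_norm {0<..<T} v \<le> ereal r"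
  using Linf_norm_le_iff[of v "{0<..<T}" r] by (auto simp: Linf_ball_def)

lemma Linf_ball_subset_Linf: "v \<in> Linf_ball T r \<Longrightarrow> v \<in> Linf {0<..<T}"
  by (auto simp: Linf_ball_iff Linf_def less_ereal.simps intro: le_less_trans)

text \<open>Positivity of \<open>T\<close> excludes the null interval, on which the essential
  supremum is -\<infinity>. For a nonmeasurable function it is \<infinity> by convention.\<close>

lemma Linf_norm_nonneg:
  assumes "T > 0"
  shows "0 \<le> Linf_norm {0<..<T} v"
proof (cases "(\<lambda>t. ereal (norm (v t))) \<in> borel_measurable (lebesgue_on {0<..<T})")
  case True
  have "emeasure (lebesgue_on {0<..<T}) (space (lebesgue_on {0<..<T})) \<noteq> 0"
    using assms by (simp add: emeasure_restrict_space)
  then have "0 = esssup (lebesgue_on {0<..<T}) (\<lambda>_. 0 :: ereal)" by (simp add: esssup_const)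
  also have "\<dots> \<le> Linf_norm {0<..<T} v" unfolding Linf_norm_def by (rule esssup_mono) auto
  finally show ?thesis .
qed (simp add: Linf_norm_def esssup_non_measurable top_ereal_def)

lemma Linf_ballE:
  assumes "v \<in> Linf {0<..<T}" "T > 0"
  obtains r where "r \<ge> 0" "Linf_norm {0<..<T} v = ereal r" "v \<in> Linf_ball T r"
proof -
  have "Linf_norm {0<..<T} v < \<infinity>" "v measurable_on {0<..<T}" using assms by (auto simp: Linf_def)
  with Linf_norm_nonneg[OF assms(2), of v] show thesis
    by (cases "Linf_norm {0<..<T} v") (auto simp: Linf_ball_iff intro: that)
qed

lemma Linf_ball_integrable:
  assumes "v \<in> Linf_ball T r"
  shows "integrable (lebesgue_on {0<..<T}) (\<lambda>t. norm (v t))"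
proof -
  interpret finite_measure "lebesgue_on {0<..<T}" by (rule finite_measure_lebesgue_on) simp
  show ?thesis
    using assms by (intro integrable_const_bound[where B=r] measurable_on_norm) (auto simp: Linf_ball_def)
qed

lemma Linf_ball_Lp:
  assumes "v \<in> Linf_ball T r" "r \<ge> 0" "T > 0"
  shows "v \<in> Lp 2 {0<..<T}" "Lp_norm 2 {0<..<T} v \<le> r * sqrt T"
proof -
  let ?M = "lebesgue_on {0<..<T}"
  interpret finite_measure ?M by (rule finite_measure_lebesgue_on) simp
  have v: "v measurable_on {0<..<T}" and le: "AE t in ?M. norm (v t) \<le> r"
    using assms(1) by (auto simp: Linf_ball_def)
  have m: "(\<lambda>t. norm (v t) powr 2) \<in> borel_measurable ?M"
    using measurable_on_norm[OF v] by simp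
  have le2: "AE t in ?M. norm (v t) powr 2 \<le> r powr 2"
    using le by eventually_elim (rule powr_mono2; simp)
  have i: "integrable ?M (\<lambda>t. norm (v t) powr 2)"
    by (rule integrable_const_bound[where B="r powr 2", OF _ m]) (use le2 in simp)
  then show "v \<in> Lp 2 {0<..<T}" using v by (simp add: Lp_def)
  have "(LINT t|?M. norm (v t) powr 2) \<le> (LINT t|?M. r powr 2)"
    by (rule integral_mono_AE[OF i _ le2]) simp
  also have "\<dots> = r powr 2 * T" using assms(3) by (simp add: measure_restrict_space)
  finally have "Lp_norm 2 {0<..<T} v \<le> (r powr 2 * T) powr (1/2)"
    unfolding Lp_norm_def by (intro powr_mono2) (auto intro: integral_nonneg)
  also have "\<dots> = r * sqrt T"
    using assms by (simp add: powr_mult powr_powr powr_half_sqrt)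
  finally show "Lp_norm 2 {0<..<T} v \<le> r * sqrt T" .
qed

section \<open>Duality between controls and observations\<close>

context admissible_system
begin

abbreviation "B' \<equiv> ctrl_adj \<Sigma>"

lemma ctrl_bounded:
  obtains C where "C \<ge> 0" "\<And>u z. z \<in> D' \<Longrightarrow> \<bar>ctrl \<Sigma> u z\<bar> \<le> C * norm u * graph_norm \<Sigma> z"
proof -
  obtain C where C: "\<And>u z. z \<in> D' \<Longrightarrow> \<bar>ctrl \<Sigma> u z\<bar> \<le> C * norm u * graph_norm \<Sigma> z"
    using control_system unfolding control_system_def bounded_into_Xm1_def by blast
  have g: "0 \<le> graph_norm \<Sigma> z" for z by (simp add: graph_norm_def)
  show thesis
  proof (rule that[of "\<bar>C\<bar>"])
    fix u z assume "z \<in> D'"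
    from C[OF this, of u] show "\<bar>ctrl \<Sigma> u z\<bar> \<le> \<bar>C\<bar> * norm u * graph_norm \<Sigma> z"
      by (rule order_trans) (intro mult_right_mono abs_ge_self norm_ge_zero g)
  qed simp
qed

lemma bounded_linear_ctrl:
  assumes "z \<in> D'"
  shows "bounded_linear (\<lambda>u. ctrl \<Sigma> u z)"
proof -
  obtain C where "\<And>u z. z \<in> D' \<Longrightarrow> \<bar>ctrl \<Sigma> u z\<bar> \<le> C * norm u * graph_norm \<Sigma> z"
    using ctrl_bounded by blast
  then show ?thesis
    using assms control_system unfolding control_system_def bounded_into_Xm1_def
    by (intro bounded_linear_intro[where K="C * graph_norm \<Sigma> z"]) (auto simp: mult_ac)
qed

lemma inner_B':
  assumes "z \<in> D'"
  shows "u \<bullet> B' z = ctrl \<Sigma> u z"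
proof -
  obtain w where w: "\<And>u. ctrl \<Sigma> u z = u \<bullet> w"
    using riesz_representation[OF bounded_linear_ctrl[OF assms]] by blast
  have "B' z = w"
    unfolding ctrl_adj_def using w by (intro the_equality) (auto simp: vector_eq_ldot)
  then show ?thesis using w by simp
qed

lemma ctrl_Xm1: "ctrl \<Sigma> u \<in> Xm1 \<Sigma>"
  using control_system unfolding control_system_def bounded_into_Xm1_def by blast

lemma B'_add: "z \<in> D' \<Longrightarrow> w \<in> D' \<Longrightarrow> B' (z + w) = B' z + B' w"
  and B'_scaleR: "z \<in> D' \<Longrightarrow> B' (c *\<^sub>R z) = c *\<^sub>R B' z"
  by (rule vector_eq_ldot[THEN iffD1];
      use ctrl_Xm1 A'_add A'_scaleR in \<open>simp add: inner_B' inner_add_right Xm1_def\<close>)+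

lemma B'_diff: "z \<in> D' \<Longrightarrow> w \<in> D' \<Longrightarrow> B' (z - w) = B' z - B' w"
  using B'_add[of z "(-1) *\<^sub>R w"] B'_scaleR[of w "-1"] A'_scaleR[of w "-1"] by simp

definition obs :: "real \<Rightarrow> 'x \<Rightarrow> real \<Rightarrow> 'u" where
  "obs T z \<tau> = B' (S' (T - \<tau>) z)"

lemma obs_add: "z \<in> D' \<Longrightarrow> w \<in> D' \<Longrightarrow> \<tau> \<le> T \<Longrightarrow> obs T (z + w) \<tau> = obs T z \<tau> + obs T w \<tau>"
  by (simp add: obs_def B'_add S'_in_D' linear_add bounded_linear.linear[OF bounded_linear_S'])

lemma obs_scaleR: "z \<in> D' \<Longrightarrow> \<tau> \<le> T \<Longrightarrow> obs T (c *\<^sub>R z) \<tau> = c *\<^sub>R obs T z \<tau>"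
  by (simp add: obs_def B'_scaleR S'_in_D' linear_scale bounded_linear.linear[OF bounded_linear_S'])

text \<open>Through this identity the restriction of \<open>obs T z\<close> to (0, t) agrees with a
  member of \<open>X_space \<Sigma> t\<close>, so that \<open>L^1\<close> limits taken on (0, t) lie
  in \<open>Y_space \<Sigma> t\<close>.\<close>

lemma obs_shift: "\<tau> \<le> t \<Longrightarrow> t \<le> T \<Longrightarrow> obs T z \<tau> = obs t (S' (T - t) z) \<tau>"
  using S'_add[of "t - \<tau>" "T - t" z] by (simp add: obs_def)

text \<open>\<open>B'\<close> is bounded for the graph norm only, so \<open>S'\<close> has to be
  continuous in that norm. As \<open>A'\<close> commutes with \<open>S'\<close> on
  \<open>D'\<close>, this is strong continuity applied to \<open>z\<close> and to
  \<open>A' z\<close>.\<close>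

lemma obs_continuous:
  assumes z: "z \<in> D'"
  shows "continuous_on {..T} (obs T z)"
  unfolding continuous_on_def
proof
  fix \<tau> assume \<tau>: "\<tau> \<in> {..T}"
  obtain C where C: "C \<ge> 0" "\<And>u z. z \<in> D' \<Longrightarrow> \<bar>ctrl \<Sigma> u z\<bar> \<le> C * norm u * graph_norm \<Sigma> z"
    using ctrl_bounded by blast
  have bound: "norm (B' y) \<le> C * graph_norm \<Sigma> y" if y: "y \<in> D'" for y
  proof -
    have "norm (B' y) * norm (B' y) \<le> norm (B' y) * (C * graph_norm \<Sigma> y)"
      using C(2)[OF y, of "B' y"] inner_B'[OF y, of "B' y"]
      by (simp add: power2_norm_eq_inner[symmetric] power2_eq_square mult_ac)
    then show ?thesis using C(1) by (cases "B' y = 0") (auto simp: graph_norm_def)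
  qed
  have lim: "((\<lambda>s. S' (T - s) y) \<longlongrightarrow> S' (T - \<tau>) y) (at \<tau> within {..T})" for y
  proof -
    have "continuous_on {..T} (\<lambda>s. S' (T - s) y)"
      by (rule continuous_on_compose2[OF S'_continuous]) (auto intro!: continuous_intros)
    then show ?thesis using \<tau> by (simp add: continuous_on_def)
  qed
  have g: "((\<lambda>s. C * sqrt ((norm (S' (T - s) z - S' (T - \<tau>) z))\<^sup>2 + (norm (S' (T - s) (A' z) - S' (T - \<tau>) (A' z)))\<^sup>2))
      \<longlongrightarrow> C * sqrt ((norm (S' (T - \<tau>) z - S' (T - \<tau>) z))\<^sup>2 + (norm (S' (T - \<tau>) (A' z) - S' (T - \<tau>) (A' z)))\<^sup>2))
      (at \<tau> within {..T})"
    by (intro tendsto_intros lim)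
  have "((\<lambda>s. norm (obs T z s - obs T z \<tau>)) \<longlongrightarrow> 0) (at \<tau> within {..T})"
  proof (rule tendsto_sandwich[OF _ _ tendsto_const])
    show "\<forall>\<^sub>F s in at \<tau> within {..T}. norm (obs T z s - obs T z \<tau>)
      \<le> C * sqrt ((norm (S' (T - s) z - S' (T - \<tau>) z))\<^sup>2 + (norm (S' (T - s) (A' z) - S' (T - \<tau>) (A' z)))\<^sup>2)"
      unfolding eventually_at_filter
    proof (intro always_eventually allI impI)
      fix s assume s: "s \<noteq> \<tau>" "s \<in> {..T}"
      have D: "S' (T - s) z \<in> D'" "S' (T - \<tau>) z \<in> D'" using z s \<tau> by (auto intro: S'_in_D')
      have "obs T z s - obs T z \<tau> = B' (S' (T - s) z - S' (T - \<tau>) z)"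
        unfolding obs_def by (rule B'_diff[OF D, symmetric])
      then show "norm (obs T z s - obs T z \<tau>)
        \<le> C * sqrt ((norm (S' (T - s) z - S' (T - \<tau>) z))\<^sup>2 + (norm (S' (T - s) (A' z) - S' (T - \<tau>) (A' z)))\<^sup>2)"
        using bound[of "S' (T - s) z - S' (T - \<tau>) z"] A'_diff[OF D] A'_S'[OF _ z] s \<tau>
        by (simp add: graph_norm_def)
    qed
  qed (use g in auto)
  then show "(obs T z \<longlongrightarrow> obs T z \<tau>) (at \<tau> within {..T})"
    by (simp add: tendsto_norm_zero_iff LIM_zero_iff)
qed

lemma obs_measurable:
  assumes z: "z \<in> D'" and E: "E \<in> sets lebesgue" "E \<subseteq> {..T}"
  shows "obs T z measurable_on E"
proof -
  \<comment> \<open>Continuity of \<open>obs T z\<close> is known up to \<open>T\<close> only;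
    freezing it beyond \<open>T\<close> gives a function continuous on the whole line, as
    \<open>measurable_on\<close> demands.\<close>
  have "continuous_on UNIV (\<lambda>\<tau>. obs T z (min \<tau> T))"
    by (rule continuous_on_compose2[OF obs_continuous[OF z]]) (auto intro!: continuous_intros)
  then have "(\<lambda>\<tau>. obs T z (min \<tau> T)) measurable_on UNIV" by (rule continuous_imp_measurable_on)
  then have "(\<lambda>\<tau>. obs T z (min \<tau> T)) measurable_on E" by (rule measurable_on_subset) (use E in auto)
  then show ?thesis
    by (rule measurable_on_spike[of _ _ "{}"]) (use E in \<open>auto simp: min_def\<close>)
qed

lemma obs_bounded:
  assumes z: "z \<in> D'"
  obtains M where "M \<ge> 0" "\<And>\<tau>. \<tau> \<in> {0<..<T} \<Longrightarrow> norm (obs T z \<tau>) \<le> M"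
proof -
  have "compact (obs T z ` {0..T})"
    by (intro compact_continuous_image continuous_on_subset[OF obs_continuous[OF z]]) auto
  then obtain M where "\<And>y. y \<in> obs T z ` {0..T} \<Longrightarrow> norm y \<le> M"
    by (metis compact_imp_bounded bounded_iff)
  then show thesis by (intro that[of "max 0 M"]) (auto intro: max.coboundedI2)
qed

lemma input_integral_eq:
  assumes "z \<in> D'"
  shows "input_integral \<Sigma> T u z = (LINT \<tau>|lebesgue_on {0<..<T}. u \<tau> \<bullet> obs T z \<tau>)"
proof -
  have "input_integral \<Sigma> T u z = (LINT \<tau>|lebesgue_on {0<..<T}. sg_ext \<Sigma> (T - \<tau>) (ctrl \<Sigma> (u \<tau>)) z)"
    using assms by (simp add: input_integral_def Xm1_integral_def)
  also have "\<dots> = (LINT \<tau>|lebesgue_on {0<..<T}. u \<tau> \<bullet> obs T z \<tau>)"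
    using assms by (intro Bochner_Integration.integral_cong) (auto simp: sg_ext_def obs_def inner_B' S'_in_D')
  finally show ?thesis .
qed

lemma embed_inj: "inj (embed \<Sigma>)"
proof (rule injI)
  fix x y assume "embed \<Sigma> x = embed \<Sigma> y"
  then have "x \<bullet> z = y \<bullet> z" if "z \<in> D'" for z
    using that by (metis embed_def restrict_apply')
  then have "x - y = 0" by (intro D'_separates) (simp add: inner_diff_left)
  then show "x = y" by simp
qed

lemma to_X_embed [simp]: "to_X \<Sigma> (embed \<Sigma> x) = x"
  by (simp add: to_X_def embed_inj)

definition reach :: "real \<Rightarrow> (real \<Rightarrow> 'u) \<Rightarrow> 'x" where
  "reach T u = to_X \<Sigma> (input_integral \<Sigma> T u)"

lemma state_eq: "state \<Sigma> T y u = S T y + reach T u"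
  by (simp add: state_def reach_def)

lemma input_integral_embed:
  assumes "\<And>z. z \<in> D' \<Longrightarrow> (LINT \<tau>|lebesgue_on {0<..<T}. u \<tau> \<bullet> obs T z \<tau>) = x \<bullet> z"
  shows "input_integral \<Sigma> T u = embed \<Sigma> x"
proof
  fix z show "input_integral \<Sigma> T u z = embed \<Sigma> x z"
    using assms[of z] by (cases "z \<in> D'") (auto simp: embed_def input_integral_eq, simp add: input_integral_def Xm1_integral_def)
qed

text \<open>The weak identity on \<open>D'\<close> says that the integral is
  \<open>embed \<Sigma> x\<close>, and the inverse of the embedding returns \<open>x\<close>. States
  are identified by their pairings through this rule.\<close>

lemma reach_eqI:
  assumes "\<And>z. z \<in> D' \<Longrightarrow> (LINT \<tau>|lebesgue_on {0<..<T}. u \<tau> \<bullet> obs T z \<tau>) = x \<bullet> z"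
  shows "reach T u = x"
  using input_integral_embed[OF assms] by (simp add: reach_def)

lemma reach_cong:
  assumes "AE \<tau> in lebesgue_on {0<..<T}. u \<tau> = u' \<tau>"
    and "u measurable_on {0<..<T}" "u' measurable_on {0<..<T}"
  shows "reach T u = reach T u'" "input_integral \<Sigma> T u = input_integral \<Sigma> T u'"
proof -
  have eq: "(LINT \<tau>|lebesgue_on {0<..<T}. u \<tau> \<bullet> obs T z \<tau>) = (LINT \<tau>|lebesgue_on {0<..<T}. u' \<tau> \<bullet> obs T z \<tau>)"
    if "z \<in> D'" for z
    using assms(1) by (intro integral_cong_AE measurable_on_inner assms(2,3) obs_measurable that) (auto elim: eventually_mono)
  show "input_integral \<Sigma> T u = input_integral \<Sigma> T u'"
  proof
    fix z show "input_integral \<Sigma> T u z = input_integral \<Sigma> T u' z"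
      using eq[of z] by (cases "z \<in> D'") (auto simp: input_integral_eq, simp add: input_integral_def Xm1_integral_def)
  qed
  then show "reach T u = reach T u'" by (simp add: reach_def)
qed

text \<open>Admissibility speaks of controls on the half-line; a control on (0, T) is extended by 0,
  which changes neither its integral nor its norm on (0, T).\<close>

lemma reach_L2:
  assumes T: "T > 0"
  obtains C where "C > 0" "\<And>u. u \<in> Lp 2 {0<..<T} \<Longrightarrow> norm (reach T u) \<le> C * Lp_norm 2 {0<..<T} u"
    "\<And>u z. u \<in> Lp 2 {0<..<T} \<Longrightarrow> z \<in> D' \<Longrightarrow>
      reach T u \<bullet> z = (LINT \<tau>|lebesgue_on {0<..<T}. u \<tau> \<bullet> obs T z \<tau>)"
proof -
  obtain C where C: "C > 0" "\<And>u. u \<in> L2_loc \<Longrightarrow> input_integral \<Sigma> T u \<in> range (embed \<Sigma>) \<and>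
        norm (to_X \<Sigma> (input_integral \<Sigma> T u)) \<le> C * Lp_norm 2 {0<..<T} u"
    using control_system T unfolding control_system_def admissible_ctrl_op_def by blast
  have main: "input_integral \<Sigma> T u \<in> range (embed \<Sigma>) \<and> norm (reach T u) \<le> C * Lp_norm 2 {0<..<T} u"
    if u: "u \<in> Lp 2 {0<..<T}" for u
  proof -
    define u0 where "u0 t = (if t \<in> {0<..<T} then u t else 0)" for t
    have um: "u measurable_on {0<..<T}" and ui: "integrable (lebesgue_on {0<..<T}) (\<lambda>t. norm (u t) powr 2)"
      using u by (auto simp: Lp_def)
    have u0m: "u0 measurable_on {0<..<T}"
      by (rule measurable_on_spike[OF um, of "{}"]) (auto simp: u0_def)
    have "u0 \<in> Lp 2 {0<..<T'}" if "T' > 0" for T'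
    proof -
      define m where "m = max T T'"
      have "u0 measurable_on {0<..<m}"
        by (rule measurable_on_superset[OF u0m]) (auto simp: u0_def m_def)
      then have 1: "u0 measurable_on {0<..<T'}" by (rule measurable_on_subset) (auto simp: m_def)
      have "integrable (lebesgue_on {0<..<m}) (\<lambda>t. if t \<in> {0<..<T} then norm (u t) powr 2 else 0)"
        using ui by (subst integral_lebesgue_on_if(2)) (auto simp: m_def)
      then have "integrable (lebesgue_on {0<..<m}) (\<lambda>t. norm (u0 t) powr 2)"
        by (rule back_subst[of "integrable _"]) (auto simp: u0_def)
      then have "integrable (lebesgue_on {0<..<T'}) (\<lambda>t. norm (u0 t) powr 2)"
        by (rule integrable_lebesgue_on_subset) (auto simp: m_def)
      with 1 show ?thesis by (simp add: Lp_def)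
    qed
    then have "u0 \<in> L2_loc" by (simp add: L2_loc_def)
    note C' = C(2)[OF this]
    have AE: "AE \<tau> in lebesgue_on {0<..<T}. u0 \<tau> = u \<tau>" by (rule AE_I2) (auto simp: u0_def)
    have "Lp_norm 2 {0<..<T} u0 = Lp_norm 2 {0<..<T} u"
        unfolding Lp_norm_def
      by (rule arg_cong[where f="\<lambda>I. I powr (1 / 2)"], rule Bochner_Integration.integral_cong) (auto simp: u0_def)
    with C' show ?thesis using reach_cong[OF AE u0m um] by (simp add: reach_def)
  qed
  show thesis
  proof (rule that[OF C(1)])
    fix u :: "real \<Rightarrow> 'u" and z assume u: "u \<in> Lp 2 {0<..<T}" and z: "z \<in> D'"
    obtain x where x: "input_integral \<Sigma> T u = embed \<Sigma> x" using main[OF u] by blast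
    then have "reach T u = x" by (simp add: reach_def)
    then show "reach T u \<bullet> z = (LINT \<tau>|lebesgue_on {0<..<T}. u \<tau> \<bullet> obs T z \<tau>)"
      using x z input_integral_eq[OF z, of T u] by (simp add: embed_def)
  qed (use main in blast)
qed

end

lemma Linf_ball_mono: "v \<in> Linf_ball T r \<Longrightarrow> r \<le> r' \<Longrightarrow> v \<in> Linf_ball T r'"
  by (auto simp: Linf_ball_def elim: eventually_mono)

lemma Linf_ball_combine:
  assumes "v \<in> Linf_ball T r" "w \<in> Linf_ball T r'"
  shows "(\<lambda>t. a *\<^sub>R v t + b *\<^sub>R w t) \<in> Linf_ball T (\<bar>a\<bar> * r + \<bar>b\<bar> * r')"
proof -
  have "AE t in lebesgue_on {0<..<T}. norm (v t) \<le> r" "AE t in lebesgue_on {0<..<T}. norm (w t) \<le> r'"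
    using assms by (auto simp: Linf_ball_def)
  then have "AE t in lebesgue_on {0<..<T}. norm (a *\<^sub>R v t + b *\<^sub>R w t) \<le> \<bar>a\<bar> * r + \<bar>b\<bar> * r'"
  proof eventually_elim
    case (elim t)
    have "norm (a *\<^sub>R v t + b *\<^sub>R w t) \<le> \<bar>a\<bar> * norm (v t) + \<bar>b\<bar> * norm (w t)"
      by (rule norm_triangle_le) simp
    also have "\<dots> \<le> \<bar>a\<bar> * r + \<bar>b\<bar> * r'" using elim by (intro add_mono mult_left_mono) auto
    finally show ?case .
  qed
  then show ?thesis
    using assms by (auto simp: Linf_ball_def intro!: measurable_on_add measurable_on_scaleR_const)
qed

lemma zero_Linf_ball: "r \<ge> 0 \<Longrightarrow> (\<lambda>_. 0) \<in> Linf_ball T r"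
  by (simp add: Linf_ball_def)

context admissible_system
begin

lemma obs_AE_bounded:
  assumes z: "z \<in> D'"
  obtains M where "M \<ge> 0" "AE \<tau> in lebesgue_on {0<..<T}. norm (obs T z \<tau>) \<le> M"
proof -
  obtain M where "M \<ge> 0" "\<And>\<tau>. \<tau> \<in> {0<..<T} \<Longrightarrow> norm (obs T z \<tau>) \<le> M"
    using obs_bounded[OF z, of T] by blast
  then show thesis by (intro that[of M] AE_I2) auto
qed

lemma obs_interval_measurable: "z \<in> D' \<Longrightarrow> obs T z measurable_on {0<..<T}"
  by (rule obs_measurable) auto

lemma integrable_inner_obs:
  assumes "u measurable_on {0<..<T}" "integrable (lebesgue_on {0<..<T}) (\<lambda>t. norm (u t))" "z \<in> D'"
  shows "integrable (lebesgue_on {0<..<T}) (\<lambda>\<tau>. u \<tau> \<bullet> obs T z \<tau>)"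
proof -
  obtain M where "AE \<tau> in lebesgue_on {0<..<T}. norm (obs T z \<tau>) \<le> M"
    by (rule obs_AE_bounded[OF assms(3)])
  then show ?thesis
    by (intro integrable_inner_bounded(1)[OF assms(1,2) obs_interval_measurable[OF assms(3)]]) auto
qed

lemma Linf_ball_inner_obs:
  assumes "v \<in> Linf_ball T r" "z \<in> D'"
  shows "integrable (lebesgue_on {0<..<T}) (\<lambda>\<tau>. v \<tau> \<bullet> obs T z \<tau>)"
  using assms Linf_ball_integrable by (intro integrable_inner_obs) (auto simp: Linf_ball_def)

lemma reach_inner:
  assumes "v \<in> Linf_ball T r" "T > 0" "r \<ge> 0" "z \<in> D'"
  shows "reach T v \<bullet> z = (LINT \<tau>|lebesgue_on {0<..<T}. v \<tau> \<bullet> obs T z \<tau>)"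
  using reach_L2[OF assms(2)] Linf_ball_Lp(1)[OF assms(1,3,2)] assms(4) by metis

lemma reach_combine:
  assumes "v \<in> Linf_ball T r" "w \<in> Linf_ball T r" "T > 0" "r \<ge> 0"
  shows "reach T (\<lambda>t. a *\<^sub>R v t + b *\<^sub>R w t) = a *\<^sub>R reach T v + b *\<^sub>R reach T w"
proof (rule reach_eqI)
  fix z assume z: "z \<in> D'"
  show "(LINT \<tau>|lebesgue_on {0<..<T}. (a *\<^sub>R v \<tau> + b *\<^sub>R w \<tau>) \<bullet> obs T z \<tau>) = (a *\<^sub>R reach T v + b *\<^sub>R reach T w) \<bullet> z"
    using Linf_ball_inner_obs[OF assms(1) z] Linf_ball_inner_obs[OF assms(2) z]
    by (simp add: inner_add_left reach_inner[OF _ assms(3,4) z] assms(1,2))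
qed

lemma reach_zero: "reach T (\<lambda>_. 0) = 0"
  by (rule reach_eqI) simp

lemma reach_bounded:
  assumes "T > 0" "r \<ge> 0"
  obtains R where "R \<ge> 0" "\<And>v. v \<in> Linf_ball T r \<Longrightarrow> norm (reach T v) \<le> R"
proof -
  obtain C where C: "C > 0" "\<And>u. u \<in> Lp 2 {0<..<T} \<Longrightarrow> norm (reach T u) \<le> C * Lp_norm 2 {0<..<T} u"
    using reach_L2[OF assms(1)] by metis
  show thesis
  proof (rule that[of "C * (r * sqrt T)"])
    fix v :: "real \<Rightarrow> 'u" assume v: "v \<in> Linf_ball T r"
    show "norm (reach T v) \<le> C * (r * sqrt T)"
      by (rule order_trans[OF C(2)[OF Linf_ball_Lp(1)[OF v assms(2,1)]] mult_left_mono[OF Linf_ball_Lp(2)[OF v assms(2,1)]]])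
         (use C(1) in simp)
  qed (use C assms in auto)
qed

lemma inner_obs_extend:
  assumes "0 \<le> t" "t \<le> T" "z \<in> D'"
  shows "(LINT \<tau>|lebesgue_on {0<..<T}. (if \<tau> \<in> {0<..<t} then v \<tau> else 0) \<bullet> obs T z \<tau>)
    = (LINT \<tau>|lebesgue_on {0<..<t}. v \<tau> \<bullet> obs T z \<tau>)"
    and "(LINT \<tau>|lebesgue_on {0<..<t}. v \<tau> \<bullet> obs T z \<tau>)
    = (LINT \<tau>|lebesgue_on {0<..<t}. v \<tau> \<bullet> obs t (S' (T - t) z) \<tau>)"
proof -
  have "(LINT \<tau>|lebesgue_on {0<..<T}. (if \<tau> \<in> {0<..<t} then v \<tau> else 0) \<bullet> obs T z \<tau>)
    = (LINT \<tau>|lebesgue_on {0<..<T}. (if \<tau> \<in> {0<..<t} then v \<tau> \<bullet> obs T z \<tau> else 0))"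
    by (rule Bochner_Integration.integral_cong) auto
  also have "\<dots> = (LINT \<tau>|lebesgue_on {0<..<t}. v \<tau> \<bullet> obs T z \<tau>)"
    by (rule integral_lebesgue_on_if) (use assms in auto)
  finally show "(LINT \<tau>|lebesgue_on {0<..<T}. (if \<tau> \<in> {0<..<t} then v \<tau> else 0) \<bullet> obs T z \<tau>)
    = (LINT \<tau>|lebesgue_on {0<..<t}. v \<tau> \<bullet> obs T z \<tau>)" .
  show "(LINT \<tau>|lebesgue_on {0<..<t}. v \<tau> \<bullet> obs T z \<tau>)
    = (LINT \<tau>|lebesgue_on {0<..<t}. v \<tau> \<bullet> obs t (S' (T - t) z) \<tau>)"
  proof (rule Bochner_Integration.integral_cong)
    fix \<tau> assume "\<tau> \<in> space (lebesgue_on {0<..<t})"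
    then show "v \<tau> \<bullet> obs T z \<tau> = v \<tau> \<bullet> obs t (S' (T - t) z) \<tau>"
      using obs_shift[of \<tau> t T z] assms(2) by simp
  qed simp
qed

text \<open>After \<open>t\<close> the control is off and the state evolves freely; in the pairings,
  \<open>S (T - t)\<close> moves onto \<open>z\<close> as \<open>S' (T - t)\<close>.\<close>

lemma extend_control:
  assumes v: "v \<in> Linf_ball t r" and "0 < t" "t \<le> T" "r \<ge> 0"
  shows "(\<lambda>\<tau>. if \<tau> \<in> {0<..<t} then v \<tau> else 0) \<in> Linf_ball T r"
    and "reach T (\<lambda>\<tau>. if \<tau> \<in> {0<..<t} then v \<tau> else 0) = S (T - t) (reach t v)"
proof -
  let ?v = "\<lambda>\<tau>. if \<tau> \<in> {0<..<t} then v \<tau> else 0"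
  have vm: "v measurable_on {0<..<t}" and vr: "AE \<tau> in lebesgue_on {0<..<t}. norm (v \<tau>) \<le> r"
    using v by (auto simp: Linf_ball_def)
  have "?v measurable_on {0<..<t}" by (rule measurable_on_spike[OF vm, of "{}"]) auto
  then have "?v measurable_on {0<..<T}" by (rule measurable_on_superset) (use assms in auto)
  moreover have "AE \<tau> in lebesgue. \<tau> \<in> {0<..<t} \<longrightarrow> norm (v \<tau>) \<le> r"
    using vr by (simp add: AE_restrict_space_iff)
  then have "AE \<tau> in lebesgue. \<tau> \<in> {0<..<T} \<longrightarrow> norm (?v \<tau>) \<le> r"
    by eventually_elim (use assms in auto)
  then have "AE \<tau> in lebesgue_on {0<..<T}. norm (?v \<tau>) \<le> r"
    by (simp add: AE_restrict_space_iff)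
  ultimately show "?v \<in> Linf_ball T r" by (simp add: Linf_ball_def)
  show "reach T ?v = S (T - t) (reach t v)"
  proof (rule reach_eqI)
    fix z assume z: "z \<in> D'"
    have "S' (T - t) z \<in> D'" using z assms by (intro S'_in_D') auto
    from reach_inner[OF v assms(2,4) this]
    show "(LINT \<tau>|lebesgue_on {0<..<T}. ?v \<tau> \<bullet> obs T z \<tau>) = S (T - t) (reach t v) \<bullet> z"
      using inner_obs_extend[of t T z v] assms z by (simp add: inner_S' less_imp_le)
  qed
qed

text \<open>The near-solutions form decreasing convex sets \<open>C n\<close> of controls bounded by
  \<open>r + 1\<close>, hence uniformly integrable with exponent 1. A limit obeys the bound
  \<open>r\<close> almost everywhere, and the pairings converge because each \<open>obs T z\<close>
  is bounded. Both the existence of minimal norm controls and the strict separation of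
  \<open>- S T y\<close> from the reachable set rest on this.\<close>

lemma Linf_ball_reach_closed:
  assumes T: "T > 0" and r: "r \<ge> 0"
    and approx: "\<And>\<epsilon>. \<epsilon> > 0 \<Longrightarrow> \<exists>v\<in>Linf_ball T (r + \<epsilon>). norm (reach T v - y) \<le> \<epsilon>"
  obtains v where "v \<in> Linf_ball T r" "reach T v = y"
proof -
  let ?M = "lebesgue_on {0<..<T}"
  define e where "e n = 1 / real (Suc n)" for n
  have e: "e n > 0" "e n \<le> 1" for n by (auto simp: e_def)
  have e_lim: "e \<longlonglongrightarrow> 0" unfolding e_def by (rule LIMSEQ_Suc[OF lim_1_over_n])
  have e_dec: "e n \<le> e m" if "m \<le> n" for m n using that by (simp add: e_def frac_le)
  define C where "C n = {v \<in> Linf_ball T (r + e n). norm (reach T v - y) \<le> e n}" for n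
  interpret finite_measure ?M by (rule finite_measure_lebesgue_on) simp
  have C0: "v \<in> Linf_ball T (r + 1)" if "v \<in> C 0" for v
    using that by (auto simp: C_def e_def)
  obtain h g where h: "\<And>n. h n \<in> C n" and g: "g measurable_on {0<..<T}"
    and AE: "AE t in ?M. (\<lambda>n. h n t) \<longlonglongrightarrow> g t"
    and int: "\<And>n. integrable ?M (\<lambda>t. norm (h n t - g t))"
    and lim: "(\<lambda>n. LINT t|?M. norm (h n t - g t)) \<longlonglongrightarrow> 0"
  proof (rule uniformly_integrable_convex_limit[of "{0<..<T}" C "r + 1" 1])
    show "C n \<noteq> {}" for n using approx[OF e(1)[of n]] by (auto simp: C_def)
    show "decseq C"
    unfolding decseq_def
    proof (intro allI impI subsetI)
      fix m n :: nat and v assume mn: "m \<le> n" and v: "v \<in> C n"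
      have "e n \<le> e m" using mn by (rule e_dec)
      with v show "v \<in> C m"
        unfolding C_def by (auto intro: Linf_ball_mono)
    qed
    show "(\<lambda>t. (1/2) *\<^sub>R (v t + w t)) \<in> C n" if vw: "v \<in> C n" "w \<in> C n" for n v w
    proof -
      have v: "v \<in> Linf_ball T (r + e n)" "norm (reach T v - y) \<le> e n"
        and w: "w \<in> Linf_ball T (r + e n)" "norm (reach T w - y) \<le> e n" using vw by (auto simp: C_def)
      have eq: "(\<lambda>t. (1/2) *\<^sub>R (v t + w t)) = (\<lambda>t. (1/2) *\<^sub>R v t + (1/2) *\<^sub>R w t)"
        by (simp add: scaleR_add_right)
      have "(\<lambda>t. (1/2) *\<^sub>R (v t + w t)) \<in> Linf_ball T (r + e n)"
        unfolding eq using Linf_ball_combine[OF v(1) w(1), of "1/2" "1/2"] by simp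
      moreover have "norm (reach T (\<lambda>t. (1/2) *\<^sub>R (v t + w t)) - y) \<le> e n"
      proof -
        have "reach T (\<lambda>t. (1/2) *\<^sub>R (v t + w t)) = (1/2) *\<^sub>R reach T v + (1/2) *\<^sub>R reach T w"
          unfolding eq by (rule reach_combine[OF v(1) w(1) T]) (use r e(1)[of n] in simp)
        also have "\<dots> \<in> cball y (e n)"
          using v(2) w(2) by (intro convexD[OF convex_cball]) (auto simp: dist_norm norm_minus_commute)
        finally show ?thesis by (simp add: dist_norm norm_minus_commute)
      qed
      ultimately show ?thesis by (simp add: C_def)
    qed
    show "v measurable_on {0<..<T}" if "v \<in> C 0" for v using C0[OF that] by (simp add: Linf_ball_def)
    show "integrable ?M (\<lambda>t. norm (v t))" if "v \<in> C 0" for v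
      by (rule Linf_ball_integrable[OF C0[OF that]])
    show "(LINT t|?M. indicator E t * norm (v t)) \<le> (r + 1) * measure ?M E powr 1"
      if "v \<in> C 0" "E \<in> sets ?M" for v E
    proof -
      note v = C0[OF that(1)]
      have "(LINT t|?M. indicator E t * norm (v t)) \<le> (LINT t|?M. indicator E t * (r + 1))"
      proof (rule integral_mono_AE)
        show "integrable ?M (\<lambda>t. indicator E t * norm (v t))"
          using integrable_mult_indicator[OF that(2) Linf_ball_integrable[OF v]] by simp
        show "integrable ?M (\<lambda>t. indicator E t * (r + 1))"
          using that(2) by (intro integrable_mult_left integrable_real_indicator) (auto simp: less_top[symmetric])
        have "AE t in ?M. norm (v t) \<le> r + 1" using v by (simp add: Linf_ball_def)
        then show "AE t in ?M. indicator E t * norm (v t) \<le> indicator E t * (r + 1)"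
          by eventually_elim (auto intro: mult_left_mono)
      qed
      also have "\<dots> = (r + 1) * measure ?M E powr 1"
        using sets.sets_into_space[OF that(2)] that(2) by (simp add: Int_absorb2)
      finally show ?thesis .
    qed
  qed (use r that in auto)
  show thesis
  proof (rule that)
    have "AE t in ?M. \<forall>n. norm (h n t) \<le> r + e n"
      unfolding AE_all_countable using h by (auto simp: C_def Linf_ball_def)
    with AE have "AE t in ?M. norm (g t) \<le> r"
    proof eventually_elim
      case (elim t)
      have "(\<lambda>n. norm (h n t)) \<longlonglongrightarrow> norm (g t)" by (intro tendsto_norm elim)
      moreover have "(\<lambda>n. r + e n) \<longlonglongrightarrow> r + 0" by (intro tendsto_intros e_lim)
      ultimately have "norm (g t) \<le> r + 0" by (rule LIMSEQ_le) (use elim in auto)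
      then show ?case by simp
    qed
    then show gr: "g \<in> Linf_ball T r" using g by (simp add: Linf_ball_def)
    show "reach T g = y"
    proof (rule reach_eqI)
      fix z assume z: "z \<in> D'"
      obtain M where M: "M \<ge> 0" "AE \<tau> in ?M. norm (obs T z \<tau>) \<le> M" by (rule obs_AE_bounded[OF z])
      have hb: "h n \<in> Linf_ball T (r + e n)" for n using h by (auto simp: C_def)
      have diff: "\<bar>reach T (h n) \<bullet> z - (LINT \<tau>|?M. g \<tau> \<bullet> obs T z \<tau>)\<bar> \<le> M * (LINT t|?M. norm (h n t - g t))" for n
      proof -
        have "reach T (h n) \<bullet> z - (LINT \<tau>|?M. g \<tau> \<bullet> obs T z \<tau>) = (LINT \<tau>|?M. (h n \<tau> - g \<tau>) \<bullet> obs T z \<tau>)"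
          using reach_inner[OF hb T _ z, of n] r e(1)[of n] Linf_ball_inner_obs[OF hb z, of n] Linf_ball_inner_obs[OF gr z]
          by (simp add: inner_diff_left)
        then show ?thesis
          using integrable_inner_bounded(2)[OF _ int obs_interval_measurable[OF z] M(2), of n] hb[of n] g
          by (simp add: Linf_ball_def measurable_on_diff)
      qed
      have "(\<lambda>n. reach T (h n) \<bullet> z - (LINT \<tau>|?M. g \<tau> \<bullet> obs T z \<tau>)) \<longlonglongrightarrow> 0"
        by (rule tendsto_rabs_zero_cancel, rule tendsto_sandwich[OF _ _ tendsto_const tendsto_mult_right_zero[OF lim, of M]])
           (use diff in auto)
      then have 1: "(\<lambda>n. reach T (h n) \<bullet> z) \<longlonglongrightarrow> (LINT \<tau>|?M. g \<tau> \<bullet> obs T z \<tau>)" by (simp add: LIM_zero_iff)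
      have "(\<lambda>n. reach T (h n)) \<longlonglongrightarrow> y"
      proof (rule LIM_zero_cancel, rule tendsto_norm_zero_cancel, rule tendsto_sandwich[OF _ _ tendsto_const e_lim])
        show "\<forall>\<^sub>F n in sequentially. norm (reach T (h n) - y) \<le> e n" using h by (auto simp: C_def)
      qed auto
      then have "(\<lambda>n. reach T (h n) \<bullet> z) \<longlonglongrightarrow> y \<bullet> z" by (intro tendsto_intros)
      from LIMSEQ_unique[OF 1 this] show "(LINT \<tau>|?M. g \<tau> \<bullet> obs T z \<tau>) = y \<bullet> z" .
    qed
  qed
qed

end

section \<open>The minimal norm as a function of the final time\<close>

lemma antimono_tendsto_at_right_0:
  fixes f :: "real \<Rightarrow> 'a::{complete_linorder, linorder_topology}"
  assumes anti: "\<And>s t. 0 < s \<Longrightarrow> s \<le> t \<Longrightarrow> f t \<le> f s"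
  shows "(f \<longlongrightarrow> (SUP t\<in>{0<..}. f t)) (at_right 0)"
proof (rule order_tendstoI)
  fix a assume "a < (SUP t\<in>{0<..}. f t)"
  then obtain t where t: "0 < t" "a < f t" by (auto simp: less_SUP_iff)
  have "\<forall>\<^sub>F s in at_right 0. 0 < s \<and> s < t"
    using t by (auto simp: eventually_at_right_field)
  then show "\<forall>\<^sub>F s in at_right 0. a < f s"
    by eventually_elim (use t anti in \<open>meson less_le_trans less_imp_le\<close>)
next
  fix a assume a: "(SUP t\<in>{0<..}. f t) < a"
  show "\<forall>\<^sub>F s in at_right 0. f s < a"
    using eventually_at_right_less[of 0]
    by eventually_elim (use a in \<open>auto intro: le_less_trans[OF SUP_upper]\<close>)
qed

lemma antimono_tendsto_at_top:
  fixes f :: "real \<Rightarrow> 'a::{complete_linorder, linorder_topology}"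
  assumes anti: "\<And>s t. 0 < s \<Longrightarrow> s \<le> t \<Longrightarrow> f t \<le> f s"
  shows "(f \<longlongrightarrow> (INF t\<in>{0<..}. f t)) at_top"
proof (rule order_tendstoI)
  fix a assume a: "a < (INF t\<in>{0<..}. f t)"
  show "\<forall>\<^sub>F s in at_top. a < f s"
    using eventually_gt_at_top[of 0]
    by eventually_elim (use a in \<open>auto intro: less_le_trans[OF _ INF_lower]\<close>)
next
  fix a assume "(INF t\<in>{0<..}. f t) < a"
  then obtain t where t: "0 < t" "f t < a" by (auto simp: INF_less_iff)
  show "\<forall>\<^sub>F s in at_top. f s < a"
    using eventually_ge_at_top[of t]
    by eventually_elim (use t anti in \<open>meson le_less_trans\<close>)
qed

context admissible_system
begin

lemma admissible_control_iff:
  assumes "T > 0"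
  shows "admissible_control \<Sigma> T y v \<longleftrightarrow> (\<exists>r\<ge>0. v \<in> Linf_ball T r) \<and> S T y + reach T v = 0"
proof -
  have "v \<in> Linf {0<..<T} \<longleftrightarrow> (\<exists>r\<ge>0. v \<in> Linf_ball T r)"
    using Linf_ballE[OF _ assms, of v] Linf_ball_subset_Linf[of v T] by blast
  then show ?thesis by (simp add: admissible_control_def state_eq)
qed

lemma min_norm_nonneg: "T > 0 \<Longrightarrow> 0 \<le> min_norm \<Sigma> T y"
  unfolding min_norm_def by (rule Inf_greatest) (auto simp: Linf_norm_nonneg)

lemma min_norm_le:
  assumes "v \<in> Linf_ball T r" "T > 0" "r \<ge> 0" "S T y + reach T v = 0"
  shows "min_norm \<Sigma> T y \<le> ereal r"
proof -
  have "admissible_control \<Sigma> T y v" using assms admissible_control_iff by blast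
  then have "min_norm \<Sigma> T y \<le> Linf_norm {0<..<T} v" unfolding min_norm_def by (intro Inf_lower) blast
  also have "\<dots> \<le> ereal r" using assms(1) by (simp add: Linf_ball_iff)
  finally show ?thesis .
qed

lemma min_norm_less:
  assumes "min_norm \<Sigma> T y < c" "T > 0"
  obtains v r where "v \<in> Linf_ball T r" "r \<ge> 0" "ereal r < c" "S T y + reach T v = 0"
proof -
  obtain v where v: "admissible_control \<Sigma> T y v" "Linf_norm {0<..<T} v < c"
    using assms(1) unfolding min_norm_def by (auto simp: Inf_less_iff)
  obtain r where "r \<ge> 0" "Linf_norm {0<..<T} v = ereal r" "v \<in> Linf_ball T r"
    using v assms(2) Linf_ballE unfolding admissible_control_def by blast
  with v assms(2) show thesis by (intro that[of v r]) (auto simp: admissible_control_iff)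
qed

lemma null_control_extend:
  assumes "v \<in> Linf_ball t r" "0 < t" "t \<le> T" "r \<ge> 0" "S t y + reach t v = 0"
  shows "S T y + reach T (\<lambda>\<tau>. if \<tau> \<in> {0<..<t} then v \<tau> else 0) = 0"
proof -
  have "S T y + reach T (\<lambda>\<tau>. if \<tau> \<in> {0<..<t} then v \<tau> else 0) = S (T - t) (S t y + reach t v)"
    using extend_control(2)[OF assms(1-4)] S_add[of "T - t" t y] assms(2,3) by (simp add: blinfun.add_right)
  then show ?thesis using assms(5) by simp
qed

text \<open>A control that steers to 0 by time \<open>t\<close> is continued by 0. Comparison with
  the levels above the infimum also covers the case that there is no control.\<close>

lemma min_norm_antimono:
  assumes "0 < t" "t \<le> T"
  shows "min_norm \<Sigma> T y \<le> min_norm \<Sigma> t y"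
proof (rule dense_ge)
  show "min_norm \<Sigma> T y \<le> c" if c: "min_norm \<Sigma> t y < c" for c
  proof -
    obtain v r where "v \<in> Linf_ball t r" "r \<ge> 0" "ereal r < c" "S t y + reach t v = 0"
      using min_norm_less[OF c assms(1)] by blast
    then have "min_norm \<Sigma> T y \<le> ereal r"
      using assms by (intro min_norm_le[OF extend_control(1)] null_control_extend) auto
    with \<open>ereal r < c\<close> show ?thesis by simp
  qed
qed

text \<open>Controls with norm close to the infimum hit the target exactly, so
  \<open>Linf_ball_reach_closed\<close> applies with the infimum as radius.\<close>

lemma minimal_norm_control_exists:
  assumes T: "T > 0" and fin: "min_norm \<Sigma> T y < \<infinity>"
  obtains v r where "min_norm \<Sigma> T y = ereal r" "r \<ge> 0" "v \<in> Linf_ball T r" "S T y + reach T v = 0"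
    "minimal_norm_control \<Sigma> T y v"
proof -
  obtain r where r: "min_norm \<Sigma> T y = ereal r" "r \<ge> 0"
    using min_norm_nonneg[OF T, of y] fin by (cases "min_norm \<Sigma> T y") auto
  obtain v where v: "v \<in> Linf_ball T r" "reach T v = - S T y"
  proof (rule Linf_ball_reach_closed[OF T r(2), of "- S T y"])
    fix \<epsilon> :: real assume "\<epsilon> > 0"
    then have "min_norm \<Sigma> T y < ereal (r + \<epsilon>)" using r by simp
    then obtain v r' where v: "v \<in> Linf_ball T r'" "ereal r' < ereal (r + \<epsilon>)" "S T y + reach T v = 0"
      using min_norm_less[OF _ T] by metis
    then show "\<exists>v\<in>Linf_ball T (r + \<epsilon>). norm (reach T v - - S T y) \<le> \<epsilon>"
      using \<open>\<epsilon> > 0\<close> by (intro bexI[of _ v]) (auto simp: add.commute intro: Linf_ball_mono)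
  qed
  have "admissible_control \<Sigma> T y v" using v r T by (auto simp: admissible_control_iff)
  moreover have "Linf_norm {0<..<T} v = min_norm \<Sigma> T y"
  proof (rule antisym)
    show "Linf_norm {0<..<T} v \<le> min_norm \<Sigma> T y" using v r by (simp add: Linf_ball_iff)
    show "min_norm \<Sigma> T y \<le> Linf_norm {0<..<T} v"
      unfolding min_norm_def by (rule Inf_lower) (use calculation in blast)
  qed
  ultimately show thesis using v r by (intro that[of r v]) (auto simp: minimal_norm_control_def)
qed

lemma min_norm_eq_0_imp:
  assumes T: "T > 0" and "min_norm \<Sigma> T y = 0"
  shows "S T y = 0"
proof -
  have "min_norm \<Sigma> T y < \<infinity>" using assms(2) by simp
  then obtain v r where v: "min_norm \<Sigma> T y = ereal r" "r \<ge> 0" "v \<in> Linf_ball T r" "S T y + reach T v = 0"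
    using minimal_norm_control_exists[OF T] by metis
  then have v0: "v \<in> Linf_ball T 0" using assms(2) by simp
  then have "AE t in lebesgue_on {0<..<T}. v t = 0" by (simp add: Linf_ball_def)
  then have "reach T v = reach T (\<lambda>_. 0)"
    by (rule reach_cong(1)) (use v0 in \<open>auto simp: Linf_ball_def\<close>)
  then show ?thesis using v(4) by (simp add: reach_zero)
qed

lemma null_control_optimal:
  assumes T: "T > 0" and "S T y = 0"
  shows "bang_bang \<Sigma> T y" "minimal_norm_control \<Sigma> T y (\<lambda>_. 0)"
    "minimal_norm_control \<Sigma> T y v \<Longrightarrow> AE t\<in>{0<..<T} in lebesgue. v t = 0"
proof -
  have adm: "admissible_control \<Sigma> T y (\<lambda>_. 0)"
    using T assms(2) zero_Linf_ball[of 0 T] by (auto simp: admissible_control_iff reach_zero)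
  have "min_norm \<Sigma> T y \<le> ereal 0"
    by (rule min_norm_le[OF zero_Linf_ball T]) (auto simp: assms reach_zero)
  then have N: "min_norm \<Sigma> T y = 0"
    using min_norm_nonneg[OF T, of y] by (intro antisym) (simp_all add: zero_ereal_def)
  have "Linf_norm {0<..<T} (\<lambda>_. 0::'u) \<le> ereal 0"
    using zero_Linf_ball[of 0 T, where 'a='u] by (simp add: Linf_ball_iff)
  then have "Linf_norm {0<..<T} (\<lambda>_. 0::'u) = 0"
    using Linf_norm_nonneg[OF T, of "\<lambda>_. 0::'u"] by (intro antisym) (simp_all add: zero_ereal_def)
  with adm N show "minimal_norm_control \<Sigma> T y (\<lambda>_. 0)" by (simp add: minimal_norm_control_def)
  have AE: "AE t\<in>{0<..<T} in lebesgue. v t = 0" if "minimal_norm_control \<Sigma> T y v" for v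
  proof -
    have "v measurable_on {0<..<T}" "Linf_norm {0<..<T} v \<le> ereal 0"
      using that N by (auto simp: minimal_norm_control_def admissible_control_def Linf_def)
    then have "AE t in lebesgue_on {0<..<T}. norm (v t) \<le> 0" by (simp add: Linf_norm_le_iff)
    then show ?thesis by (simp add: AE_restrict_space_iff)
  qed
  then show "minimal_norm_control \<Sigma> T y v \<Longrightarrow> AE t\<in>{0<..<T} in lebesgue. v t = 0" .
  show "bang_bang \<Sigma> T y"
    unfolding bang_bang_def
  proof (intro conjI allI impI)
    show "\<exists>v. admissible_control \<Sigma> T y v" using adm by blast
    show "AE t\<in>{0<..<T} in lebesgue. ereal (norm (v t)) = min_norm \<Sigma> T y"
      if "minimal_norm_control \<Sigma> T y v" for v
      using AE[OF that] by eventually_elim (simp add: N)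
  qed
qed

lemma T0_nonneg: "0 \<le> T0 \<Sigma> y"
  unfolding T0_def by (rule Inf_greatest) auto

text \<open>\<open>T0\<close> refers to controls on the half-line, so the control on (0, T) is
  continued by 0.\<close>

lemma T0_le:
  assumes T: "T > 0" and "admissible_control \<Sigma> T y v"
  shows "T0 \<Sigma> y \<le> ereal T"
proof -
  obtain r where r: "r \<ge> 0" "v \<in> Linf_ball T r" and v: "S T y + reach T v = 0"
    using assms admissible_control_iff by blast
  define u where "u t = (if t \<in> {0<..<T} then v t else 0)" for t
  have vm: "v measurable_on {0<..<T}" and vr: "AE t in lebesgue_on {0<..<T}. norm (v t) \<le> r"
    using r by (auto simp: Linf_ball_def)
  have u0: "u measurable_on {0<..<T}"
    by (rule measurable_on_spike[OF vm, of "{}"]) (auto simp: u_def)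
  then have um: "u measurable_on {0<..}" by (rule measurable_on_superset) (auto simp: u_def)
  have "AE t in lebesgue. t \<in> {0<..<T} \<longrightarrow> norm (v t) \<le> r" using vr by (simp add: AE_restrict_space_iff)
  then have "AE t in lebesgue. t \<in> {0<..} \<longrightarrow> norm (u t) \<le> r" by eventually_elim (auto simp: u_def r)
  then have "AE t in lebesgue_on {0<..}. norm (u t) \<le> r" by (simp add: AE_restrict_space_iff)
  then have "Linf_norm {0<..} u \<le> ereal r" by (simp add: Linf_norm_le_iff[OF um])
  then have "u \<in> Linf {0<..}" using um by (auto simp: Linf_def intro: le_less_trans)
  moreover have "reach T u = reach T v"
    by (rule reach_cong(1)[OF AE_I2 u0 vm]) (auto simp: u_def)
  then have "state \<Sigma> T y u = 0" using v by (simp add: state_eq)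
  ultimately show ?thesis unfolding T0_def using T by (intro Inf_lower) fastforce
qed

lemma T0_less:
  assumes "T0 \<Sigma> y < ereal T" "y \<noteq> 0"
  obtains t u r where "0 < t" "t < T" "r \<ge> 0" "u \<in> Linf_ball t r" "S t y + reach t u = 0"
proof -
  obtain t u where t: "t \<ge> 0" "t < T" and u: "u \<in> Linf {0<..}" "state \<Sigma> t y u = 0"
    using assms(1) unfolding T0_def by (auto simp: Inf_less_iff)
  \<comment> \<open>The infimum that defines \<open>T0\<close> admits time 0, where the state is
    \<open>y\<close> itself.\<close>
  have "t \<noteq> 0"
  proof
    assume "t = 0"
    moreover have "reach 0 u = 0" by (rule reach_eqI) simp
    ultimately show False using u(2) assms(2) by (simp add: state_eq)
  qed
  have um: "u measurable_on {0<..}" and "Linf_norm {0<..} u < \<infinity>" using u(1) by (auto simp: Linf_def)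
  then obtain r where "Linf_norm {0<..} u \<le> ereal r"
    by (cases "Linf_norm {0<..} u") (auto intro: that[of 0])
  then have "AE s in lebesgue_on {0<..}. norm (u s) \<le> r" by (simp add: Linf_norm_le_iff[OF um])
  then have "AE s in lebesgue_on {0<..<t}. norm (u s) \<le> r"
    by (rule AE_lebesgue_on_subset) auto
  moreover have "u measurable_on {0<..<t}" by (rule measurable_on_subset[OF um]) auto
  ultimately have "u \<in> Linf_ball t (max 0 r)" by (auto simp: Linf_ball_def elim: eventually_mono)
  with t \<open>t \<noteq> 0\<close> u(2) show thesis by (intro that[of t "max 0 r" u]) (auto simp: state_eq)
qed

text \<open>The orbit vanishes at all times after \<open>T\<close>, hence at \<open>T\<close> by
  right continuity: the infimum \<open>T1\<close> is attained when it is finite.\<close>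

lemma S_eq_0_of_T1_le:
  assumes "T1 \<Sigma> y \<le> ereal T" "T \<ge> 0"
  shows "S T y = 0"
proof -
  have zero: "S s y = 0" if s: "T < s" for s
  proof -
    have "T1 \<Sigma> y < ereal s" using assms(1) s by (simp add: le_less_trans)
    then obtain t where t: "t \<ge> 0" "t < s" "S t y = 0"
      unfolding T1_def by (auto simp: Inf_less_iff)
    then show ?thesis using S_add[of "s - t" t y] by simp
  qed
  have "((\<lambda>s. S s y) \<longlongrightarrow> S T y) (at_right T)"
  proof -
    have "((\<lambda>s. S s y) \<longlongrightarrow> S T y) (at T within {0..})"
      using S_continuous[of y] assms(2) by (simp add: continuous_on_def)
    then show ?thesis by (rule tendsto_mono[OF at_le, rotated]) (use assms(2) in auto)
  qed
  moreover have "\<forall>\<^sub>F s in at_right T. S s y = 0"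
    using eventually_at_right_less[of T] by eventually_elim (rule zero)
  ultimately have "((\<lambda>_. 0) \<longlongrightarrow> S T y) (at_right T)" by (rule Lim_transform_eventually)
  then show ?thesis
    using tendsto_unique[OF trivial_limit_at_right_real _ tendsto_const] by metis
qed

lemma S_nonzero_of_less_T1: "ereal T < T1 \<Sigma> y \<Longrightarrow> T \<ge> 0 \<Longrightarrow> S T y \<noteq> 0"
proof
  assume "ereal T < T1 \<Sigma> y" "T \<ge> 0" "S T y = 0"
  moreover from this have "T1 \<Sigma> y \<le> ereal T" unfolding T1_def by (intro Inf_lower) blast
  ultimately show False by simp
qed

text \<open>By monotonicity the limit at 0 from the right is the supremum over all positive
  times.\<close>

lemma min_norm_ext_0: "0 < T \<Longrightarrow> min_norm \<Sigma> T y \<le> min_norm_ext \<Sigma> 0 y"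
proof -
  assume T: "0 < T"
  have "min_norm_ext \<Sigma> 0 y = (SUP t\<in>{0<..}. min_norm \<Sigma> t y)"
    unfolding min_norm_ext_def
    using tendsto_Lim[OF trivial_limit_at_right_real antimono_tendsto_at_right_0[of "\<lambda>t. min_norm \<Sigma> t y"]]
      min_norm_antimono by simp
  also have "min_norm \<Sigma> T y \<le> \<dots>" using T by (intro SUP_upper) auto
  finally show "min_norm \<Sigma> T y \<le> min_norm_ext \<Sigma> 0 y" .
qed

lemma min_norm_ext_nonneg:
  assumes "0 \<le> t"
  shows "0 \<le> min_norm_ext \<Sigma> t y"
proof (cases t)
  case PInf
  have "min_norm_ext \<Sigma> \<infinity> y = (INF t\<in>{0<..}. min_norm \<Sigma> t y)"
    unfolding min_norm_ext_def
    using tendsto_Lim[OF trivial_limit_at_top_linorder antimono_tendsto_at_top[of "\<lambda>t. min_norm \<Sigma> t y"]]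
      min_norm_antimono by simp
  also have "0 \<le> \<dots>" by (intro INF_greatest) (auto simp: min_norm_nonneg)
  finally show ?thesis using PInf by simp
next
  case (real r)
  show ?thesis
  proof (cases "r = 0")
    case True
    have "0 \<le> min_norm \<Sigma> 1 y" by (simp add: min_norm_nonneg)
    also have "\<dots> \<le> min_norm_ext \<Sigma> 0 y" by (simp add: min_norm_ext_0)
    finally show ?thesis using real True by (simp add: zero_ereal_def)
  qed (use real assms in \<open>simp add: min_norm_ext_def min_norm_nonneg\<close>)
qed (use assms in simp)

section \<open>The decomposition of \<open>W\<close>, and the cases of null, missing and optimal
  controls\<close>

lemma W_decomposition:
  "(W :: (real \<times> 'x) set) =
      W11 \<Sigma> \<union> W12 \<Sigma> \<union> W21 \<Sigma> \<union> W22 \<Sigma> \<union> W23 \<Sigma> \<union> W24 \<Sigma> \<union> W31 \<Sigma> \<union> W32 \<Sigma> \<union> W33 \<Sigma> \<union> W34 \<Sigma> \<and>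
    sorted_wrt disjnt
      [W11 \<Sigma>, W12 \<Sigma>, W21 \<Sigma>, W22 \<Sigma>, W23 \<Sigma>, W24 \<Sigma>, W31 \<Sigma>, W32 \<Sigma>, W33 \<Sigma>, W34 \<Sigma>]"
  (is "?U \<and> ?D")
proof
  note defs = W1_def W2_def W3_def W11_def W12_def W21_def W22_def W23_def W24_def W31_def W32_def W33_def W34_def
  show ?U
  proof
    show "W \<subseteq> W11 \<Sigma> \<union> W12 \<Sigma> \<union> W21 \<Sigma> \<union> W22 \<Sigma> \<union> W23 \<Sigma> \<union> W24 \<Sigma> \<union> W31 \<Sigma> \<union> W32 \<Sigma> \<union> W33 \<Sigma> \<union> W34 \<Sigma>"
    proof
      fix p :: "real \<times> 'x" assume p: "p \<in> W"
      obtain T y where [simp]: "p = (T, y)" by (cases p)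
      define N where "N = min_norm_ext \<Sigma> (T0 \<Sigma> y) y"
      have "0 \<le> N" unfolding N_def by (rule min_norm_ext_nonneg[OF T0_nonneg])
      then consider "N = 0" | "0 < N" "N < \<infinity>" | "N = \<infinity>" by (metis ereal_infty_less(1) order_le_less)
      then show "p \<in> W11 \<Sigma> \<union> W12 \<Sigma> \<union> W21 \<Sigma> \<union> W22 \<Sigma> \<union> W23 \<Sigma> \<union> W24 \<Sigma> \<union> W31 \<Sigma> \<union> W32 \<Sigma> \<union> W33 \<Sigma> \<union> W34 \<Sigma>"
      proof cases
        case 1
        then have "p \<in> W1 \<Sigma>" using p by (simp add: W1_def N_def)
        then have "p \<in> W11 \<Sigma> \<or> p \<in> W12 \<Sigma>" by (simp add: W11_def W12_def not_less[symmetric])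
        then show ?thesis by blast
      next
        case 2
        then have "p \<in> W2 \<Sigma>" using p by (simp add: W2_def N_def)
        then have "p \<in> W21 \<Sigma> \<or> p \<in> W22 \<Sigma> \<or> p \<in> W23 \<Sigma> \<or> p \<in> W24 \<Sigma>"
          using less_linear[of "ereal T" "T0 \<Sigma> y"] not_less[of "ereal T" "T1 \<Sigma> y"]
          by (simp add: W21_def W22_def W23_def W24_def) blast
        then show ?thesis by blast
      next
        case 3
        then have "p \<in> W3 \<Sigma>" using p by (simp add: W3_def N_def)
        then have "p \<in> W31 \<Sigma> \<or> p \<in> W32 \<Sigma> \<or> p \<in> W33 \<Sigma> \<or> p \<in> W34 \<Sigma>"
          using not_less[of "T0 \<Sigma> y" "ereal T"] not_less[of "ereal T" "T1 \<Sigma> y"] ereal_infty_less(1)[of "T0 \<Sigma> y"]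
          by (simp add: W31_def W32_def W33_def W34_def) blast
        then show ?thesis by blast
      qed
    qed
  qed (auto simp: defs)
  show ?D
    by (simp add: disjnt_iff) (auto simp: defs)
qed

text \<open>In \<open>W24\<close> and \<open>W33\<close> the free orbit has died by time
  \<open>T\<close>. In \<open>W12\<close> the minimal norm vanishes at \<open>T0\<close>, hence at
  \<open>T\<close> by monotonicity; if \<open>T0\<close> is 0, the value there is a supremum over
  positive times and dominates the one at \<open>T\<close>.\<close>

lemma W_null_control:
  assumes "(T, y) \<in> W12 \<Sigma> \<union> W24 \<Sigma> \<union> W33 \<Sigma>"
  shows "T > 0" "S T y = 0"
proof -
  show T: "T > 0" using assms by (auto simp: W_def W1_def W2_def W3_def W12_def W24_def W33_def)
  consider "(T, y) \<in> W12 \<Sigma>" | "T1 \<Sigma> y \<le> ereal T"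
    using assms by (auto simp: W24_def W33_def)
  then show "S T y = 0"
  proof cases
    case 1
    then have N: "min_norm_ext \<Sigma> (T0 \<Sigma> y) y = 0" and T0: "T0 \<Sigma> y \<le> ereal T"
      by (auto simp: W12_def W1_def)
    have "min_norm \<Sigma> T y \<le> 0"
    proof (cases "T0 \<Sigma> y")
      case (real t)
      show ?thesis
      proof (cases "t = 0")
        case True
        then show ?thesis using min_norm_ext_0[OF T, of y] N real by (simp add: zero_ereal_def)
      next
        case False
        then have t: "0 < t" "t \<le> T" using T0_nonneg[of y] T0 real by auto
        then have "min_norm \<Sigma> t y = 0" using N real by (simp add: min_norm_ext_def)
        then show ?thesis using min_norm_antimono[OF t, of y] by simp
      qed
    qed (use T0 T0_nonneg[of y] in auto)
    then show ?thesis using min_norm_nonneg[OF T, of y] T by (intro min_norm_eq_0_imp) auto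
  next
    case 2
    then show ?thesis using T by (intro S_eq_0_of_T1_le) auto
  qed
qed

text \<open>A control would force \<open>T0 \<Sigma> y \<le> ereal T\<close>, which leaves only the
  boundary case of \<open>W31\<close>, where \<open>T\<close> equals \<open>T0\<close>; there the
  minimal norm is infinite by the definition of \<open>W3\<close>.\<close>

lemma W_no_control:
  assumes "(T, y) \<in> W11 \<Sigma> \<union> W21 \<Sigma> \<union> W31 \<Sigma> \<union> W34 \<Sigma>"
  shows "\<not> admissible_control \<Sigma> T y v"
proof
  assume adm: "admissible_control \<Sigma> T y v"
  have T: "T > 0" using assms by (auto simp: W_def W1_def W2_def W3_def W11_def W21_def W31_def W34_def)
  have le: "T0 \<Sigma> y \<le> ereal T" by (rule T0_le[OF T adm])
  then have "(T, y) \<in> W31 \<Sigma>" using assms by (auto simp: W11_def W21_def W34_def)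
  then have "T0 \<Sigma> y = ereal T" "min_norm_ext \<Sigma> (T0 \<Sigma> y) y = \<infinity>" using le by (auto simp: W31_def W3_def)
  then have "min_norm \<Sigma> T y = \<infinity>" using T by (simp add: min_norm_ext_def)
  moreover have "min_norm \<Sigma> T y < \<infinity>"
  proof -
    have "min_norm \<Sigma> T y \<le> Linf_norm {0<..<T} v" unfolding min_norm_def using adm by (intro Inf_lower) blast
    also have "\<dots> < \<infinity>" using adm by (simp add: admissible_control_def Linf_def)
    finally show ?thesis .
  qed
  ultimately show False by simp
qed

lemma W22_minimal_norm_control:
  assumes "(T, y) \<in> W22 \<Sigma>"
  shows "\<exists>v. minimal_norm_control \<Sigma> T y v"
proof -
  have T: "T > 0" "T0 \<Sigma> y = ereal T" "min_norm_ext \<Sigma> (T0 \<Sigma> y) y < \<infinity>"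
    using assms by (auto simp: W_def W2_def W22_def)
  then have "min_norm \<Sigma> T y < \<infinity>" by (simp add: min_norm_ext_def)
  with T(1) show ?thesis using minimal_norm_control_exists by metis
qed

end

text \<open>A substitute for \<^const>\<open>sgn\<close> that is continuous and hence preserves strong measurability.\<close>

definition soft_sgn :: "real \<Rightarrow> 'a::real_inner \<Rightarrow> 'a" where
  "soft_sgn \<delta> y = y /\<^sub>R (norm y + \<delta>)"

lemma soft_sgn_continuous: "\<delta> > 0 \<Longrightarrow> continuous_on UNIV (soft_sgn \<delta>)"
  unfolding soft_sgn_def by (intro continuous_intros) (auto simp: add_nonneg_pos less_imp_neq[symmetric])

lemma norm_soft_sgn: "\<delta> > 0 \<Longrightarrow> norm (soft_sgn \<delta> y) \<le> 1"
  by (simp add: soft_sgn_def divide_inverse[symmetric] mult.commute add_nonneg_pos)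

lemma soft_sgn_inner:
  assumes "\<delta> > 0"
  shows "norm y - \<delta> \<le> soft_sgn \<delta> y \<bullet> y"
proof -
  have pos: "norm y + \<delta> > 0" using assms by (simp add: add_nonneg_pos)
  have "(norm y - \<delta>) * (norm y + \<delta>) \<le> norm y * norm y"
    by (simp add: algebra_simps)
  then have "norm y - \<delta> \<le> (norm y * norm y) / (norm y + \<delta>)" using pos by (simp add: pos_le_divide_eq)
  then show ?thesis
    by (simp add: soft_sgn_def power2_norm_eq_inner[symmetric] power2_eq_square divide_inverse mult.commute)
qed

lemma measurable_on_soft_sgn:
  assumes "\<delta> > 0" "f measurable_on S"
  shows "(\<lambda>t. soft_sgn \<delta> (f t)) measurable_on S"
proof -
  have "(soft_sgn \<delta> \<circ> f) measurable_on S"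
    by (rule measurable_on_compose_continuous_0[OF assms(2) soft_sgn_continuous[OF assms(1)]]) (simp add: soft_sgn_def)
  then show ?thesis by (simp add: o_def)
qed

text \<open>If every \<open>e k\<close> lies in the unit ball of \<open>L\<^sup>p\<close>, then \<open>\<bar>e k\<bar> \<le> 2\<^sup>k P\<^bsup>1/p\<^esup>\<close> for \<open>P = \<Sum>k. 2\<^sup>-\<^sup>k \<bar>e k\<bar>\<^sup>p\<close>.\<close>

lemma weighted_series_Lp:
  fixes e :: "nat \<Rightarrow> real \<Rightarrow> 'b::{real_inner, banach}"
  assumes S: "S \<in> lmeasurable" and p: "p \<ge> 1"
    and e: "\<And>k. e k \<in> Lp p S" "\<And>k. (LINT t|lebesgue_on S. norm (e k t) powr p) \<le> 1"
    and s: "\<And>k. \<bar>s k\<bar> = (1/3)^k"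
  shows "AE t in lebesgue_on S. summable (\<lambda>k. norm (s k *\<^sub>R e k t))"
    and "(\<lambda>t. \<Sum>k. s k *\<^sub>R e k t) \<in> Lp p S"
proof -
  let ?M = "lebesgue_on S"
  have SL: "S \<in> sets lebesgue" using S by (rule fmeasurableD)
  have em: "e k measurable_on S" and ei: "integrable ?M (\<lambda>t. norm (e k t) powr p)" for k
    using e(1)[of k] by (auto simp: Lp_def)
  define a where "a k t = (1/2)^k * norm (e k t) powr p" for k t
  define P where "P t = (\<Sum>k. a k t)" for t
  have a0: "0 \<le> a k t" for k t by (simp add: a_def)
  have ai: "integrable ?M (a k)" for k unfolding a_def using ei by simp
  have aI: "integral\<^sup>L ?M (a k) \<le> (1/2)^k" for k
    using mult_left_mono[OF e(2)[of k], of "(1/2)^k"] by (simp add: a_def[abs_def])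
  have half: "summable (\<lambda>k. (1/2::real)^k)" by (simp add: summable_geometric)
  have sa: "AE t in ?M. summable (\<lambda>k. a k t)"
    by (rule AE_summable_of_integrals[OF ai a0 aI half])
  have Pi: "integrable ?M P"
    unfolding P_def
  proof (rule integrable_suminf[OF ai])
    show "AE t in ?M. summable (\<lambda>k. norm (a k t))" using sa a0 by simp
    show "summable (\<lambda>k. LINT t|?M. norm (a k t))"
      by (rule summable_comparison_test'[OF half]) (use aI a0 in \<open>auto simp: integral_nonneg\<close>)
  qed
  have third: "summable (\<lambda>k. (2/3::real)^k)" by (simp add: summable_geometric)
  have key: "summable (\<lambda>k. norm (s k *\<^sub>R e k t)) \<and> norm (\<Sum>k. s k *\<^sub>R e k t) \<le> 3 * P t powr (1/p)"
    if t: "summable (\<lambda>k. a k t)" for t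
  proof -
    have P0: "0 \<le> P t" unfolding P_def by (rule suminf_nonneg[OF t a0])
    \<comment> \<open>As \<open>p \<ge> 1\<close>, the factor \<open>(2^k) powr (1/p)\<close> is at
      most \<open>2^k\<close>. The weights \<open>(1/3)^k\<close> then leave the ratio 2/3, whose
      geometric series has sum 3.\<close>
    have le: "norm (s k *\<^sub>R e k t) \<le> (2/3)^k * P t powr (1/p)" for k
    proof -
      have "a k t \<le> P t"
        unfolding P_def using sum_le_suminf[OF t, of "{k}"] a0 by simp
      then have "norm (e k t) powr p \<le> 2^k * P t"
        by (simp add: a_def power_divide field_simps)
      then have "(norm (e k t) powr p) powr (1/p) \<le> (2^k * P t) powr (1/p)"
        using p by (intro powr_mono2) auto
      moreover have "(norm (e k t) powr p) powr (1/p) = norm (e k t)" using p by (simp add: powr_powr)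
      moreover have "(2^k * P t) powr (1/p) \<le> 2^k * P t powr (1/p)"
      proof -
        have "(2^k::real) powr (1/p) \<le> (2^k) powr 1" using p by (intro powr_mono) auto
        then show ?thesis using P0 by (simp add: powr_mult mult_right_mono)
      qed
      ultimately have "norm (e k t) \<le> 2^k * P t powr (1/p)" by simp
      then have "(1/3)^k * norm (e k t) \<le> (1/3)^k * (2^k * P t powr (1/p))" by (intro mult_left_mono) auto
      then show ?thesis by (simp add: s power_divide field_simps)
    qed
    have sm: "summable (\<lambda>k. (2/3)^k * P t powr (1/p))" by (rule summable_mult2[OF third])
    have ns: "summable (\<lambda>k. norm (s k *\<^sub>R e k t))"
      by (rule summable_comparison_test'[OF sm]) (use le in simp)
    have "norm (\<Sum>k. s k *\<^sub>R e k t) \<le> (\<Sum>k. norm (s k *\<^sub>R e k t))" by (rule summable_norm[OF ns])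
    also have "\<dots> \<le> (\<Sum>k. (2/3)^k * P t powr (1/p))" by (rule suminf_le[OF le ns sm])
    also have "\<dots> = 3 * P t powr (1/p)" using suminf_mult2[OF third, of "P t powr (1/p)"] by (simp add: suminf_geometric)
    finally show ?thesis using ns by blast
  qed
  show AEs: "AE t in ?M. summable (\<lambda>k. norm (s k *\<^sub>R e k t))"
    using sa by eventually_elim (use key in blast)
  define x where "x t = (\<Sum>k. s k *\<^sub>R e k t)" for t
  have "AE t in ?M. (\<lambda>n. \<Sum>k<n. s k *\<^sub>R e k t) \<longlonglongrightarrow> x t"
    using AEs by eventually_elim (unfold x_def, rule summable_LIMSEQ, rule summable_norm_cancel)
  then have xm: "x measurable_on S"
    by (rule measurable_on_AE_limit[rotated 2]) (intro measurable_on_sum measurable_on_scaleR_const em, simp, rule SL)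
  have "integrable ?M (\<lambda>t. norm (x t) powr p)"
  proof (rule Bochner_Integration.integrable_bound)
    show "integrable ?M (\<lambda>t. 3 powr p * P t)" using Pi by simp
    show "(\<lambda>t. norm (x t) powr p) \<in> borel_measurable ?M" using measurable_on_norm[OF xm SL] by simp
    show "AE t in ?M. norm (norm (x t) powr p) \<le> norm (3 powr p * P t)"
      using sa
    proof eventually_elim
      fix t assume t: "summable (\<lambda>k. a k t)"
      have P0: "0 \<le> P t" unfolding P_def by (rule suminf_nonneg[OF t a0])
      have "norm (x t) powr p \<le> (3 * P t powr (1/p)) powr p"
        using key[OF t] p unfolding x_def by (intro powr_mono2) auto
      also have "\<dots> = 3 powr p * P t" using p P0 by (simp add: powr_mult powr_powr)
      finally show "norm (norm (x t) powr p) \<le> norm (3 powr p * P t)" using P0 by simp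
    qed
  qed
  with xm show "(\<lambda>t. \<Sum>k. s k *\<^sub>R e k t) \<in> Lp p S" by (simp add: Lp_def x_def[abs_def])
qed

lemma Lp_unit_integral:
  fixes f :: "real \<Rightarrow> 'b::real_normed_vector"
  assumes "f \<in> Lp p S" "(LINT t|lebesgue_on S. norm (f t) powr p) \<le> 1" "p \<ge> 1" "S \<in> lmeasurable"
  shows "(LINT t|lebesgue_on S. norm (f t)) \<le> measure lebesgue S + 1"
proof -
  let ?M = "lebesgue_on S"
  interpret finite_measure ?M using assms(4) by (rule finite_measure_lebesgue_on)
  have le: "norm y \<le> 1 + norm y powr p" for y :: 'b
    using powr_le_one_plus_powr[of 1 p "norm y"] assms(3) by simp
  have i: "integrable ?M (\<lambda>t. norm (f t) powr p)" using assms(1) by (simp add: Lp_def)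
  have "(LINT t|?M. norm (f t)) \<le> (LINT t|?M. 1 + norm (f t) powr p)"
    using i Lp_integrable_norm[OF assms(1,3,4)] le by (intro integral_mono) auto
  also have "\<dots> = measure ?M (space ?M) + (LINT t|?M. norm (f t) powr p)" using i by simp
  also have "measure ?M (space ?M) = measure lebesgue S"
    using assms(4) by (simp add: measure_restrict_space fmeasurableD)
  finally show ?thesis using assms(2) by simp
qed

section \<open>Uniform integrability of observations under condition (a)\<close>

context admissible_system
begin

lemma obs_norm_integrable:
  assumes z: "z \<in> D'" and E: "E \<in> sets lebesgue" "E \<subseteq> {0<..<T}"
  shows "integrable (lebesgue_on E) (\<lambda>\<tau>. norm (obs T z \<tau>))"
proof -
  obtain M where M: "\<And>\<tau>. \<tau> \<in> {0<..<T} \<Longrightarrow> norm (obs T z \<tau>) \<le> M"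
    using obs_bounded[OF z, of T] by blast
  have "E \<in> lmeasurable" by (rule fmeasurableI2[OF interval_lmeasurable E(2,1)])
  then interpret finite_measure "lebesgue_on E" by (rule finite_measure_lebesgue_on)
  have "obs T z measurable_on E" by (rule obs_measurable[OF z E(1)]) (use E(2) in auto)
  then have m: "(\<lambda>\<tau>. norm (obs T z \<tau>)) \<in> borel_measurable (lebesgue_on E)" by (rule measurable_on_norm[OF _ E(1)])
  show ?thesis
    by (rule integrable_const_bound[OF AE_I2 m, of M]) (use M E(2) in auto)
qed

lemma obs_norm_integral_mono:
  assumes z: "z \<in> D'" and "E \<in> sets lebesgue" "F \<in> sets lebesgue" "E \<subseteq> F" "F \<subseteq> {0<..<T}"
  shows "(LINT \<tau>|lebesgue_on E. norm (obs T z \<tau>)) \<le> (LINT \<tau>|lebesgue_on F. norm (obs T z \<tau>))"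
proof -
  have "(LINT \<tau>|lebesgue_on E. norm (obs T z \<tau>)) = (LINT \<tau>|lebesgue_on F. (if \<tau> \<in> E then norm (obs T z \<tau>) else 0))"
    by (rule integral_lebesgue_on_if(1)[symmetric]) (use assms in auto)
  also have "\<dots> \<le> (LINT \<tau>|lebesgue_on F. norm (obs T z \<tau>))"
    using assms obs_norm_integrable[OF z]
    by (intro integral_mono integral_lebesgue_on_if(2)[THEN iffD2]) auto
  finally show ?thesis .
qed

lemma Linf_obs_bound:
  assumes "v measurable_on E" "AE \<tau> in lebesgue_on E. norm (v \<tau>) \<le> r" "z \<in> D'" "E \<in> sets lebesgue" "E \<subseteq> {0<..<T}"
  shows "\<bar>LINT \<tau>|lebesgue_on E. v \<tau> \<bullet> obs T z \<tau>\<bar> \<le> r * (LINT \<tau>|lebesgue_on E. norm (obs T z \<tau>))"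
proof -
  have "obs T z measurable_on E" by (rule obs_measurable[OF assms(3,4)]) (use assms(5) in auto)
  from integrable_inner_bounded(2)[OF this obs_norm_integrable[OF assms(3-5)] assms(1,2,4)]
  show ?thesis by (simp add: inner_commute)
qed

text \<open>The inclusion yields a bounded control \<open>v\<close>, vanishing almost everywhere on
  (0, t), that reaches the same state as \<open>u\<close>. Both have the same pairings with
  \<open>obs T z\<close>, so a bound of \<open>v\<close> serves as \<open>R\<close>; it depends on
  \<open>u\<close> but not on \<open>z\<close>.\<close>

lemma reach_inf_pointwise_bound:
  assumes p: "p \<ge> 2" and sub: "reach_p \<Sigma> p T t \<subseteq> reach_inf \<Sigma> T t" and t: "0 < t" "t < T"
    and u: "u \<in> Lp p {0<..<t}"
  obtains R where "R \<ge> 0" "\<And>z. z \<in> D' \<Longrightarrow> \<bar>LINT \<tau>|lebesgue_on {0<..<t}. u \<tau> \<bullet> obs T z \<tau>\<bar>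
    \<le> R * (LINT \<tau>|lebesgue_on {t<..<T}. norm (obs T z \<tau>))"
proof -
  define u0 where "u0 \<tau> = (if \<tau> \<in> {0<..<t} then u \<tau> else 0)" for \<tau>
  have um: "u measurable_on {0<..<t}" and ui: "integrable (lebesgue_on {0<..<t}) (\<lambda>\<tau>. norm (u \<tau>) powr p)"
    using u by (auto simp: Lp_def)
  have "u0 measurable_on {0<..<t}"
    by (rule measurable_on_spike[OF um, of "{}"]) (auto simp: u0_def)
  then have u0m: "u0 measurable_on {0<..<T}"
    by (rule measurable_on_superset) (use t in \<open>auto simp: u0_def\<close>)
  have "integrable (lebesgue_on {0<..<T}) (\<lambda>\<tau>. if \<tau> \<in> {0<..<t} then norm (u \<tau>) powr p else 0)"
    using ui t by (subst integral_lebesgue_on_if(2)) auto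
  then have "integrable (lebesgue_on {0<..<T}) (\<lambda>\<tau>. norm (u0 \<tau>) powr p)"
    by (rule back_subst[of "integrable _"]) (auto simp: u0_def)
  then have u0: "u0 \<in> Lp p {0<..<T}" using u0m by (simp add: Lp_def)
  then have u02: "u0 \<in> Lp 2 {0<..<T}" by (rule Lp_mono[OF _ _ p]) auto
  have "state \<Sigma> T 0 u0 \<in> reach_p \<Sigma> p T t"
    unfolding reach_p_def using u0 by (auto simp: u0_def)
  with sub obtain v where v: "v \<in> Linf {0<..<T}" "AE s\<in>{0<..<t} in lebesgue. v s = 0" "state \<Sigma> T 0 u0 = state \<Sigma> T 0 v"
    unfolding reach_inf_def by blast
  have T: "T > 0" using t by simp
  obtain r where r: "r \<ge> 0" "v \<in> Linf_ball T r" using Linf_ballE[OF v(1) T] by blast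
  have vm: "v measurable_on {0<..<T}" and vr: "AE s in lebesgue_on {0<..<T}. norm (v s) \<le> r"
    using r by (auto simp: Linf_ball_def)
  have eq: "reach T u0 = reach T v" using v(3) by (simp add: state_eq)
  show thesis
  proof (rule that[OF r(1)])
    fix z assume z: "z \<in> D'"
    have "(LINT \<tau>|lebesgue_on {0<..<t}. u \<tau> \<bullet> obs T z \<tau>) = (LINT \<tau>|lebesgue_on {0<..<T}. u0 \<tau> \<bullet> obs T z \<tau>)"
      unfolding u0_def by (rule inner_obs_extend(1)[symmetric]) (use t z in auto)
    also have "\<dots> = reach T u0 \<bullet> z" using reach_L2[OF T] u02 z by metis
    also have "\<dots> = (LINT \<tau>|lebesgue_on {0<..<T}. v \<tau> \<bullet> obs T z \<tau>)"
      unfolding eq by (rule reach_inner[OF r(2) T r(1) z])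
    also have "\<dots> = (LINT \<tau>|lebesgue_on {0<..<T}. (if \<tau> \<in> {t<..<T} then v \<tau> \<bullet> obs T z \<tau> else 0))"
    proof (rule integral_cong_AE)
      show "(\<lambda>\<tau>. v \<tau> \<bullet> obs T z \<tau>) \<in> borel_measurable (lebesgue_on {0<..<T})"
        by (intro measurable_on_inner vm obs_interval_measurable z) simp
      show "(\<lambda>\<tau>. if \<tau> \<in> {t<..<T} then v \<tau> \<bullet> obs T z \<tau> else 0) \<in> borel_measurable (lebesgue_on {0<..<T})"
      proof (rule borel_measurable_integrable, subst integral_lebesgue_on_if(2))
        show "integrable (lebesgue_on {t<..<T}) (\<lambda>\<tau>. v \<tau> \<bullet> obs T z \<tau>)"
          by (rule integrable_lebesgue_on_subset[OF Linf_ball_inner_obs[OF r(2) z]]) (use t in auto)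
      qed (use t in auto)
      have "AE \<tau> in lebesgue. \<tau> \<noteq> t"
        using AE_not_in[of "{t}" lebesgue] by (simp add: negligible_iff_null_sets[symmetric])
      with v(2) have "AE \<tau> in lebesgue. \<tau> \<in> {0<..<T} \<longrightarrow> v \<tau> \<bullet> obs T z \<tau> = (if \<tau> \<in> {t<..<T} then v \<tau> \<bullet> obs T z \<tau> else 0)"
        by eventually_elim auto
      then show "AE \<tau> in lebesgue_on {0<..<T}. v \<tau> \<bullet> obs T z \<tau> = (if \<tau> \<in> {t<..<T} then v \<tau> \<bullet> obs T z \<tau> else 0)"
        by (simp add: AE_restrict_space_iff)
    qed
    also have "\<dots> = (LINT \<tau>|lebesgue_on {t<..<T}. v \<tau> \<bullet> obs T z \<tau>)"
      by (rule integral_lebesgue_on_if(1)) (use t in auto)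
    finally have "(LINT \<tau>|lebesgue_on {0<..<t}. u \<tau> \<bullet> obs T z \<tau>) = (LINT \<tau>|lebesgue_on {t<..<T}. v \<tau> \<bullet> obs T z \<tau>)" .
    moreover have "\<bar>LINT \<tau>|lebesgue_on {t<..<T}. v \<tau> \<bullet> obs T z \<tau>\<bar> \<le> r * (LINT \<tau>|lebesgue_on {t<..<T}. norm (obs T z \<tau>))"
    proof (rule Linf_obs_bound[OF _ _ z])
      show "v measurable_on {t<..<T}" by (rule measurable_on_subset[OF vm]) (use t in auto)
      show "AE \<tau> in lebesgue_on {t<..<T}. norm (v \<tau>) \<le> r" by (rule AE_lebesgue_on_subset[OF vr]) (use t in auto)
    qed (use t in auto)
    ultimately show "\<bar>LINT \<tau>|lebesgue_on {0<..<t}. u \<tau> \<bullet> obs T z \<tau>\<bar>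
      \<le> r * (LINT \<tau>|lebesgue_on {t<..<T}. norm (obs T z \<tau>))" by simp
  qed
qed

text \<open>This makes the bound for a single \<open>u\<close> uniform over the unit ball of
  \<open>L^p\<close>. If every constant \<open>4^n\<close> fails, there are \<open>z n\<close> whose
  pairings on that ball exceed \<open>4^n * \<nu> (z n)\<close>; the hump combination
  \<open>x\<close> of near-maximisers lies in \<open>L^p\<close> and contradicts the bound for
  \<open>u = x\<close>.\<close>

lemma obs_dual_bound:
  assumes p: "p \<ge> 2" and sub: "reach_p \<Sigma> p T t \<subseteq> reach_inf \<Sigma> T t" and t: "0 < t" "t < T"
  obtains C where "C \<ge> 0" "\<And>z e. z \<in> D' \<Longrightarrow> e \<in> Lp p {0<..<t} \<Longrightarrow>
    (LINT \<tau>|lebesgue_on {0<..<t}. norm (e \<tau>) powr p) \<le> 1 \<Longrightarrow>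
    \<bar>LINT \<tau>|lebesgue_on {0<..<t}. e \<tau> \<bullet> obs T z \<tau>\<bar> \<le> C * (LINT \<tau>|lebesgue_on {t<..<T}. norm (obs T z \<tau>))"
proof (rule ccontr)
  let ?M = "lebesgue_on {0<..<t}"
  define L where "L z e = (LINT \<tau>|?M. e \<tau> \<bullet> obs T z \<tau>)" for z e
  define \<nu> where "\<nu> z = (LINT \<tau>|lebesgue_on {t<..<T}. norm (obs T z \<tau>))" for z
  define U :: "(real \<Rightarrow> 'u) set" where "U = {e \<in> Lp p {0<..<t}. (LINT \<tau>|?M. norm (e \<tau>) powr p) \<le> 1}"
  have \<nu>0: "0 \<le> \<nu> z" for z unfolding \<nu>_def by (rule Bochner_Integration.integral_nonneg) simp
  have p1: "1 \<le> p" using p by simp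
  assume "\<not> thesis"
  then have "\<exists>z e. z \<in> D' \<and> e \<in> U \<and> 4^n * \<nu> z < \<bar>L z e\<bar>" for n
    using that[of "4^n"] unfolding U_def L_def \<nu>_def by (fastforce simp: not_le)
  then have "\<forall>n. \<exists>z e. z \<in> D' \<and> e \<in> U \<and> 4^n * \<nu> z < \<bar>L z e\<bar>" by blast
  from choice[OF this] obtain z where z: "\<And>n. z n \<in> D'" and big: "\<And>n. \<exists>e\<in>U. 4^n * \<nu> (z n) < \<bar>L (z n) e\<bar>"
    by blast
  have U_m: "e measurable_on {0<..<t}" and U_i: "integrable ?M (\<lambda>\<tau>. norm (e \<tau>))"
    and U_I: "(LINT \<tau>|?M. norm (e \<tau>)) \<le> t + 1" if "e \<in> U" for e
    using that Lp_integrable_norm[OF _ p1, of e "{0<..<t}"] Lp_unit_integral[OF _ _ p1, of e "{0<..<t}"] t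
    by (auto simp: U_def Lp_def)
  have obs_m: "obs T w measurable_on {0<..<t}" if "w \<in> D'" for w
    by (rule obs_measurable[OF that]) (use t in auto)
  have "\<exists>K\<ge>0. AE \<tau> in ?M. norm (obs T (z n) \<tau>) \<le> K" for n
  proof -
    obtain K where "K \<ge> 0" "AE \<tau> in lebesgue_on {0<..<T}. norm (obs T (z n) \<tau>) \<le> K"
      using obs_AE_bounded[OF z] by blast
    moreover from this(2) have "AE \<tau> in ?M. norm (obs T (z n) \<tau>) \<le> K"
      by (rule AE_lebesgue_on_subset) (use t in auto)
    ultimately show ?thesis by blast
  qed
  then obtain K where K: "\<And>n. K n \<ge> 0" "\<And>n. AE \<tau> in ?M. norm (obs T (z n) \<tau>) \<le> K n" by metis
  have L_int: "integrable ?M (\<lambda>\<tau>. e \<tau> \<bullet> obs T (z n) \<tau>)" and L_le: "\<bar>L (z n) e\<bar> \<le> K n * (t + 1)"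
    if e: "e \<in> U" for e n
  proof -
    show "integrable ?M (\<lambda>\<tau>. e \<tau> \<bullet> obs T (z n) \<tau>)"
      by (rule integrable_inner_bounded(1)[OF U_m[OF e] U_i[OF e] obs_m[OF z] K(2)]) simp
    have "\<bar>L (z n) e\<bar> \<le> K n * (LINT \<tau>|?M. norm (e \<tau>))"
      unfolding L_def by (rule integrable_inner_bounded(2)[OF U_m[OF e] U_i[OF e] obs_m[OF z] K(2)]) simp
    then show "\<bar>L (z n) e\<bar> \<le> K n * (t + 1)"
      using mult_left_mono[OF U_I[OF e] K(1)[of n]] by linarith
  qed
  \<comment> \<open>The norm of the functional given by \<open>z n\<close>. Passing from
    \<open>e\<close> to \<open>- e\<close> where necessary removes the absolute value, so that the
    diagonal of \<open>l\<close> is positive.\<close>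
  define \<sigma> where "\<sigma> n = (SUP e\<in>U. \<bar>L (z n) e\<bar>)" for n
  have bdd: "bdd_above ((\<lambda>e. \<bar>L (z n) e\<bar>) ` U)" for n by (rule bdd_aboveI2) (rule L_le)
  have \<sigma>_le: "\<bar>L (z n) e\<bar> \<le> \<sigma> n" if "e \<in> U" for e n
    unfolding \<sigma>_def by (rule cSUP_upper[OF that bdd])
  have \<sigma>_big: "4^n * \<nu> (z n) < \<sigma> n" for n using big[of n] \<sigma>_le by (meson less_le_trans)
  have \<sigma>_pos: "0 < \<sigma> n" for n
    using \<sigma>_big[of n] \<nu>0[of "z n"] by (meson le_less_trans mult_nonneg_nonneg zero_le_numeral zero_le_power)
  have U_ne: "U \<noteq> {}" using big by blast
  have "\<exists>e\<in>U. 3/4 * \<sigma> n < L (z n) e" for n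
  proof -
    have "3/4 * \<sigma> n < \<sigma> n" using \<sigma>_pos[of n] by simp
    then obtain e where e: "e \<in> U" "3/4 * \<sigma> n < \<bar>L (z n) e\<bar>"
      using less_cSUP_iff[OF U_ne bdd[of n], of "3/4 * \<sigma> n"] unfolding \<sigma>_def by blast
    show ?thesis
    proof (cases "L (z n) e \<ge> 0")
      case True
      then show ?thesis using e by auto
    next
      case False
      have "(\<lambda>\<tau>. - e \<tau>) \<in> U" using e(1) by (auto simp: U_def Lp_def measurable_on_minus)
      moreover have "L (z n) (\<lambda>\<tau>. - e \<tau>) = - L (z n) e" by (simp add: L_def)
      ultimately show ?thesis using e(2) False by (intro bexI[of _ "\<lambda>\<tau>. - e \<tau>"]) auto
    qed
  qed
  then obtain e where e: "\<And>n. e n \<in> U" and e_big: "\<And>n. 3/4 * \<sigma> n < L (z n) (e n)" by metis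
  define l where "l n k = L (z n) (e k)" for n k
  have l: "\<bar>l n k\<bar> \<le> 4/3 * l n n" for n k
  proof -
    have "\<bar>l n k\<bar> \<le> \<sigma> n" unfolding l_def by (rule \<sigma>_le[OF e])
    also have "\<dots> \<le> 4/3 * l n n" using e_big[of n] unfolding l_def by simp
    finally show ?thesis .
  qed
  note hump = hump_weight_bound[of l, OF l]
  define s where "s = hump_weight l"
  define x where "x \<tau> = (\<Sum>k. s k *\<^sub>R e k \<tau>)" for \<tau>
  have s: "\<bar>s k\<bar> = (1/3)^k" for k unfolding s_def by (rule hump(1))
  have eLp: "e k \<in> Lp p {0<..<t}" "(LINT \<tau>|?M. norm (e k \<tau>) powr p) \<le> 1" for k
    using e[of k] by (auto simp: U_def)
  have xsum: "AE \<tau> in ?M. summable (\<lambda>k. norm (s k *\<^sub>R e k \<tau>))" and xLp: "x \<in> Lp p {0<..<t}"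
    using weighted_series_Lp[OF interval_lmeasurable p1 eLp s] unfolding x_def[abs_def] by auto
  have Lx: "L (z n) x = (\<Sum>k. s k * l n k)" for n
  proof -
    define f where "f k \<tau> = s k * (e k \<tau> \<bullet> obs T (z n) \<tau>)" for k \<tau>
    have fi: "integrable ?M (f k)" for k unfolding f_def using L_int[OF e] by simp
    have fs: "AE \<tau> in ?M. summable (\<lambda>k. norm (f k \<tau>)) \<and> x \<tau> \<bullet> obs T (z n) \<tau> = (\<Sum>k. f k \<tau>)"
      using xsum
    proof eventually_elim
      fix \<tau> assume sm: "summable (\<lambda>k. norm (s k *\<^sub>R e k \<tau>))"
      have "summable (\<lambda>k. norm (s k *\<^sub>R e k \<tau>) * norm (obs T (z n) \<tau>))" by (rule summable_mult2[OF sm])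
      then have "summable (\<lambda>k. norm (f k \<tau>))"
      proof (rule summable_comparison_test')
        show "norm (norm (f k \<tau>)) \<le> norm (s k *\<^sub>R e k \<tau>) * norm (obs T (z n) \<tau>)" for k
          using Cauchy_Schwarz_ineq2[of "s k *\<^sub>R e k \<tau>" "obs T (z n) \<tau>"] by (simp add: f_def)
      qed
      moreover have "x \<tau> \<bullet> obs T (z n) \<tau> = (\<Sum>k. f k \<tau>)"
        unfolding x_def bounded_linear.suminf[OF bounded_linear_inner_left summable_norm_cancel[OF sm]]
        by (simp add: f_def)
      ultimately show "summable (\<lambda>k. norm (f k \<tau>)) \<and> x \<tau> \<bullet> obs T (z n) \<tau> = (\<Sum>k. f k \<tau>)" by blast
    qed
    have fI: "summable (\<lambda>k. LINT \<tau>|?M. norm (f k \<tau>))"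
    proof (rule summable_comparison_test')
      show "summable (\<lambda>k. (1/3)^k * (K n * (t + 1)))" by (intro summable_mult2 summable_geometric) simp
      fix k
      have "(LINT \<tau>|?M. norm (f k \<tau>)) \<le> (LINT \<tau>|?M. (1/3)^k * (K n * norm (e k \<tau>)))"
      proof (rule integral_mono_AE)
        show "integrable ?M (\<lambda>\<tau>. norm (f k \<tau>))" using fi by simp
        show "integrable ?M (\<lambda>\<tau>. (1/3)^k * (K n * norm (e k \<tau>)))" using U_i[OF e[of k]] by simp
        show "AE \<tau> in ?M. norm (f k \<tau>) \<le> (1/3)^k * (K n * norm (e k \<tau>))"
          using K(2)[of n]
        proof eventually_elim
          fix \<tau> assume "norm (obs T (z n) \<tau>) \<le> K n"
          then have "norm (e k \<tau>) * norm (obs T (z n) \<tau>) \<le> norm (e k \<tau>) * K n" by (rule mult_left_mono) simp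
          then have "\<bar>e k \<tau> \<bullet> obs T (z n) \<tau>\<bar> \<le> K n * norm (e k \<tau>)"
            using Cauchy_Schwarz_ineq2[of "e k \<tau>" "obs T (z n) \<tau>"] by (simp add: mult.commute)
          then show "norm (f k \<tau>) \<le> (1/3)^k * (K n * norm (e k \<tau>))"
            unfolding f_def real_norm_def abs_mult s by (rule mult_left_mono) simp
        qed
      qed
      also have "\<dots> = (1/3)^k * (K n * (LINT \<tau>|?M. norm (e k \<tau>)))" by simp
      also have "\<dots> \<le> (1/3)^k * (K n * (t + 1))"
        by (intro mult_left_mono U_I[OF e] K(1)) auto
      finally show "norm (LINT \<tau>|?M. norm (f k \<tau>)) \<le> (1/3)^k * (K n * (t + 1))" by simp
    qed
    have fs1: "AE \<tau> in ?M. summable (\<lambda>k. norm (f k \<tau>))" using fs by eventually_elim blast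
    have "L (z n) x = (LINT \<tau>|?M. (\<Sum>k. f k \<tau>))"
      unfolding L_def
    proof (rule integral_cong_AE)
      show "(\<lambda>\<tau>. x \<tau> \<bullet> obs T (z n) \<tau>) \<in> borel_measurable ?M"
        using xLp by (intro measurable_on_inner obs_m[OF z]) (auto simp: Lp_def)
      show "(\<lambda>\<tau>. \<Sum>k. f k \<tau>) \<in> borel_measurable ?M" by (rule borel_measurable_integrable[OF integrable_suminf[OF fi fs1 fI]])
    qed (use fs in \<open>eventually_elim, blast\<close>)
    also have "\<dots> = (\<Sum>k. integral\<^sup>L ?M (f k))" by (rule integral_suminf[OF fi fs1 fI])
    also have "\<dots> = (\<Sum>k. s k * l n k)" by (simp add: f_def[abs_def] l_def L_def)
    finally show ?thesis .
  qed
  obtain R where R: "R \<ge> 0" "\<And>w. w \<in> D' \<Longrightarrow> \<bar>L w x\<bar> \<le> R * \<nu> w"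
    using reach_inf_pointwise_bound[OF p sub t xLp] unfolding L_def \<nu>_def by blast
  have less: "(4/3)^n * \<nu> (z n) < 4 * (R * \<nu> (z n))" for n
  proof -
    have "(1/3)^n * (3/4 * \<sigma> n) \<le> (1/3)^n * l n n"
      using e_big[of n] unfolding l_def by (intro mult_left_mono) auto
    also have "\<dots> \<le> 3 * \<bar>L (z n) x\<bar>" using hump(3)[of n] unfolding Lx s_def by simp
    also have "\<dots> \<le> 3 * (R * \<nu> (z n))" using R(2)[OF z[of n]] by simp
    finally have "(1/3)^n * \<sigma> n \<le> 4 * (R * \<nu> (z n))" by (simp add: mult.commute)
    moreover have "(1/3)^n * (4^n * \<nu> (z n)) < (1/3)^n * \<sigma> n"
      using \<sigma>_big[of n] by (intro mult_strict_left_mono) auto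
    moreover have "(1/3)^n * (4^n * \<nu> (z n)) = (4/3)^n * \<nu> (z n)" by (simp add: power_divide)
    ultimately show ?thesis by linarith
  qed
  \<comment> \<open>Strictness of \<open>less\<close> excludes \<open>\<nu> (z n) = 0\<close>, so
    that this factor may be cancelled.\<close>
  have "(4/3)^n < 4 * R" for n
  proof -
    have "\<nu> (z n) \<noteq> 0" using less[of n] by auto
    with \<nu>0[of "z n"] have "0 < \<nu> (z n)" by simp
    then show ?thesis using less[of n] by (simp add: mult.assoc[symmetric])
  qed
  moreover obtain n where "4 * R < (4/3)^n" using real_arch_pow[of "4/3" "4 * R"] by auto
  ultimately show False by (meson less_asym)
qed

text \<open>\<open>obs_dual_bound\<close> is applied to the indicator of \<open>E\<close> times the
  softened sign of \<open>obs T z\<close>, scaled into the unit ball of \<open>L^p\<close>. The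
  scaling is the origin of the power \<open>1/p\<close>; letting \<open>\<delta>\<close> tend to 0
  removes the softening.\<close>

lemma obs_uniformly_integrable:
  assumes p: "p \<ge> 2" and sub: "reach_p \<Sigma> p T t \<subseteq> reach_inf \<Sigma> T t" and t: "0 < t" "t < T"
  obtains C where "C \<ge> 0" "\<And>z E. z \<in> D' \<Longrightarrow> E \<in> sets (lebesgue_on {0<..<t}) \<Longrightarrow>
    (LINT \<tau>|lebesgue_on {0<..<t}. indicator E \<tau> * norm (obs T z \<tau>))
      \<le> C * (LINT \<tau>|lebesgue_on {t<..<T}. norm (obs T z \<tau>)) * measure (lebesgue_on {0<..<t}) E powr (1/p)"
proof -
  let ?M = "lebesgue_on {0<..<t}"
  obtain C where C: "C \<ge> 0" "\<And>z e. z \<in> D' \<Longrightarrow> e \<in> Lp p {0<..<t} \<Longrightarrow>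
    (LINT \<tau>|?M. norm (e \<tau>) powr p) \<le> 1 \<Longrightarrow>
    \<bar>LINT \<tau>|?M. e \<tau> \<bullet> obs T z \<tau>\<bar> \<le> C * (LINT \<tau>|lebesgue_on {t<..<T}. norm (obs T z \<tau>))"
    using obs_dual_bound[OF p sub t] by blast
  interpret finite_measure ?M by (rule finite_measure_lebesgue_on) simp
  show thesis
  proof (rule that[OF C(1)])
    fix z E assume z: "z \<in> D'" and E: "E \<in> sets ?M"
    define f where "f = obs T z"
    define \<mu> where "\<mu> = measure ?M E"
    define \<nu> where "\<nu> = (LINT \<tau>|lebesgue_on {t<..<T}. norm (obs T z \<tau>))"
    have EL: "E \<in> sets lebesgue" using E by (simp add: sets_restrict_space_iff)
    have Esub: "E \<inter> {0<..<t} = E" using sets.sets_into_space[OF E] by (simp add: Int_absorb2)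
    have fm: "f measurable_on {0<..<t}" unfolding f_def by (rule obs_measurable[OF z]) (use t in auto)
    have fi: "integrable ?M (\<lambda>\<tau>. norm (f \<tau>))" unfolding f_def by (rule obs_norm_integrable[OF z]) (use t in auto)
    have Efi: "integrable ?M (\<lambda>\<tau>. indicator E \<tau> * norm (f \<tau>))"
      using integrable_mult_indicator[OF E fi] by simp
    have iE: "integrable ?M (\<lambda>\<tau>. indicator E \<tau> * c)" for c :: real
      using E by (intro integrable_mult_left integrable_real_indicator) (auto simp: less_top[symmetric])
    have IE: "(LINT \<tau>|?M. indicator E \<tau> * c) = \<mu> * c" for c :: real
      using E Esub by (simp add: \<mu>_def)
    have bound: "(LINT \<tau>|?M. indicator E \<tau> * norm (f \<tau>)) \<le> C * \<nu> * \<mu> powr (1/p) + \<delta> * \<mu>" if \<delta>: "\<delta> > 0" for \<delta>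
    proof (cases "\<mu> = 0")
      case True
      then have "E \<in> null_sets ?M" using E by (simp add: \<mu>_def null_setsI emeasure_eq_measure)
      then have "AE \<tau> in ?M. indicator E \<tau> * norm (f \<tau>) = 0"
        by (auto dest!: AE_not_in elim!: eventually_mono)
      then have "(LINT \<tau>|?M. indicator E \<tau> * norm (f \<tau>)) = (LINT \<tau>|?M. 0)"
        by (intro integral_cong_AE borel_measurable_integrable[OF Efi]) auto
      then show ?thesis using True by simp
    next
      case False
      then have \<mu>: "\<mu> > 0" by (simp add: \<mu>_def less_le)
      define c where "c = \<mu> powr (- (1/p))"
      have c: "c > 0" "c powr p * \<mu> = 1" "c * \<mu> powr (1/p) = 1"
      proof -
        have "c powr p = \<mu> powr (- 1)" using p by (simp add: c_def powr_powr)
        then show "c powr p * \<mu> = 1" using \<mu> by (simp add: powr_neg_one)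
        show "c * \<mu> powr (1/p) = 1" using \<mu> by (simp add: c_def powr_add[symmetric])
      qed (use \<mu> in \<open>simp add: c_def\<close>)
      define e where "e \<tau> = c *\<^sub>R (indicat_real E \<tau> *\<^sub>R soft_sgn \<delta> (f \<tau>))" for \<tau>
      have em: "e measurable_on {0<..<t}"
        unfolding e_def by (intro measurable_on_scaleR_const measurable_on_indicator measurable_on_soft_sgn \<delta> fm EL)
      have en: "norm (e \<tau>) powr p \<le> indicator E \<tau> * c powr p" for \<tau>
      proof (cases "\<tau> \<in> E")
        case True
        have "norm (e \<tau>) \<le> c * 1" using True c norm_soft_sgn[OF \<delta>, of "f \<tau>"] by (simp add: e_def)
        then show ?thesis using True p by (simp add: powr_mono2)
      qed (simp add: e_def)
      have ei: "integrable ?M (\<lambda>\<tau>. norm (e \<tau>) powr p)"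
        by (rule Bochner_Integration.integrable_bound[OF iE[of "c powr p"]])
           (use measurable_on_norm[OF em] en in \<open>auto intro!: AE_I2 simp: abs_mult\<close>)
      then have eLp: "e \<in> Lp p {0<..<t}" using em by (simp add: Lp_def)
      have "(LINT \<tau>|?M. norm (e \<tau>) powr p) \<le> (LINT \<tau>|?M. indicator E \<tau> * c powr p)"
        by (rule integral_mono[OF ei iE en])
      also have "\<dots> = 1" using c(2) by (simp only: IE mult.commute)
      finally have "\<bar>LINT \<tau>|?M. e \<tau> \<bullet> f \<tau>\<bar> \<le> C * \<nu>"
        unfolding f_def \<nu>_def by (rule C(2)[OF z eLp])
      moreover have "(LINT \<tau>|?M. c * (indicator E \<tau> * norm (f \<tau>) - indicator E \<tau> * \<delta>)) \<le> (LINT \<tau>|?M. e \<tau> \<bullet> f \<tau>)"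
      proof (rule integral_mono)
        show "integrable ?M (\<lambda>\<tau>. c * (indicator E \<tau> * norm (f \<tau>) - indicator E \<tau> * \<delta>))" using Efi iE by simp
        show "integrable ?M (\<lambda>\<tau>. e \<tau> \<bullet> f \<tau>)"
        proof -
          have "AE \<tau> in ?M. norm (e \<tau>) \<le> c"
          proof (rule AE_I2)
            show "norm (e \<tau>) \<le> c" for \<tau>
              using c norm_soft_sgn[OF \<delta>, of "f \<tau>"] by (simp add: e_def indicator_def)
          qed
          from integrable_inner_bounded(1)[OF fm fi em this] show ?thesis by (simp add: inner_commute)
        qed
        show "c * (indicator E \<tau> * norm (f \<tau>) - indicator E \<tau> * \<delta>) \<le> e \<tau> \<bullet> f \<tau>" for \<tau>
          using soft_sgn_inner[OF \<delta>, of "f \<tau>"] c(1) by (simp add: e_def indicator_def)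
      qed
      ultimately have "c * ((LINT \<tau>|?M. indicator E \<tau> * norm (f \<tau>)) - \<mu> * \<delta>) \<le> C * \<nu>"
        using Efi iE[of \<delta>] \<delta> Esub by (simp add: \<mu>_def)
      then have le: "\<mu> powr (1/p) * (c * ((LINT \<tau>|?M. indicator E \<tau> * norm (f \<tau>)) - \<mu> * \<delta>)) \<le> \<mu> powr (1/p) * (C * \<nu>)"
        by (rule mult_left_mono) simp
      have eq: "\<mu> powr (1/p) * (c * ((LINT \<tau>|?M. indicator E \<tau> * norm (f \<tau>)) - \<mu> * \<delta>))
          = (LINT \<tau>|?M. indicator E \<tau> * norm (f \<tau>)) - \<mu> * \<delta>"
        using c(3) by (simp add: mult.assoc[symmetric] mult.commute[of "\<mu> powr (1/p)" c])
      show ?thesis using le unfolding eq by (simp add: mult_ac)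
    qed
    have "(LINT \<tau>|?M. indicator E \<tau> * norm (f \<tau>)) \<le> C * \<nu> * \<mu> powr (1/p)"
    proof (rule field_le_epsilon)
      fix \<epsilon> :: real assume \<epsilon>: "\<epsilon> > 0"
      define \<delta> where "\<delta> = \<epsilon> / (\<mu> + 1)"
      have \<mu>0: "\<mu> \<ge> 0" by (simp add: \<mu>_def)
      then have \<delta>: "\<delta> > 0" "\<delta> * \<mu> \<le> \<epsilon>" using \<epsilon> by (auto simp: \<delta>_def field_simps)
      show "(LINT \<tau>|?M. indicator E \<tau> * norm (f \<tau>)) \<le> C * \<nu> * \<mu> powr (1/p) + \<epsilon>"
        using bound[OF \<delta>(1)] \<delta>(2) by linarith
    qed
    then show "(LINT \<tau>|?M. indicator E \<tau> * norm (obs T z \<tau>))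
      \<le> C * (LINT \<tau>|lebesgue_on {t<..<T}. norm (obs T z \<tau>)) * measure ?M E powr (1/p)"
      by (simp add: f_def \<nu>_def \<mu>_def)
  qed
qed

section \<open>Duality for the minimal norm and the maximum principle\<close>

lemma obs_dual_norm:
  assumes z: "z \<in> D'" and r: "r \<ge> 0" and T: "T > 0"
    and bound: "\<And>v. v \<in> Linf_ball T r \<Longrightarrow> reach T v \<bullet> z \<le> c"
  shows "r * (LINT \<tau>|lebesgue_on {0<..<T}. norm (obs T z \<tau>)) \<le> c"
proof (rule field_le_epsilon)
  let ?M = "lebesgue_on {0<..<T}"
  fix \<epsilon> :: real assume \<epsilon>: "\<epsilon> > 0"
  interpret finite_measure ?M by (rule finite_measure_lebesgue_on) simp
  \<comment> \<open>The control equal to \<open>r\<close> times the softened sign of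
    \<open>obs T z\<close> nearly attains the \<open>L^1\<close> norm: it misses by at most
    \<open>r * \<delta>\<close> pointwise, which costs \<open>r * \<delta> * T\<close> after
    integration.\<close>
  define \<delta> where "\<delta> = \<epsilon> / (r * T + 1)"
  have rT: "0 \<le> r * T" using r T by simp
  then have \<delta>: "\<delta> > 0" "r * (\<delta> * T) \<le> \<epsilon>"
    using \<epsilon> by (auto simp: \<delta>_def field_simps add_nonneg_pos)
  define f where "f = obs T z"
  define v where "v \<tau> = r *\<^sub>R soft_sgn \<delta> (f \<tau>)" for \<tau>
  have fm: "f measurable_on {0<..<T}" unfolding f_def by (rule obs_interval_measurable[OF z])
  have fi: "integrable ?M (\<lambda>\<tau>. norm (f \<tau>))" unfolding f_def by (rule obs_norm_integrable[OF z]) auto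
  have "norm (v \<tau>) \<le> r" for \<tau>
    using mult_left_mono[OF norm_soft_sgn[OF \<delta>(1), of "f \<tau>"] r] r by (simp add: v_def)
  then have v: "v \<in> Linf_ball T r"
    unfolding Linf_ball_def v_def by (auto intro!: measurable_on_scaleR_const measurable_on_soft_sgn \<delta> fm)
  have "(LINT \<tau>|?M. r * (norm (f \<tau>) - \<delta>)) \<le> (LINT \<tau>|?M. v \<tau> \<bullet> f \<tau>)"
  proof (rule integral_mono)
    show "integrable ?M (\<lambda>\<tau>. r * (norm (f \<tau>) - \<delta>))" using fi by simp
    show "integrable ?M (\<lambda>\<tau>. v \<tau> \<bullet> f \<tau>)" unfolding f_def by (rule Linf_ball_inner_obs[OF v z])
    show "r * (norm (f \<tau>) - \<delta>) \<le> v \<tau> \<bullet> f \<tau>" for \<tau>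
      using mult_left_mono[OF soft_sgn_inner[OF \<delta>(1), of "f \<tau>"] r] by (simp add: v_def)
  qed
  also have "\<dots> = reach T v \<bullet> z" unfolding f_def by (rule reach_inner[OF v T r z, symmetric])
  also have "\<dots> \<le> c" by (rule bound[OF v])
  also have "(LINT \<tau>|?M. r * (norm (f \<tau>) - \<delta>)) = r * (LINT \<tau>|?M. norm (f \<tau>)) - r * (\<delta> * T)"
    using fi T by (simp add: measure_restrict_space algebra_simps)
  finally show "r * (LINT \<tau>|?M. norm (obs T z \<tau>)) \<le> c + \<epsilon>" using \<delta>(2) by (simp add: f_def)
qed

text \<open>
  Separation takes place in the Hilbert space of states; the separating functional may be moved
  into \<open>D'\<close> because the set of states reachable with controls of norm at most \<open>r\<close> is bounded.
\<close>

lemma dual_witness: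
  assumes T: "T > 0" and N: "min_norm \<Sigma> T y = ereal N" and r: "0 \<le> r" "r < N"
  obtains z where "z \<in> D'" "(LINT \<tau>|lebesgue_on {0<..<T}. norm (obs T z \<tau>)) \<le> 1" "r < (- S T y) \<bullet> z"
proof -
  define y0 where "y0 = - S T y"
  define K where "K = reach T ` Linf_ball T r"
  obtain v where v: "v \<in> Linf_ball T N" "reach T v = y0" and N0: "N \<ge> 0"
  proof -
    have "min_norm \<Sigma> T y < \<infinity>" using N by simp
    then obtain v r' where "min_norm \<Sigma> T y = ereal r'" "r' \<ge> 0" "v \<in> Linf_ball T r'" "S T y + reach T v = 0"
      by (rule minimal_norm_control_exists[OF T])
    then show thesis using N by (intro that[of v]) (auto simp: y0_def eq_neg_iff_add_eq_0 add.commute)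
  qed
  have "convex K"
  proof (rule convexI)
    fix x x' and a b :: real assume x: "x \<in> K" "x' \<in> K" and ab: "0 \<le> a" "0 \<le> b" "a + b = 1"
    obtain w w' where w: "w \<in> Linf_ball T r" "w' \<in> Linf_ball T r" "x = reach T w" "x' = reach T w'"
      using x by (auto simp: K_def)
    have "\<bar>a\<bar> * r + \<bar>b\<bar> * r = r" using ab by (simp add: distrib_right[symmetric])
    then have "(\<lambda>t. a *\<^sub>R w t + b *\<^sub>R w' t) \<in> Linf_ball T r"
      using Linf_ball_combine[OF w(1,2), of a b] by simp
    moreover have "a *\<^sub>R x + b *\<^sub>R x' = reach T (\<lambda>t. a *\<^sub>R w t + b *\<^sub>R w' t)"
      unfolding w(3,4) by (rule reach_combine[OF w(1,2) T r(1), symmetric])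
    ultimately show "a *\<^sub>R x + b *\<^sub>R x' \<in> K" unfolding K_def by blast
  qed
  moreover have K0: "0 \<in> K"
    unfolding K_def using zero_Linf_ball[OF r(1), of T] reach_zero[of T] by (intro image_eqI[of _ _ "\<lambda>_. 0"]) auto
  moreover have "y0 \<notin> closure K"
  proof
    assume cl: "y0 \<in> closure K"
    obtain w where w: "w \<in> Linf_ball T r" "reach T w = y0"
    proof (rule Linf_ball_reach_closed[OF T r(1), of y0])
      fix \<epsilon> :: real assume \<epsilon>: "\<epsilon> > 0"
      then obtain x where x: "x \<in> K" "dist x y0 < \<epsilon>" using cl by (meson closure_approachable)
      then obtain w where "w \<in> Linf_ball T r" "x = reach T w" by (auto simp: K_def)
      then show "\<exists>w\<in>Linf_ball T (r + \<epsilon>). norm (reach T w - y0) \<le> \<epsilon>"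
        using x \<epsilon> by (intro bexI[of _ w]) (auto simp: dist_norm intro: Linf_ball_mono)
    qed
    then have "min_norm \<Sigma> T y \<le> ereal r" by (intro min_norm_le[OF _ T r(1)]) (auto simp: y0_def)
    then show False using N r by simp
  qed
  ultimately obtain \<zeta> c where \<zeta>: "\<And>x. x \<in> K \<Longrightarrow> x \<bullet> \<zeta> \<le> c" "c < y0 \<bullet> \<zeta>"
    using separate_point_convex[of K y0] by blast
  obtain R where R: "R \<ge> 0" "\<And>w. w \<in> Linf_ball T r \<Longrightarrow> norm (reach T w) \<le> R"
    using reach_bounded[OF T r(1)] by blast
  \<comment> \<open>Replacing \<open>\<zeta>\<close> by \<open>z\<close> shifts the values on
    \<open>K\<close> by at most \<open>R\<close> times the distance of \<open>z\<close> to
    \<open>\<zeta>\<close>, and the value at \<open>y0\<close> by at most \<open>norm y0\<close>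
    times it. With \<open>\<eta>\<close> as bound of the distance, both shifts together stay below
    the gap.\<close>
  define \<eta> where "\<eta> = (y0 \<bullet> \<zeta> - c) / (R + norm y0 + 1)"
  have den: "R + norm y0 + 1 > 0" using R(1) by (simp add: add_nonneg_pos)
  have \<eta>: "\<eta> > 0" unfolding \<eta>_def using \<zeta>(2) den by simp
  obtain z where z: "z \<in> D'" "norm (z - \<zeta>) < \<eta>"
    using dense_D' \<eta> by (metis UNIV_I closure_approachable dist_norm)
  have near: "\<bar>x \<bullet> z - x \<bullet> \<zeta>\<bar> \<le> norm x * norm (z - \<zeta>)" for x
    using Cauchy_Schwarz_ineq2[of x "z - \<zeta>"] by (simp add: inner_diff_right)
  define c' where "c' = c + R * norm (z - \<zeta>)"
  have c': "reach T w \<bullet> z \<le> c'" if "w \<in> Linf_ball T r" for w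
  proof -
    have "reach T w \<bullet> \<zeta> \<le> c" using that \<zeta>(1) by (auto simp: K_def)
    moreover have "norm (reach T w) * norm (z - \<zeta>) \<le> R * norm (z - \<zeta>)"
      using R(2)[OF that] by (intro mult_right_mono) auto
    ultimately show ?thesis using near[of "reach T w"] unfolding c'_def by linarith
  qed
  have gap: "c' < y0 \<bullet> z"
  proof -
    have "(R + norm y0) * norm (z - \<zeta>) \<le> (R + norm y0) * \<eta>"
      using z(2) R(1) by (intro mult_left_mono) auto
    also have "\<dots> < (R + norm y0 + 1) * \<eta>" using \<eta> by (simp add: distrib_right)
    also have "\<dots> = y0 \<bullet> \<zeta> - c" unfolding \<eta>_def using den by simp
    finally have "R * norm (z - \<zeta>) + norm y0 * norm (z - \<zeta>) < y0 \<bullet> \<zeta> - c" by (simp add: distrib_right)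
    then show ?thesis using near[of y0] unfolding c'_def by linarith
  qed
  define I where "I = (LINT \<tau>|lebesgue_on {0<..<T}. norm (obs T z \<tau>))"
  have I0: "0 \<le> I" unfolding I_def by (rule Bochner_Integration.integral_nonneg) simp
  have rI: "r * I \<le> c'" unfolding I_def by (rule obs_dual_norm[OF z(1) r(1) T c'])
  have "y0 \<bullet> z = (LINT \<tau>|lebesgue_on {0<..<T}. v \<tau> \<bullet> obs T z \<tau>)"
    unfolding v(2)[symmetric] by (rule reach_inner[OF v(1) T N0 z(1)])
  also have "\<dots> \<le> N * I"
  proof -
    have "\<bar>LINT \<tau>|lebesgue_on {0<..<T}. v \<tau> \<bullet> obs T z \<tau>\<bar> \<le> N * I"
      unfolding I_def by (rule Linf_obs_bound[OF _ _ z(1)]) (use v(1) in \<open>auto simp: Linf_ball_def\<close>)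
    then show ?thesis by linarith
  qed
  finally have yN: "y0 \<bullet> z \<le> N * I" .
  \<comment> \<open>\<open>I = 0\<close> would give \<open>y0 \<bullet> z \<le> 0 \<le> c'\<close>,
    against the gap; the minimal norm control \<open>v\<close> supplies the first inequality.
    Dividing \<open>z\<close> by \<open>I\<close> then normalises it.\<close>
  have I: "I > 0"
  proof (rule ccontr)
    assume "\<not> I > 0"
    then have "I = 0" using I0 by simp
    then show False using yN rI gap by simp
  qed
  show thesis
  proof (rule that)
    show "(1 / I) *\<^sub>R z \<in> D'" using A'_scaleR[OF z(1)] by blast
    have "(LINT \<tau>|lebesgue_on {0<..<T}. norm (obs T ((1 / I) *\<^sub>R z) \<tau>)) = (LINT \<tau>|lebesgue_on {0<..<T}. (1 / I) * norm (obs T z \<tau>))"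
      by (rule Bochner_Integration.integral_cong) (use I in \<open>auto simp: obs_scaleR[OF z(1)]\<close>)
    also have "\<dots> = 1" using I by (simp add: I_def)
    finally show "(LINT \<tau>|lebesgue_on {0<..<T}. norm (obs T ((1 / I) *\<^sub>R z) \<tau>)) \<le> 1" by simp
    have "r * I < y0 \<bullet> z" using rI gap by linarith
    then have "r < y0 \<bullet> z / I" using I by (simp add: pos_less_divide_eq)
    then show "r < (- S T y) \<bullet> ((1 / I) *\<^sub>R z)" by (simp add: y0_def)
  qed
qed

text \<open>
  Normalised dual near-optimal functions are uniformly integrable on \<open>(0, t)\<close>, so convex combinations
  converge to some \<open>g\<close> in \<open>Y_space \<Sigma> t\<close>, and the duality gap forces \<open>N \<bar>g\<bar> = \<langle>g, v\<rangle>\<close> there. Since the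
  state can be steered to \<open>0\<close> before time \<open>t\<close>, \<open>g\<close> does not vanish.
\<close>

lemma maximum_principle:
  assumes N: "min_norm \<Sigma> T y = ereal N" "N > 0"
    and v: "v \<in> Linf_ball T N" "reach T v = - S T y"
    and u: "u \<in> Linf_ball t' r" "r \<ge> 0" "S t' y + reach t' u = 0"
    and t: "0 < t'" "t' < t" "t < T"
    and p: "p \<ge> 2" and sub: "reach_p \<Sigma> p T t \<subseteq> reach_inf \<Sigma> T t"
  obtains g where "g \<in> Y_space \<Sigma> t" "AE \<tau> in lebesgue_on {0<..<t}. N * norm (g \<tau>) = v \<tau> \<bullet> g \<tau>"
    "\<not> (AE \<tau> in lebesgue_on {0<..<t}. g \<tau> = 0)"
proof -
  let ?M = "lebesgue_on {0<..<t}"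
  define y0 where "y0 = - S T y"
  have T: "T > 0" "0 < t" using t by auto
  have tT: "{0<..<t} \<subseteq> {0<..<T}" using t by auto
  interpret finite_measure ?M by (rule finite_measure_lebesgue_on) simp
  \<comment> \<open>Additivity of \<open>obs T\<close> in \<open>z\<close> holds up to time
    \<open>T\<close>. Cutting off outside (0, t) makes midpoints of members of \<open>C n\<close>
    members as functions, not merely almost everywhere.\<close>
  define f where "f z \<tau> = (if \<tau> \<in> {0<..<t} then obs T z \<tau> else 0)" for z \<tau>
  define I where "I z = (LINT \<tau>|lebesgue_on {0<..<T}. norm (obs T z \<tau>))" for z
  \<comment> \<open>Starting with \<open>\<epsilon> 0 = N\<close> keeps the levels
    \<open>N - \<epsilon> n\<close> nonnegative, as \<open>dual_witness\<close> requires.\<close>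
  define \<epsilon> where "\<epsilon> n = N / real (Suc n)" for n
  have \<epsilon>: "0 < \<epsilon> n" "\<epsilon> n \<le> N" for n using N by (auto simp: \<epsilon>_def field_simps)
  have \<epsilon>_lim: "\<epsilon> \<longlonglongrightarrow> 0"
    unfolding \<epsilon>_def using tendsto_mult_right_zero[OF LIMSEQ_Suc[OF lim_1_over_n], of N] by simp
  define Z where "Z n = {z \<in> D'. I z \<le> 1 \<and> N - \<epsilon> n \<le> y0 \<bullet> z}" for n
  define C where "C n = f ` Z n" for n
  have f_obs: "f z \<tau> = obs T z \<tau>" if "\<tau> \<in> {0<..<t}" for z \<tau> using that by (simp add: f_def)
  have fm: "f z measurable_on {0<..<t}" if "z \<in> D'" for z
    by (rule measurable_on_spike[OF obs_measurable[OF that], of _ _ "{}"]) (use t in \<open>auto simp: f_def\<close>)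
  have f_LINT: "(LINT \<tau>|?M. F \<tau> (f z \<tau>)) = (LINT \<tau>|?M. F \<tau> (obs T z \<tau>))" for F :: "real \<Rightarrow> 'u \<Rightarrow> real" and z
    by (rule Bochner_Integration.integral_cong) (auto simp: f_def)
  have fi: "integrable ?M (\<lambda>\<tau>. norm (f z \<tau>))" if "z \<in> D'" for z
  proof -
    have "integrable ?M (\<lambda>\<tau>. norm (obs T z \<tau>))" by (rule obs_norm_integrable[OF that]) (use tT in auto)
    then show ?thesis by (rule Bochner_Integration.integrable_cong[THEN iffD1, rotated 2]) (auto simp: f_def)
  qed
  obtain c where c: "c \<ge> 0" "\<And>z E. z \<in> D' \<Longrightarrow> E \<in> sets ?M \<Longrightarrow>
    (LINT \<tau>|?M. indicator E \<tau> * norm (obs T z \<tau>))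
      \<le> c * (LINT \<tau>|lebesgue_on {t<..<T}. norm (obs T z \<tau>)) * measure ?M E powr (1/p)"
    using obs_uniformly_integrable[OF p sub T(2) t(3)] by blast
  obtain h g where h: "\<And>n. h n \<in> C n" and g: "g measurable_on {0<..<t}"
    and hg: "\<And>n. integrable ?M (\<lambda>\<tau>. norm (h n \<tau> - g \<tau>))"
    and lim: "(\<lambda>n. LINT \<tau>|?M. norm (h n \<tau> - g \<tau>)) \<longlonglongrightarrow> 0"
  proof (rule uniformly_integrable_convex_limit[of "{0<..<t}" C c "1/p"])
    show "C n \<noteq> {}" for n
    proof -
      obtain z where "z \<in> D'" "I z \<le> 1" "N - \<epsilon> n < y0 \<bullet> z"
        unfolding I_def y0_def by (rule dual_witness[OF T(1) N(1), of "N - \<epsilon> n"]) (use \<epsilon>[of n] in auto)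
      then show ?thesis by (auto simp: C_def Z_def)
    qed
    show "decseq C"
      unfolding decseq_def
    proof (intro allI impI)
      fix m n :: nat assume mn: "m \<le> n"
      have "\<epsilon> n \<le> \<epsilon> m" unfolding \<epsilon>_def using mn N by (intro divide_left_mono) auto
      then have "Z n \<subseteq> Z m" by (auto simp: Z_def)
      then show "C n \<subseteq> C m" unfolding C_def by (rule image_mono)
    qed
    show "(\<lambda>\<tau>. (1/2) *\<^sub>R (a \<tau> + b \<tau>)) \<in> C n" if ab: "a \<in> C n" "b \<in> C n" for n a b
    proof -
      obtain z w where z: "z \<in> D'" "I z \<le> 1" "N - \<epsilon> n \<le> y0 \<bullet> z" "a = f z"
        and w: "w \<in> D'" "I w \<le> 1" "N - \<epsilon> n \<le> y0 \<bullet> w" "b = f w"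
        using ab by (auto simp: C_def Z_def)
      have zw: "z + w \<in> D'" "(1/2) *\<^sub>R (z + w) \<in> D'" using A'_add[OF z(1) w(1)] A'_scaleR by blast+
      have obs_mid: "obs T ((1/2) *\<^sub>R (z + w)) \<tau> = (1/2) *\<^sub>R (obs T z \<tau> + obs T w \<tau>)" if "\<tau> \<le> T" for \<tau>
        by (simp only: obs_scaleR[OF zw(1) that] obs_add[OF z(1) w(1) that])
      have "(\<lambda>\<tau>. (1/2) *\<^sub>R (a \<tau> + b \<tau>)) = f ((1/2) *\<^sub>R (z + w))"
        using t by (auto simp: f_def z w obs_mid)
      moreover have "I ((1/2) *\<^sub>R (z + w)) \<le> 1"
      proof -
        have iz: "integrable (lebesgue_on {0<..<T}) (\<lambda>\<tau>. norm (obs T x \<tau>))" if "x \<in> D'" for x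
          by (rule obs_norm_integrable[OF that]) auto
        have "I ((1/2) *\<^sub>R (z + w)) \<le> (LINT \<tau>|lebesgue_on {0<..<T}. (1/2) * (norm (obs T z \<tau>) + norm (obs T w \<tau>)))"
          unfolding I_def
        proof (rule integral_mono[OF iz[OF zw(2)]])
          show "integrable (lebesgue_on {0<..<T}) (\<lambda>\<tau>. (1/2) * (norm (obs T z \<tau>) + norm (obs T w \<tau>)))"
            using iz[OF z(1)] iz[OF w(1)] by simp
          fix \<tau> assume "\<tau> \<in> space (lebesgue_on {0<..<T})"
          then have "\<tau> \<le> T" by simp
          have "norm ((1/2) *\<^sub>R (obs T z \<tau> + obs T w \<tau>)) = (1/2) * norm (obs T z \<tau> + obs T w \<tau>)" by (simp only: norm_scaleR)
          also have "\<dots> \<le> (1/2) * (norm (obs T z \<tau>) + norm (obs T w \<tau>))" by (intro mult_left_mono norm_triangle_ineq) simp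
          finally show "norm (obs T ((1/2) *\<^sub>R (z + w)) \<tau>) \<le> (1/2) * (norm (obs T z \<tau>) + norm (obs T w \<tau>))"
            by (simp only: obs_mid[OF \<open>\<tau> \<le> T\<close>])
        qed
        also have "\<dots> = (1/2) * (I z + I w)" using iz[OF z(1)] iz[OF w(1)] by (simp add: I_def)
        also have "\<dots> \<le> 1" using z(2) w(2) by simp
        finally show ?thesis .
      qed
      moreover have "N - \<epsilon> n \<le> y0 \<bullet> ((1/2) *\<^sub>R (z + w))"
        using z(3) w(3) by (simp add: inner_add_right)
      ultimately show ?thesis using zw(2) unfolding C_def Z_def by blast
    qed
    show "a measurable_on {0<..<t}" "integrable ?M (\<lambda>\<tau>. norm (a \<tau>))" if "a \<in> C 0" for a
      using that fm fi by (auto simp: C_def Z_def)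
    show "(LINT \<tau>|?M. indicator E \<tau> * norm (a \<tau>)) \<le> c * measure ?M E powr (1/p)"
      if a: "a \<in> C 0" and E: "E \<in> sets ?M" for a E
    proof -
      obtain z where z: "z \<in> D'" "I z \<le> 1" "a = f z" using a by (auto simp: C_def Z_def)
      \<comment> \<open>The normalisation on all of (0, T) bounds the mass on (t, T) by 1, so that
        one constant \<open>c\<close> serves the whole of \<open>C 0\<close>.\<close>
      have "(LINT \<tau>|lebesgue_on {t<..<T}. norm (obs T z \<tau>)) \<le> I z"
        unfolding I_def by (rule obs_norm_integral_mono[OF z(1)]) (use t in auto)
      then have le1: "(LINT \<tau>|lebesgue_on {t<..<T}. norm (obs T z \<tau>)) \<le> 1" using z(2) by linarith
      have "(LINT \<tau>|?M. indicator E \<tau> * norm (a \<tau>)) = (LINT \<tau>|?M. indicator E \<tau> * norm (obs T z \<tau>))"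
        unfolding z(3) by (rule f_LINT)
      also have "\<dots> \<le> c * (LINT \<tau>|lebesgue_on {t<..<T}. norm (obs T z \<tau>)) * measure ?M E powr (1/p)"
        by (rule c(2)[OF z(1) E])
      also have "\<dots> \<le> c * 1 * measure ?M E powr (1/p)"
        by (intro mult_right_mono mult_left_mono le1 c(1)) simp
      finally show ?thesis by simp
    qed
  qed (use c p that in auto)
  have "\<forall>n. \<exists>z. z \<in> Z n \<and> h n = f z" using h by (auto simp: C_def)
  from choice[OF this] obtain z where z: "\<And>n. z n \<in> Z n" and hz: "\<And>n. h n = f (z n)" by blast
  have zD: "z n \<in> D'" and zI: "I (z n) \<le> 1" and zy: "N - \<epsilon> n \<le> y0 \<bullet> z n" for n
    using z[of n] by (auto simp: Z_def)
  have hm: "h n measurable_on {0<..<t}" and hi: "integrable ?M (\<lambda>\<tau>. norm (h n \<tau>))" for n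
    unfolding hz using fm fi zD by auto
  have gn: "(\<lambda>\<tau>. norm (g \<tau>)) \<in> borel_measurable ?M" by (rule measurable_on_norm[OF g]) simp
  have gi: "integrable ?M (\<lambda>\<tau>. norm (g \<tau>))"
  proof (rule Bochner_Integration.integrable_bound[OF Bochner_Integration.integrable_add[OF hg[of 0] hi[of 0]] gn])
    show "AE \<tau> in ?M. norm (norm (g \<tau>)) \<le> norm (norm (h 0 \<tau> - g \<tau>) + norm (h 0 \<tau>))"
      using norm_triangle_ineq2[of "g _" "h 0 _"] by (simp add: norm_minus_commute algebra_simps)
  qed
  have vt: "v measurable_on {0<..<t}" "AE \<tau> in ?M. norm (v \<tau>) \<le> N"
  proof -
    show "v measurable_on {0<..<t}"
      by (rule measurable_on_subset[of _ "{0<..<T}"]) (use v(1) tT in \<open>auto simp: Linf_ball_def\<close>)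
    show "AE \<tau> in ?M. norm (v \<tau>) \<le> N"
      by (rule AE_lebesgue_on_subset[where B="{0<..<T}"]) (use v(1) tT in \<open>auto simp: Linf_ball_def\<close>)
  qed
  have I_lim: "(\<lambda>n. LINT \<tau>|?M. norm (h n \<tau>)) \<longlonglongrightarrow> (LINT \<tau>|?M. norm (g \<tau>))"
  proof (rule LIM_zero_cancel, rule tendsto_rabs_zero_cancel, rule tendsto_sandwich[OF _ _ tendsto_const lim])
    show "\<forall>\<^sub>F n in sequentially. \<bar>(LINT \<tau>|?M. norm (h n \<tau>)) - (LINT \<tau>|?M. norm (g \<tau>))\<bar> \<le> (LINT \<tau>|?M. norm (h n \<tau> - g \<tau>))"
    proof (rule always_eventually, rule allI)
      fix n
      have "\<bar>(LINT \<tau>|?M. norm (h n \<tau>)) - (LINT \<tau>|?M. norm (g \<tau>))\<bar> = \<bar>LINT \<tau>|?M. norm (h n \<tau>) - norm (g \<tau>)\<bar>"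
        using hi gi by simp
      also have "\<dots> \<le> (LINT \<tau>|?M. \<bar>norm (h n \<tau>) - norm (g \<tau>)\<bar>)" by (rule integral_abs_bound)
      also have "\<dots> \<le> (LINT \<tau>|?M. norm (h n \<tau> - g \<tau>))"
        using hi gi hg by (intro integral_mono norm_triangle_ineq3) auto
      finally show "\<bar>(LINT \<tau>|?M. norm (h n \<tau>)) - (LINT \<tau>|?M. norm (g \<tau>))\<bar> \<le> (LINT \<tau>|?M. norm (h n \<tau> - g \<tau>))" .
    qed
  qed simp
  have vh_int: "integrable ?M (\<lambda>\<tau>. v \<tau> \<bullet> h n \<tau>)" and vg_int: "integrable ?M (\<lambda>\<tau>. v \<tau> \<bullet> g \<tau>)" for n
    using integrable_inner_bounded(1)[OF hm hi vt] integrable_inner_bounded(1)[OF g gi vt]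
    by (simp_all add: inner_commute)
  have V_lim: "(\<lambda>n. LINT \<tau>|?M. v \<tau> \<bullet> h n \<tau>) \<longlonglongrightarrow> (LINT \<tau>|?M. v \<tau> \<bullet> g \<tau>)"
  proof (rule LIM_zero_cancel, rule tendsto_rabs_zero_cancel,
      rule tendsto_sandwich[OF _ _ tendsto_const tendsto_mult_right_zero[OF lim, of N]])
    show "\<forall>\<^sub>F n in sequentially. \<bar>(LINT \<tau>|?M. v \<tau> \<bullet> h n \<tau>) - (LINT \<tau>|?M. v \<tau> \<bullet> g \<tau>)\<bar>
      \<le> N * (LINT \<tau>|?M. norm (h n \<tau> - g \<tau>))"
    proof (rule always_eventually, rule allI)
      fix n
      have "(LINT \<tau>|?M. v \<tau> \<bullet> h n \<tau>) - (LINT \<tau>|?M. v \<tau> \<bullet> g \<tau>) = (LINT \<tau>|?M. (h n \<tau> - g \<tau>) \<bullet> v \<tau>)"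
      proof -
        have "(h n \<tau> - g \<tau>) \<bullet> v \<tau> = v \<tau> \<bullet> h n \<tau> - v \<tau> \<bullet> g \<tau>" for \<tau>
          by (simp only: inner_diff_left inner_commute[of "v \<tau>"])
        then show ?thesis using vh_int vg_int by simp
      qed
      then show "\<bar>(LINT \<tau>|?M. v \<tau> \<bullet> h n \<tau>) - (LINT \<tau>|?M. v \<tau> \<bullet> g \<tau>)\<bar>
        \<le> N * (LINT \<tau>|?M. norm (h n \<tau> - g \<tau>))"
        using integrable_inner_bounded(2)[OF measurable_on_diff[OF hm[of n] g] hg vt] by simp
    qed
  qed simp
  \<comment> \<open>The integrand \<open>?q\<close> is nonnegative almost everywhere on (0, T), so
    restricting it to (0, t) can only decrease its integral; on (0, T) that integral is
    \<open>N * I (z n) - y0 \<bullet> z n\<close>.\<close>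
  have gap: "N * (LINT \<tau>|?M. norm (h n \<tau>)) - (LINT \<tau>|?M. v \<tau> \<bullet> h n \<tau>) \<le> \<epsilon> n" for n
  proof -
    let ?q = "\<lambda>\<tau>. N * norm (obs T (z n) \<tau>) - v \<tau> \<bullet> obs T (z n) \<tau>"
    have on_T: "integrable (lebesgue_on {0<..<T}) (\<lambda>\<tau>. norm (obs T (z n) \<tau>))"
        "integrable (lebesgue_on {0<..<T}) (\<lambda>\<tau>. v \<tau> \<bullet> obs T (z n) \<tau>)"
      by (rule obs_norm_integrable[OF zD]; auto) (rule Linf_ball_inner_obs[OF v(1) zD])
    then have qT: "integrable (lebesgue_on {0<..<T}) ?q" by simp
    have "N * (LINT \<tau>|?M. norm (h n \<tau>)) - (LINT \<tau>|?M. v \<tau> \<bullet> h n \<tau>) = (LINT \<tau>|?M. N * norm (h n \<tau>) - v \<tau> \<bullet> h n \<tau>)"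
      using hi[of n] vh_int[of n] by simp
    also have "\<dots> = (LINT \<tau>|?M. ?q \<tau>)" unfolding hz by (rule f_LINT)
    also have "\<dots> = (LINT \<tau>|lebesgue_on {0<..<T}. (if \<tau> \<in> {0<..<t} then ?q \<tau> else 0))"
      by (rule integral_lebesgue_on_if(1)[symmetric]) (use tT in auto)
    also have "\<dots> \<le> (LINT \<tau>|lebesgue_on {0<..<T}. ?q \<tau>)"
    proof (rule integral_mono_AE[OF _ qT])
      show "integrable (lebesgue_on {0<..<T}) (\<lambda>\<tau>. if \<tau> \<in> {0<..<t} then ?q \<tau> else 0)"
        by (rule integral_lebesgue_on_if(2)[THEN iffD2], rule tT, simp, simp,
            rule integrable_lebesgue_on_subset[OF qT tT]) simp_all
      have "AE \<tau> in lebesgue_on {0<..<T}. norm (v \<tau>) \<le> N" using v(1) by (simp add: Linf_ball_def)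
      then show "AE \<tau> in lebesgue_on {0<..<T}. (if \<tau> \<in> {0<..<t} then ?q \<tau> else 0) \<le> ?q \<tau>"
      proof eventually_elim
        fix \<tau> assume "norm (v \<tau>) \<le> N"
        then have "norm (v \<tau>) * norm (obs T (z n) \<tau>) \<le> N * norm (obs T (z n) \<tau>)" by (rule mult_right_mono) simp
        then have "0 \<le> ?q \<tau>" using norm_cauchy_schwarz[of "v \<tau>" "obs T (z n) \<tau>"] by linarith
        then show "(if \<tau> \<in> {0<..<t} then ?q \<tau> else 0) \<le> ?q \<tau>" by simp
      qed
    qed
    also have "\<dots> = N * I (z n) - y0 \<bullet> z n"
    proof -
      have "reach T v \<bullet> z n = (LINT \<tau>|lebesgue_on {0<..<T}. v \<tau> \<bullet> obs T (z n) \<tau>)"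
        by (rule reach_inner[OF v(1) T(1) _ zD]) (use N in simp)
      then show ?thesis using on_T by (simp add: I_def y0_def v(2))
    qed
    also have "\<dots> \<le> \<epsilon> n"
    proof -
      have "N * I (z n) \<le> N * 1" by (rule mult_left_mono[OF zI]) (use N(2) in simp)
      then show ?thesis using zy[of n] by simp
    qed
    finally show ?thesis .
  qed
  have "(\<lambda>n. N * (LINT \<tau>|?M. norm (h n \<tau>)) - (LINT \<tau>|?M. v \<tau> \<bullet> h n \<tau>))
    \<longlonglongrightarrow> N * (LINT \<tau>|?M. norm (g \<tau>)) - (LINT \<tau>|?M. v \<tau> \<bullet> g \<tau>)"
    by (intro tendsto_intros I_lim V_lim)
  then have "N * (LINT \<tau>|?M. norm (g \<tau>)) - (LINT \<tau>|?M. v \<tau> \<bullet> g \<tau>) \<le> 0"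
    by (rule LIMSEQ_le[OF _ \<epsilon>_lim]) (use gap in blast)
  then have q_le: "(LINT \<tau>|?M. N * norm (g \<tau>) - v \<tau> \<bullet> g \<tau>) \<le> 0" using gi vg_int by simp
  have q_int: "integrable ?M (\<lambda>\<tau>. N * norm (g \<tau>) - v \<tau> \<bullet> g \<tau>)" using gi vg_int by simp
  have q0: "AE \<tau> in ?M. 0 \<le> N * norm (g \<tau>) - v \<tau> \<bullet> g \<tau>"
    using vt(2)
  proof eventually_elim
    fix \<tau> assume "norm (v \<tau>) \<le> N"
    then have "norm (v \<tau>) * norm (g \<tau>) \<le> N * norm (g \<tau>)" by (rule mult_right_mono) simp
    then show "0 \<le> N * norm (g \<tau>) - v \<tau> \<bullet> g \<tau>" using norm_cauchy_schwarz[of "v \<tau>" "g \<tau>"] by linarith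
  qed
  have "(LINT \<tau>|?M. N * norm (g \<tau>) - v \<tau> \<bullet> g \<tau>) = 0"
    using q_le integral_nonneg_AE[OF q0] by linarith
  then have eqAE: "AE \<tau> in ?M. N * norm (g \<tau>) = v \<tau> \<bullet> g \<tau>"
    using integral_nonneg_eq_0_iff_AE[OF q_int q0] by simp
  \<comment> \<open>If \<open>g\<close> vanished, the mass of \<open>h n\<close> on (0, t) would
    tend to 0. But \<open>w\<close>, which is off after \<open>t'\<close>, reaches
    \<open>y0\<close>, so \<open>r\<close> times that mass bounds \<open>y0 \<bullet> z n\<close>,
    which is at least \<open>N - \<epsilon> n\<close>.\<close>
  have nonzero: "\<not> (AE \<tau> in ?M. g \<tau> = 0)"
  proof
    assume "AE \<tau> in ?M. g \<tau> = 0"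
    then have "AE \<tau> in ?M. norm (g \<tau>) = 0" by eventually_elim simp
    then have G0: "(LINT \<tau>|?M. norm (g \<tau>)) = 0" by (rule integral_eq_zero_AE)
    define w where "w \<tau> = (if \<tau> \<in> {0<..<t'} then u \<tau> else 0)" for \<tau>
    have "S T y + reach T w = 0"
      unfolding w_def by (rule null_control_extend[OF u(1) t(1) _ u(2,3)]) (use t in simp)
    then have w: "reach T w = y0" by (simp add: y0_def eq_neg_iff_add_eq_0 add.commute)
    have wb: "w \<in> Linf_ball T r"
      unfolding w_def by (rule extend_control(1)[OF u(1) t(1) _ u(2)]) (use t in simp)
    have le: "N - \<epsilon> n \<le> r * (LINT \<tau>|?M. norm (h n \<tau>))" for n
    proof -
      have "y0 \<bullet> z n = (LINT \<tau>|lebesgue_on {0<..<T}. w \<tau> \<bullet> obs T (z n) \<tau>)"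
        unfolding w[symmetric] by (rule reach_inner[OF wb T(1) u(2) zD])
      also have "\<dots> = (LINT \<tau>|lebesgue_on {0<..<t'}. u \<tau> \<bullet> obs T (z n) \<tau>)"
        unfolding w_def by (rule inner_obs_extend(1)) (use t zD in auto)
      also have "\<dots> \<le> r * (LINT \<tau>|lebesgue_on {0<..<t'}. norm (obs T (z n) \<tau>))"
      proof -
        have "\<bar>LINT \<tau>|lebesgue_on {0<..<t'}. u \<tau> \<bullet> obs T (z n) \<tau>\<bar> \<le> r * (LINT \<tau>|lebesgue_on {0<..<t'}. norm (obs T (z n) \<tau>))"
          by (rule Linf_obs_bound[OF _ _ zD]) (use u(1) t in \<open>auto simp: Linf_ball_def\<close>)
        then show ?thesis by linarith
      qed
      also have "\<dots> \<le> r * (LINT \<tau>|?M. norm (obs T (z n) \<tau>))"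
        by (intro mult_left_mono obs_norm_integral_mono[OF zD] u(2)) (use t in auto)
      also have "(LINT \<tau>|?M. norm (obs T (z n) \<tau>)) = (LINT \<tau>|?M. norm (h n \<tau>))"
        unfolding hz by (rule f_LINT[symmetric])
      finally show ?thesis using zy[of n] by linarith
    qed
    have 1: "(\<lambda>n. N - \<epsilon> n) \<longlonglongrightarrow> N - 0" by (intro tendsto_intros \<epsilon>_lim)
    have 2: "(\<lambda>n. r * (LINT \<tau>|?M. norm (h n \<tau>))) \<longlonglongrightarrow> r * 0" using I_lim unfolding G0 by (intro tendsto_intros)
    have "N - 0 \<le> r * 0" by (rule LIMSEQ_le[OF 1 2]) (use le in blast)
    then show False using N by simp
  qed
  have "g \<in> Y_space \<Sigma> t"
  proof -
    have "g \<in> Lp 1 {0<..<t}" using g gi by (simp add: Lp_def)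
    moreover have "\<exists>k\<in>X_space \<Sigma> t. Lp_norm 1 {0<..<t} (\<lambda>\<tau>. g \<tau> - k \<tau>) < \<delta>" if \<delta>: "\<delta> > 0" for \<delta>
    proof -
      have "\<forall>\<^sub>F n in sequentially. (LINT \<tau>|?M. norm (h n \<tau> - g \<tau>)) < \<delta>"
        by (rule order_tendstoD(2)[OF lim \<delta>])
      then obtain n where n: "(LINT \<tau>|?M. norm (h n \<tau> - g \<tau>)) < \<delta>"
        using eventually_happens trivial_limit_sequentially by blast
      \<comment> \<open>By \<open>obs_shift\<close> this equals \<open>h n\<close> on (0, t) and has
        final time \<open>t\<close>, as \<open>X_space \<Sigma> t\<close> requires.\<close>
      define k where "k = (\<lambda>\<tau>. B' (S' (t - \<tau>) (S' (T - t) (z n))))"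
      have "S' (T - t) (z n) \<in> D'" by (rule S'_in_D'[OF _ zD]) (use t in simp)
      then have "k \<in> X_space \<Sigma> t" unfolding X_space_def k_def by blast
      moreover have "Lp_norm 1 {0<..<t} (\<lambda>\<tau>. g \<tau> - k \<tau>) = (LINT \<tau>|?M. norm (h n \<tau> - g \<tau>))"
      proof -
        have "(LINT \<tau>|?M. norm (g \<tau> - k \<tau>) powr 1) = (LINT \<tau>|?M. norm (h n \<tau> - g \<tau>))"
        proof (rule Bochner_Integration.integral_cong)
          fix \<tau> assume "\<tau> \<in> space ?M"
          then have \<tau>: "\<tau> \<in> {0<..<t}" by simp
          then have "h n \<tau> = k \<tau>" using t obs_shift[of \<tau> t T "z n"] by (simp add: hz f_def k_def obs_def)
          then show "norm (g \<tau> - k \<tau>) powr 1 = norm (h n \<tau> - g \<tau>)" by (simp add: norm_minus_commute)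
        qed simp
        moreover have "0 \<le> (LINT \<tau>|?M. norm (h n \<tau> - g \<tau>))" by (rule Bochner_Integration.integral_nonneg) simp
        ultimately show ?thesis by (simp add: Lp_norm_def)
      qed
      ultimately show ?thesis using n by metis
    qed
    ultimately show ?thesis by (simp add: Y_space_def)
  qed
  then show thesis using eqAE nonzero by (rule that)
qed

text \<open>The zero set of \<open>g\<close> is null, since otherwise \<open>unique\<close> would
  make \<open>g\<close> vanish. Elsewhere
  \<open>N * norm (g \<tau>) = v \<tau> \<bullet> g \<tau>\<close> and Cauchy-Schwarz give
  \<open>N \<le> norm (v \<tau>)\<close>.\<close>

lemma bang_bang_interval:
  assumes N: "min_norm \<Sigma> T y = ereal N" "N > 0"
    and v: "v \<in> Linf_ball T N" "reach T v = - S T y"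
    and u: "u \<in> Linf_ball t' r" "r \<ge> 0" "S t' y + reach t' u = 0"
    and t: "0 < t'" "t' < t" "t < T"
    and p: "p \<ge> 2" and sub: "reach_p \<Sigma> p T t \<subseteq> reach_inf \<Sigma> T t"
    and unique: "\<And>E f. E \<in> sets lebesgue \<Longrightarrow> f \<in> Y_space \<Sigma> t \<Longrightarrow> E \<subseteq> {0<..<t} \<Longrightarrow>
      emeasure lebesgue E > 0 \<Longrightarrow> AE \<tau>\<in>E in lebesgue. f \<tau> = 0 \<Longrightarrow> AE \<tau>\<in>{0<..<t} in lebesgue. f \<tau> = 0"
  shows "AE \<tau> in lebesgue_on {0<..<t}. norm (v \<tau>) = N"
proof -
  let ?M = "lebesgue_on {0<..<t}"
  obtain g where g: "g \<in> Y_space \<Sigma> t" and eq: "AE \<tau> in ?M. N * norm (g \<tau>) = v \<tau> \<bullet> g \<tau>"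
    and nonzero: "\<not> (AE \<tau> in ?M. g \<tau> = 0)"
    by (rule maximum_principle[OF N v u t p sub])
  have gn: "(\<lambda>\<tau>. norm (g \<tau>)) \<in> borel_measurable ?M"
    using g by (intro measurable_on_norm) (auto simp: Y_space_def Lp_def)
  define E where "E = {\<tau> \<in> space ?M. norm (g \<tau>) = 0}"
  have EM: "E \<in> sets ?M" unfolding E_def using gn by measurable
  then have EL: "E \<in> sets lebesgue" by (simp add: sets_restrict_space_iff)
  have Esub: "E \<subseteq> {0<..<t}" by (auto simp: E_def)
  have "AE \<tau>\<in>E in lebesgue. g \<tau> = 0" by (rule AE_I2) (auto simp: E_def)
  with nonzero unique[OF EL g Esub] have "emeasure lebesgue E = 0"
    by (auto simp: AE_restrict_space_iff zero_less_iff_neq_zero)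
  then have "E \<in> null_sets lebesgue" using EL by (simp add: null_setsI)
  then have "AE \<tau> in lebesgue. \<tau> \<notin> E" by (rule AE_not_in)
  then have "AE \<tau> in lebesgue. \<tau> \<in> {0<..<t} \<longrightarrow> g \<tau> \<noteq> 0"
    by eventually_elim (auto simp: E_def)
  then have gne: "AE \<tau> in ?M. g \<tau> \<noteq> 0" by (simp add: AE_restrict_space_iff)
  have "AE \<tau> in ?M. norm (v \<tau>) \<le> N"
    by (rule AE_lebesgue_on_subset[where B="{0<..<T}"]) (use v(1) t in \<open>auto simp: Linf_ball_def\<close>)
  with eq gne show ?thesis
  proof eventually_elim
    fix \<tau> assume a: "N * norm (g \<tau>) = v \<tau> \<bullet> g \<tau>" "g \<tau> \<noteq> 0" "norm (v \<tau>) \<le> N"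
    have "N * norm (g \<tau>) \<le> norm (v \<tau>) * norm (g \<tau>)" using a(1) norm_cauchy_schwarz[of "v \<tau>" "g \<tau>"] by simp
    then have "N \<le> norm (v \<tau>)" using a(2) by simp
    with a(3) show "norm (v \<tau>) = N" by simp
  qed
qed

text \<open>Being before \<open>T1\<close>, the free state \<open>S T y\<close> is nonzero, which
  rules out the null control and makes the minimal norm positive. Being after \<open>T0\<close>
  leaves room for a control that finishes at some \<open>t' < T\<close>; the interval (0, T) is then
  exhausted by intervals (0, t k) with \<open>t k\<close> between \<open>t'\<close> and
  \<open>T\<close>.\<close>

lemma W_bang_bang:
  assumes W: "(T, y) \<in> W23 \<Sigma> \<union> W32 \<Sigma>"
    and p: "p \<ge> 2" and sub: "\<And>T t. 0 < t \<Longrightarrow> t < T \<Longrightarrow> reach_p \<Sigma> p T t \<subseteq> reach_inf \<Sigma> T t"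
    and unique: "\<And>T E f. T > 0 \<Longrightarrow> E \<in> sets lebesgue \<Longrightarrow> f \<in> Y_space \<Sigma> T \<Longrightarrow> E \<subseteq> {0<..<T} \<Longrightarrow>
      emeasure lebesgue E > 0 \<Longrightarrow> AE \<tau>\<in>E in lebesgue. f \<tau> = 0 \<Longrightarrow> AE \<tau>\<in>{0<..<T} in lebesgue. f \<tau> = 0"
  shows "bang_bang \<Sigma> T y" "\<not> minimal_norm_control \<Sigma> T y (\<lambda>_. 0)"
proof -
  have T: "T > 0" and y: "y \<noteq> 0" and T0: "T0 \<Sigma> y < ereal T" and T1: "ereal T < T1 \<Sigma> y"
    using W by (auto simp: W_def W2_def W3_def W23_def W32_def)
  have Sy: "S T y \<noteq> 0" using S_nonzero_of_less_T1[OF T1] T by simp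
  then show "\<not> minimal_norm_control \<Sigma> T y (\<lambda>_. 0)"
    using T by (auto simp: minimal_norm_control_def admissible_control_iff reach_zero)
  obtain t' u r where t': "0 < t'" "t' < T" and u: "u \<in> Linf_ball t' r" "r \<ge> 0" "S t' y + reach t' u = 0"
    using T0_less[OF T0 y] by metis
  define w where "w = (\<lambda>\<tau>. if \<tau> \<in> {0<..<t'} then u \<tau> else 0)"
  have w: "w \<in> Linf_ball T r" "S T y + reach T w = 0"
    unfolding w_def using extend_control(1)[OF u(1) t'(1) _ u(2)] null_control_extend[OF u(1) t'(1) _ u(2,3)] t' by auto
  then have adm: "admissible_control \<Sigma> T y w" using u(2) by (auto simp: admissible_control_iff[OF T])
  have "min_norm \<Sigma> T y \<le> ereal r" by (rule min_norm_le[OF w(1) T u(2) w(2)])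
  then have "min_norm \<Sigma> T y < \<infinity>" by auto
  then obtain N where N: "min_norm \<Sigma> T y = ereal N" "N \<ge> 0"
    using minimal_norm_control_exists[OF T] by metis
  have "N \<noteq> 0"
  proof
    assume "N = 0"
    then have "min_norm \<Sigma> T y = 0" using N by simp
    then show False using min_norm_eq_0_imp[OF T] Sy by blast
  qed
  then have N0: "N > 0" using N by simp
  show "bang_bang \<Sigma> T y"
    unfolding bang_bang_def
  proof (intro conjI allI impI)
    show "\<exists>v. admissible_control \<Sigma> T y v" using adm by blast
    fix v assume min: "minimal_norm_control \<Sigma> T y v"
    then have "v measurable_on {0<..<T}" "Linf_norm {0<..<T} v \<le> ereal N" and vS: "S T y + reach T v = 0"
      using N(1) by (auto simp: minimal_norm_control_def admissible_control_def Linf_def state_eq)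
    then have v: "v \<in> Linf_ball T N" by (simp add: Linf_ball_iff)
    have vr: "reach T v = - S T y" using vS by (simp add: eq_neg_iff_add_eq_0 add.commute)
    \<comment> \<open>The denominators start at 2, so that already \<open>t 0\<close> lies strictly
      after \<open>t'\<close>.\<close>
    define t where "t k = T - (T - t') / (real k + 2)" for k
    have t: "t' < t k" "t k < T" for k
    proof -
      have "T - t' > 0" using t' by simp
      then have "(T - t') / (real k + 2) < T - t'" "(T - t') / (real k + 2) > 0"
        by (simp_all add: pos_divide_less_eq)
      then show "t' < t k" "t k < T" unfolding t_def by linarith+
    qed
    have "AE \<tau> in lebesgue. \<tau> \<in> {0<..<t k} \<longrightarrow> norm (v \<tau>) = N" for k
    proof -
      have tk: "0 < t k" using t'(1) t(1)[of k] by linarith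
      have "AE \<tau> in lebesgue_on {0<..<t k}. norm (v \<tau>) = N"
        by (rule bang_bang_interval[OF N(1) N0 v vr u t'(1) t p sub[OF tk t(2)] unique[OF tk]])
      then show ?thesis by (simp add: AE_restrict_space_iff)
    qed
    then have "AE \<tau> in lebesgue. \<forall>k. \<tau> \<in> {0<..<t k} \<longrightarrow> norm (v \<tau>) = N"
      unfolding AE_all_countable by (rule allI)
    then show "AE \<tau>\<in>{0<..<T} in lebesgue. ereal (norm (v \<tau>)) = min_norm \<Sigma> T y"
    proof eventually_elim
      fix \<tau> assume all: "\<forall>k. \<tau> \<in> {0<..<t k} \<longrightarrow> norm (v \<tau>) = N"
      show "\<tau> \<in> {0<..<T} \<longrightarrow> ereal (norm (v \<tau>)) = min_norm \<Sigma> T y"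
      proof
        assume \<tau>: "\<tau> \<in> {0<..<T}"
        obtain k where "(T - t') / (T - \<tau>) < real k" using reals_Archimedean2 by blast
        then have "(T - t') / (T - \<tau>) < real k + 2" by linarith
        then have "(T - t') / (real k + 2) < T - \<tau>" using \<tau> by (simp add: field_simps)
        then have "\<tau> < t k" unfolding t_def by linarith
        then have "norm (v \<tau>) = N" using all[rule_format, of k] \<tau> by simp
        then show "ereal (norm (v \<tau>)) = min_norm \<Sigma> T y" using N by simp
      qed
    qed
  qed
qed

end

theorem theorem1p4:
  fixes \<Sigma> :: "('x::{real_inner, banach}, 'u::{real_inner, banach}) ctrl_sys"
  assumes "control_system \<Sigma>"
  shows
    \<comment> \<open>(i)\<close>
    "((W :: (real \<times> 'x) set) =
        W11 \<Sigma> \<union> W12 \<Sigma> \<union> W21 \<Sigma> \<union> W22 \<Sigma> \<union> W23 \<Sigma> \<union> W24 \<Sigma> \<union> W31 \<Sigma> \<union> W32 \<Sigma> \<union> W33 \<Sigma> \<union> W34 \<Sigma> \<and>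
      sorted_wrt disjnt
        [W11 \<Sigma>, W12 \<Sigma>, W21 \<Sigma>, W22 \<Sigma>, W23 \<Sigma>, W24 \<Sigma>, W31 \<Sigma>, W32 \<Sigma>, W33 \<Sigma>, W34 \<Sigma>])
     \<and>
     \<comment> \<open>(ii)\<close>
     (\<forall>(T, y0) \<in> W12 \<Sigma> \<union> W24 \<Sigma> \<union> W33 \<Sigma>.
        bang_bang \<Sigma> T y0 \<and>
        minimal_norm_control \<Sigma> T y0 (\<lambda>_. 0) \<and>
        (\<forall>v. minimal_norm_control \<Sigma> T y0 v \<longrightarrow> (AE t\<in>{0<..<T} in lebesgue. v t = 0)))
     \<and>
     \<comment> \<open>(iii)\<close>
     ((\<exists>p0\<ge>2. \<forall>T t. 0 < t \<and> t < T \<longrightarrow> reach_p \<Sigma> p0 T t \<subseteq> reach_inf \<Sigma> T t) \<and>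
      (\<forall>T>0. \<forall>E\<in>sets lebesgue. \<forall>f\<in>Y_space \<Sigma> T.
         E \<subseteq> {0<..<T} \<and> emeasure lebesgue E > 0 \<and> (AE t\<in>E in lebesgue. f t = 0) \<longrightarrow>
         (AE t\<in>{0<..<T} in lebesgue. f t = 0))
      \<longrightarrow>
      (\<forall>(T, y0) \<in> W23 \<Sigma> \<union> W32 \<Sigma>.
         bang_bang \<Sigma> T y0 \<and> \<not> minimal_norm_control \<Sigma> T y0 (\<lambda>_. 0)))
     \<and>
     \<comment> \<open>(iv)\<close>
     (\<forall>(T, y0) \<in> W11 \<Sigma> \<union> W21 \<Sigma> \<union> W31 \<Sigma> \<union> W34 \<Sigma>.
        \<not> (\<exists>v. admissible_control \<Sigma> T y0 v) \<and> \<not> bang_bang \<Sigma> T y0)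
     \<and>
     \<comment> \<open>(v)\<close>
     (\<forall>(T, y0) \<in> W22 \<Sigma>. \<exists>v. minimal_norm_control \<Sigma> T y0 v)"
proof -
  interpret admissible_system \<Sigma> by unfold_locales (rule assms)
  show ?thesis
  proof (intro conjI)
    show "(W :: (real \<times> 'x) set) =
        W11 \<Sigma> \<union> W12 \<Sigma> \<union> W21 \<Sigma> \<union> W22 \<Sigma> \<union> W23 \<Sigma> \<union> W24 \<Sigma> \<union> W31 \<Sigma> \<union> W32 \<Sigma> \<union> W33 \<Sigma> \<union> W34 \<Sigma>"
      using W_decomposition by (rule conjunct1)
    show "sorted_wrt disjnt
        [W11 \<Sigma>, W12 \<Sigma>, W21 \<Sigma>, W22 \<Sigma>, W23 \<Sigma>, W24 \<Sigma>, W31 \<Sigma>, W32 \<Sigma>, W33 \<Sigma>, W34 \<Sigma>]"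
      using W_decomposition by (rule conjunct2)
    show "\<forall>(T, y0) \<in> W12 \<Sigma> \<union> W24 \<Sigma> \<union> W33 \<Sigma>.
        bang_bang \<Sigma> T y0 \<and>
        minimal_norm_control \<Sigma> T y0 (\<lambda>_. 0) \<and>
        (\<forall>v. minimal_norm_control \<Sigma> T y0 v \<longrightarrow> (AE t\<in>{0<..<T} in lebesgue. v t = 0))"
    proof (rule ballI, clarify)
      fix T y0 assume "(T, y0) \<in> W12 \<Sigma> \<union> W24 \<Sigma> \<union> W33 \<Sigma>"
      from null_control_optimal[OF W_null_control[OF this]]
      show "bang_bang \<Sigma> T y0 \<and>
        minimal_norm_control \<Sigma> T y0 (\<lambda>_. 0) \<and>
        (\<forall>v. minimal_norm_control \<Sigma> T y0 v \<longrightarrow> (AE t\<in>{0<..<T} in lebesgue. v t = 0))"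
        by blast
    qed
    show "(\<exists>p0\<ge>2. \<forall>T t. 0 < t \<and> t < T \<longrightarrow> reach_p \<Sigma> p0 T t \<subseteq> reach_inf \<Sigma> T t) \<and>
      (\<forall>T>0. \<forall>E\<in>sets lebesgue. \<forall>f\<in>Y_space \<Sigma> T.
         E \<subseteq> {0<..<T} \<and> emeasure lebesgue E > 0 \<and> (AE t\<in>E in lebesgue. f t = 0) \<longrightarrow>
         (AE t\<in>{0<..<T} in lebesgue. f t = 0))
      \<longrightarrow>
      (\<forall>(T, y0) \<in> W23 \<Sigma> \<union> W32 \<Sigma>.
         bang_bang \<Sigma> T y0 \<and> \<not> minimal_norm_control \<Sigma> T y0 (\<lambda>_. 0))"
    proof (rule impI, elim conjE exE, rule ballI, clarify)
      fix p0 T y0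
      assume p: "2 \<le> p0" and sub: "\<forall>T t. 0 < t \<and> t < T \<longrightarrow> reach_p \<Sigma> p0 T t \<subseteq> reach_inf \<Sigma> T t"
        and unique: "\<forall>T>0. \<forall>E\<in>sets lebesgue. \<forall>f\<in>Y_space \<Sigma> T.
         E \<subseteq> {0<..<T} \<and> emeasure lebesgue E > 0 \<and> (AE t\<in>E in lebesgue. f t = 0) \<longrightarrow>
         (AE t\<in>{0<..<T} in lebesgue. f t = 0)"
        and W: "(T, y0) \<in> W23 \<Sigma> \<union> W32 \<Sigma>"
      show "bang_bang \<Sigma> T y0 \<and> \<not> minimal_norm_control \<Sigma> T y0 (\<lambda>_. 0)"
        using W_bang_bang[OF W p] sub unique by blast
    qed
    show "\<forall>(T, y0) \<in> W11 \<Sigma> \<union> W21 \<Sigma> \<union> W31 \<Sigma> \<union> W34 \<Sigma>.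
        \<not> (\<exists>v. admissible_control \<Sigma> T y0 v) \<and> \<not> bang_bang \<Sigma> T y0"
      using W_no_control unfolding bang_bang_def by blast
    show "\<forall>(T, y0) \<in> W22 \<Sigma>. \<exists>v. minimal_norm_control \<Sigma> T y0 v"
      using W22_minimal_norm_control by blast
  qed
qed

end
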